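(* If $D\subset\mathbb{E}^2$ is a two-dimensional convex domain which is neither a parallelogram nor a centrally symmetric hexagon, then $$\tau(D)\ge 5.$$ Moreover, equality is attained both by some octagon and by some decagon: there exists a centrally symmetric convex octagon $D$ with $\tau(D)=5$, and there exists a centrally symmetric convex decagon $D$ with $\tau(D)=5$.
   Context: $\mathbb{E}^2$ is the Euclidean plane. A (two-dimensional) convex domain is a compact convex subset of $\mathbb{E}^2$ with nonempty interior; $\mathrm{int}(K)$ denotes the interior of $K$. Octagons, decagons, hexagons are convex polygons with exactly $8$, $10$, $6$ vertices respectively. Let $X$ be a discrete multiset in $\mathbb{E}^2$ (points may be repeated; every bounded set contains only finitely many elements, counted with multiplicity) and let $k$ be a positive integer. $K+X$ is called a $k$-fold translative tiling of $\mathbb{E}^2$ if every point of $\mathbb{E}^2$ belongs to at least $k$ of the translates $K+\mathbf{x}$, $\mathbf{x}\in X$, and every point of $\mathbb{E}^2$ belongs to at most $k$ of the translates $\mathrm{int}(K)+\mathbf{x}$, $\mathbf{x}\in X$ (translates counted with multiplicity). For a convex domain $D$, $\tau(D)$ is the smallest positive integer $k$ such that there is a discrete multiset $X$ for which $D+X$ is a $k$-fold translative tiling of $\mathbb{E}^2$; $\tau(D)=\infty$ if no such $k$ exists. *)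

theory Defs
  imports "HOL-Analysis.Analysis" "HOL-Library.Extended_Nat"
begin

type_synonym plane = "real^2"

definition convex_domain :: "plane set \<Rightarrow> bool" where
  "convex_domain K \<longleftrightarrow> compact K \<and> convex K \<and> interior K \<noteq> {}"

definition centrally_symmetric :: "plane set \<Rightarrow> bool" where
  "centrally_symmetric K \<longleftrightarrow> (\<exists>c. (\<lambda>x. 2 *\<^sub>R c - x) ` K = K)"

definition parallelogram :: "plane set \<Rightarrow> bool" where
  "parallelogram K \<longleftrightarrow>
     (\<exists>a u v. \<not> collinear {0, u, v} \<and> K = convex hull {a, a + u, a + u + v, a + v})"

definition convex_ngon :: "nat \<Rightarrow> plane set \<Rightarrow> bool" where
  "convex_ngon n K \<longleftrightarrow>
     convex_domain K \<and> polytope K \<and> card {v. v extreme_point_of K} = n"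

text \<open>A multiset of points, possibly infinite, is given by its multiplicity function;
  the library type of multisets only contains finite ones.\<close>

definition discrete_mset :: "(plane \<Rightarrow> nat) \<Rightarrow> bool" where
  "discrete_mset X \<longleftrightarrow> (\<forall>B. bounded B \<longrightarrow> finite {x \<in> B. X x > 0})"

text \<open>The number of translates \<open>K + x\<close>, with \<open>x\<close> ranging over \<open>X\<close> with multiplicity,
  that contain \<open>p\<close>. Summing over the support of \<open>X\<close> only makes the index set finite
  for bounded \<open>K\<close> and discrete \<open>X\<close> (see \<open>finite_covering\<close>), so the sum
  never takes its default value there.\<close>

definition cover_count :: "plane set \<Rightarrow> (plane \<Rightarrow> nat) \<Rightarrow> plane \<Rightarrow> nat" where
  "cover_count K X p = (\<Sum>x | X x > 0 \<and> p \<in> (+) x ` K. X x)"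

lemma finite_covering:
  assumes "bounded K" "discrete_mset X"
  shows "finite {x. X x > 0 \<and> p \<in> (+) x ` K}"
proof -
  have "bounded ((\<lambda>y. p - y) ` K)"
    using assms(1) by (intro bounded_minus_comp) (auto simp: image_constant_conv)
  then have "finite {x \<in> (\<lambda>y. p - y) ` K. X x > 0}"
    using assms(2) unfolding discrete_mset_def by blast
  moreover have "{x. X x > 0 \<and> p \<in> (+) x ` K} \<subseteq> {x \<in> (\<lambda>y. p - y) ` K. X x > 0}"
    by (force simp: image_iff algebra_simps)
  ultimately show ?thesis by (rule rev_finite_subset)
qed

definition kfold_tiling :: "nat \<Rightarrow> plane set \<Rightarrow> (plane \<Rightarrow> nat) \<Rightarrow> bool" where
  "kfold_tiling k K X \<longleftrightarrow>
     (\<forall>p. k \<le> cover_count K X p) \<and> (\<forall>p. cover_count (interior K) X p \<le> k)"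

text \<open>The infimum of the empty set of extended naturals is \<open>\<infinity>\<close>; over a
  nonempty set it is a minimum.\<close>

definition tau :: "plane set \<Rightarrow> enat" where
  "tau D = Inf {enat k | k. k > 0 \<and> (\<exists>X. discrete_mset X \<and> kfold_tiling k D X)}"

end

theory Submission
  imports Defs
begin

text \<open>Just beside a ray from a point \<open>p\<close> the covering number is exactly \<open>k\<close>. Comparing the two sides
  of the ray balances the tiles whose edge runs along it from the left against those from the right,
  and a tile boundary can only be balanced along nondegenerate edges. Hence the tile is a polygon with
  parallel opposite edges, and a convolution with the tile shows that these have equal length; so it is
  a centrally symmetric \<open>2m\<close>-gon, and only \<open>m \<ge> 4\<close> remains.

  At a point that is a vertex of some tile, the balance shows that the number of tiles having it as
  vertex \<open>v i\<close> or \<open>- v i\<close> is a constant \<open>\<kappa> \<ge> 1\<close>. So around the other end of an edge at \<open>p\<close> there is a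
  tile whose angle contains the direction back to \<open>p\<close>, and since chords parallel to an edge are longer
  than the edge, \<open>p\<close> is interior to it. Comparing three neighbours yields at least two tiles with \<open>p\<close>
  in their interior; adding the angles of at least \<open>\<kappa> (m - 1) / 2\<close> full turns leaves, for \<open>k \<le> 4\<close>, only
  \<open>m = 5\<close> and \<open>m = 4\<close> with a unique local pattern, in which too many interior tiles are forced.

  For the fivefold lattice tilings, the sections of the tile by the rows of the lattice are intervals
  whose endpoints match modulo 1, so that they wind around the circle exactly five times.\<close>

section \<open>Planar cross products and covering numbers\<close>

text \<open>The multiset carries no periodicity, so every count is taken at one point, over the
  finitely many tiles near it. At points on tile boundaries the definition gives only inequalities;
  exact counts come from test points that approach a ray sideways. A tile \<open>D + x\<close> is
  recorded at \<open>p\<close> by the position \<open>p - x\<close> of \<open>p\<close> inside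
  \<open>D\<close>, so a local statement about tiles becomes a statement about
  \<open>cover_count\<close> of a subset of \<open>D\<close>.

  Angles are never measured: instead of an angle sum, the tiles seen by two opposite rays are
  counted, which gives a budget of \<open>2 * k \<le> 8\<close>. Two interior tiles spend 4 of it,
  and the tiles with the point on their boundary must fit into the rest. Parity closes both
  remaining cases: for \<open>m = 5\<close> through a cycle of odd length, for \<open>m = 4\<close>
  because an odd \<open>\<kappa>\<close> forces a tile with the node inside one of its
  sides.\<close>

definition cr :: "plane \<Rightarrow> plane \<Rightarrow> real" where
  "cr a b = a$1 * b$2 - a$2 * b$1"

lemma cr_simps [simp]:
  "cr (a + b) c = cr a c + cr b c" "cr c (a + b) = cr c a + cr c b"
  "cr (a - b) c = cr a c - cr b c" "cr c (a - b) = cr c a - cr c b"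
  "cr (- a) c = - cr a c" "cr c (- a) = - cr c a"
  "cr (r *\<^sub>R a) c = r * cr a c" "cr c (r *\<^sub>R a) = r * cr c a"
  "cr 0 a = 0" "cr a 0 = 0" "cr a a = 0"
  by (simp_all add: cr_def algebra_simps)

lemma cr_swap: "cr a b = - cr b a"
  by (simp add: cr_def)

lemma bounded_linear_cr: "bounded_linear (cr a)"
proof -
  have "cr a = (\<lambda>b. (vector [- a$2, a$1] :: plane) \<bullet> b)"
    by (rule ext) (simp add: cr_def inner_vec_def sum_2)
  then show ?thesis by (simp add: bounded_linear_inner_right)
qed

lemma inner_eq_cr: "\<exists>d. \<forall>z. a \<bullet> z = cr d (z::plane)"
  by (rule exI[of _ "vector [a$2, - a$1]"]) (simp add: cr_def inner_vec_def sum_2)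

lemma cr_decomp:
  assumes "cr a b \<noteq> 0"
  shows "z = (cr z b / cr a b) *\<^sub>R a + (cr a z / cr a b) *\<^sub>R b"
proof -
  have "cr a b *\<^sub>R z = cr z b *\<^sub>R a + cr a z *\<^sub>R b"
    by (simp add: vec_eq_iff forall_2 cr_def algebra_simps)
  then have "(1 / cr a b) *\<^sub>R (cr a b *\<^sub>R z) = (1 / cr a b) *\<^sub>R (cr z b *\<^sub>R a + cr a z *\<^sub>R b)"
    by simp
  then show ?thesis using assms by (simp add: scaleR_add_right)
qed

text \<open>The fact behind every passage from a local to a global minimum on a polygon:
  \<open>a\<close> and \<open>b\<close> are the edges entering and leaving a vertex, and
  \<open>w\<close> points into the polygon. A height \<open>cr d\<close> that neither rises along
  \<open>a\<close> nor falls along \<open>b\<close> does not fall along \<open>w\<close>, by the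
  Pluecker relation between the four vectors.\<close>

lemma cr_cone:
  assumes "cr a b > 0" "cr a w \<ge> 0" "cr b w \<ge> 0" "cr d a \<le> 0" "cr d b \<ge> 0"
  shows "cr d w \<ge> 0"
proof -
  have "cr a b * cr d w = cr a w * cr d b - cr b w * cr d a"
    by (simp add: cr_def algebra_simps)
  moreover have "cr a w * cr d b \<ge> 0" "cr b w * cr d a \<le> 0"
    using assms by (simp_all add: mult_nonneg_nonpos)
  ultimately have "cr a b * cr d w \<ge> 0" by linarith
  then show ?thesis using assms(1) by (simp add: zero_le_mult_iff)
qed

lemma min_on_finite_range:
  fixes f :: "'a \<Rightarrow> real"
  assumes "finite (range v)" obtains n where "\<And>i. f (v n) \<le> f (v i)"
proof -
  have fin: "finite (f ` range v)" using assms by blast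
  then have "Min (f ` range v) \<in> f ` range v" by (intro Min_in) auto
  then obtain n where "Min (f ` range v) = f (v n)" by blast
  then show thesis using that[of n] Min_le[OF fin] by simp
qed

lemma cr_zero_imp_parallel:
  assumes "d \<noteq> 0" "cr d z = 0"
  obtains c where "z = c *\<^sub>R d"
proof -
  have "d$1 \<noteq> 0 \<or> d$2 \<noteq> 0" using assms(1) by (simp add: vec_eq_iff forall_2)
  then show thesis
  proof
    assume "d$1 \<noteq> 0"
    then have "z = (z$1 / d$1) *\<^sub>R d" using assms(2)
      by (simp add: vec_eq_iff forall_2 cr_def field_simps)
    then show thesis using that by blast
  next
    assume "d$2 \<noteq> 0"
    then have "z = (z$2 / d$2) *\<^sub>R d" using assms(2)
      by (simp add: vec_eq_iff forall_2 cr_def field_simps)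
    then show thesis using that by blast
  qed
qed

lemma cr_nonzero_exists:
  assumes "d \<noteq> 0" obtains n where "cr d n = 1"
proof -
  let ?s = "(d$1)^2 + (d$2)^2"
  have s: "?s \<noteq> 0" using assms by (simp add: vec_eq_iff forall_2 sum_power2_eq_zero_iff)
  have "cr d (vector [- d$2, d$1]) = ?s"
    by (simp add: cr_def power2_eq_square)
  then have "cr d ((1 / ?s) *\<^sub>R vector [- d$2, d$1]) = 1" using s by simp
  then show thesis by (rule that)
qed

lemma cr_double [simp]: "cr (2 * a) b = 2 * cr a b" "cr a (2 * b) = 2 * cr a b"
  by (simp_all only: mult_2 cr_simps)

lemma convex_cr_halfplane: "convex {z. cr d (z - p) \<ge> 0}"
proof -
  have "convex (cr d -` {cr d p..})"
    using bounded_linear.linear[OF bounded_linear_cr] by (intro convex_linear_vimage convex_real_interval)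
  moreover have "cr d -` {cr d p..} = {z. cr d (z - p) \<ge> 0}" by auto
  ultimately show ?thesis by simp
qed

lemma continuous_cr: "continuous_on UNIV (\<lambda>z. cr d (z - p))"
  by (intro continuous_on_compose2[OF linear_continuous_on[OF bounded_linear_cr]] continuous_intros) auto

section \<open>Arithmetic of covering numbers\<close>

lemma cover_count_eq: "cover_count A X p = sum X {x. X x > 0 \<and> p - x \<in> A}"
proof -
  have "p \<in> (+) x ` A \<longleftrightarrow> p - x \<in> A" for x
    by (force simp: image_iff algebra_simps)
  then show ?thesis by (simp add: cover_count_def)
qed

lemma finite_cover:
  assumes "bounded A" "discrete_mset X"
  shows "finite {x. X x > 0 \<and> p - x \<in> A}"
proof -
  have "p \<in> (+) x ` A \<longleftrightarrow> p - x \<in> A" for x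
    by (force simp: image_iff algebra_simps)
  then show ?thesis using finite_covering[OF assms, of p] by simp
qed

text \<open>Fixes one finite index set for several sets or points at once, which permits exchanging
  the count with other sums and with integrals.\<close>

lemma cover_count_of_bool:
  assumes "finite N" "{x. X x > 0 \<and> p - x \<in> A} \<subseteq> N"
  shows "cover_count A X p = (\<Sum>x\<in>N. X x * of_bool (p - x \<in> A))"
  unfolding cover_count_eq
  by (rule sum.mono_neutral_cong_left) (use assms in auto)

lemma cover_count_mono:
  assumes "A \<subseteq> B" "bounded B" "discrete_mset X"
  shows "cover_count A X p \<le> cover_count B X p"
  unfolding cover_count_eq
  by (rule sum_mono2) (use assms finite_cover in auto)

lemma cover_count_Un:
  assumes "A \<inter> B = {}" "bounded A" "bounded B" "discrete_mset X"
  shows "cover_count (A \<union> B) X p = cover_count A X p + cover_count B X p"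
proof -
  have "{x. X x > 0 \<and> p - x \<in> A \<union> B} = {x. X x > 0 \<and> p - x \<in> A} \<union> {x. X x > 0 \<and> p - x \<in> B}"
    by auto
  then show ?thesis unfolding cover_count_eq using assms
    by (simp add: finite_cover sum.union_disjoint disjoint_iff)
qed

lemma cover_count_empty [simp]: "cover_count {} X p = 0"
  by (simp add: cover_count_eq)

lemma cover_count_singleton [simp]: "cover_count {y} X p = X (p - y)"
proof -
  have "{x. X x > 0 \<and> p - x \<in> {y}} = (if X (p - y) > 0 then {p - y} else {})"
    by (auto simp: algebra_simps)
  then show ?thesis unfolding cover_count_eq by auto
qed

lemma cover_count_ge:
  assumes "y \<in> A" "bounded A" "discrete_mset X"
  shows "X (p - y) \<le> cover_count A X p"
  using cover_count_mono[of "{y}" A X p] assms by simp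

lemma cover_count_pos:
  assumes "cover_count A X p > 0"
  obtains y where "y \<in> A" "X (p - y) > 0"
proof -
  obtain x where "X x > 0" "p - x \<in> A"
    using assms unfolding cover_count_eq
    by (metis (mono_tags, lifting) less_numeral_extra(3) mem_Collect_eq sum.neutral gr0I)
  then show thesis using that[of "p - x"] by simp
qed

lemma cover_count_ge_card:
  assumes "finite Y" "Y \<subseteq> A" "\<And>y. y \<in> Y \<Longrightarrow> X (p - y) > 0" "bounded A" "discrete_mset X"
  shows "card Y \<le> cover_count A X p"
proof -
  have "card Y = card ((\<lambda>y. p - y) ` Y)" by (simp add: card_image inj_on_def)
  also have "\<dots> = (\<Sum>x\<in>(\<lambda>y. p - y) ` Y. 1)" by simp
  also have "\<dots> \<le> (\<Sum>x\<in>(\<lambda>y. p - y) ` Y. X x)" by (rule sum_mono) (use assms in \<open>fastforce simp: Suc_le_eq\<close>)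
  also have "\<dots> \<le> sum X {x. X x > 0 \<and> p - x \<in> A}"
    by (rule sum_mono2) (use assms finite_cover in auto)
  finally show ?thesis by (simp add: cover_count_eq)
qed

lemma cover_count_translate:
  "cover_count ((+) c ` A) X p = cover_count A X (p - c)"
proof -
  have "p - x \<in> (+) c ` A \<longleftrightarrow> p - c - x \<in> A" for x
    by (force simp: image_iff algebra_simps)
  then show ?thesis by (simp add: cover_count_eq)
qed

section \<open>Local balance along a ray\<close>

text \<open>Used at \<open>y = p - x\<close>: the ray from \<open>p\<close> in direction
  \<open>d\<close> enters the interior of the tile \<open>D + x\<close>. In a convex tile one such
  \<open>t\<close> yields all smaller ones.\<close>

definition inward :: "plane set \<Rightarrow> plane \<Rightarrow> plane set" where
  "inward D d = {y \<in> D. \<exists>t>0. y + t *\<^sub>R d \<in> interior D}"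

text \<open>For \<open>\<sigma> = 1\<close> the set \<open>D\<close> lies to the left of the direction \<open>d\<close>, for \<open>\<sigma> = - 1\<close> to its right.\<close>

definition along :: "real \<Rightarrow> plane set \<Rightarrow> plane \<Rightarrow> plane set" where
  "along \<sigma> D d = {y \<in> D. (\<exists>t>0. y + t *\<^sub>R d \<in> D) \<and> (\<forall>z\<in>D. \<sigma> * cr d (z - y) \<ge> 0)}"

lemma inward_small:
  fixes D :: "plane set"
  assumes "convex D" "y \<in> D" "y + t0 *\<^sub>R d \<in> interior D" "0 < t" "t \<le> t0"
  shows "y + t *\<^sub>R d \<in> interior D"
proof -
  have "y - (t / t0) *\<^sub>R (y - (y + t0 *\<^sub>R d)) \<in> interior D"
    by (rule mem_interior_convex_shrink) (use assms in auto)
  then show ?thesis using assms by simp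
qed

lemma segment_small:
  fixes D :: "plane set"
  assumes "convex D" "y \<in> D" "y + t0 *\<^sub>R d \<in> D" "0 \<le> t" "t \<le> t0"
  shows "y + t *\<^sub>R d \<in> D"
proof (cases "t0 = 0")
  case False
  then have "(1 - t / t0) *\<^sub>R y + (t / t0) *\<^sub>R (y + t0 *\<^sub>R d) \<in> D"
    using assms by (intro convexD) auto
  moreover have "(1 - t / t0) *\<^sub>R y + (t / t0) *\<^sub>R (y + t0 *\<^sub>R d) = y + t *\<^sub>R d"
    using False by (simp add: algebra_simps)
  ultimately show ?thesis by simp
qed (use assms in auto)

lemma eventually_right_open:
  fixes U :: "plane set"
  assumes "open U" "w \<in> U"
  shows "\<forall>\<^sub>F s in at_right 0. w + s *\<^sub>R n \<in> U"
proof -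
  have "((\<lambda>s. w + s *\<^sub>R n) \<longlongrightarrow> w + 0 *\<^sub>R n) (at_right 0)"
    by (intro tendsto_intros)
  then show ?thesis using assms by (auto simp: tendsto_def)
qed

lemma eventually_right_pos:
  assumes "\<forall>\<^sub>F s in at_right 0. P s" shows "\<exists>s>0. P (s::real)"
proof -
  have "\<forall>\<^sub>F s in at_right 0. P s \<and> s > 0"
    using assms by (intro eventually_conj) (simp_all add: eventually_at_right_less)
  then show ?thesis using eventually_happens by fastforce
qed

lemma interior_cr_pos:
  assumes "c \<in> interior D" "d \<noteq> 0" "\<forall>z\<in>D. \<sigma> * cr d (z - y) \<ge> 0" "\<sigma> \<noteq> 0"
  shows "\<sigma> * cr d (c - y) > 0"
proof -
  obtain n where n: "cr d n = 1" using cr_nonzero_exists[OF assms(2)] .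
  define m where "m = \<sigma> *\<^sub>R n"
  obtain s where s: "c + s *\<^sub>R - m \<in> interior D" "s > 0"
    using eventually_right_pos[OF eventually_right_open[OF open_interior assms(1)]] by blast
  then have "\<sigma> * cr d (c + s *\<^sub>R - m - y) \<ge> 0" using assms(3) interior_subset by blast
  moreover have "\<sigma> * cr d (s *\<^sub>R m) > 0" unfolding m_def
    using s assms(4) n by (auto simp: zero_less_mult_iff mult_less_0_iff)
  ultimately show ?thesis by (simp add: algebra_simps)
qed

lemma supporting_direction:
  fixes D :: "plane set"
  assumes "convex D" "interior D \<noteq> {}" "y \<in> D" "y \<notin> interior D"
  obtains a where "a \<noteq> 0" "\<And>z. z \<in> D \<Longrightarrow> cr a (z - y) \<ge> 0"
proof -
  have "rel_interior D = interior D" using assms(2) by (rule rel_interior_nonempty_interior)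
  then obtain b where b: "b \<noteq> 0" "\<And>z. z \<in> D \<Longrightarrow> b \<bullet> y \<le> b \<bullet> z"
    using supporting_hyperplane_rel_boundary[OF assms(1,3)] assms(4) by metis
  obtain a where a: "\<And>z. b \<bullet> z = cr a z" using inner_eq_cr by metis
  show thesis
  proof
    show "a \<noteq> 0" using b(1) a[of b] by auto
    show "cr a (z - y) \<ge> 0" if "z \<in> D" for z
      using b(2)[OF that] a by simp
  qed
qed

text \<open>If the ray stays in \<open>D\<close> for a while without meeting the interior, the
  midpoint of the segment lies on the boundary. A supporting line there cannot cross the segment, so
  it contains it, and \<open>D\<close> lies on one side of the ray.\<close>

lemma ray_cases:
  assumes "convex D" "y \<in> D" "d \<noteq> 0" "\<sigma> = 1 \<or> \<sigma> = -1" "interior D \<noteq> {}"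
  shows "y \<in> inward D d \<or> (\<forall>t>0. y + t *\<^sub>R d \<notin> D) \<or> y \<in> along \<sigma> D d \<or> y \<in> along (-\<sigma>) D d"
proof (rule ccontr)
  assume neg: "\<not> ?thesis"
  then obtain t where t: "t > 0" "y + t *\<^sub>R d \<in> D" by blast
  define w where "w = y + (t/2) *\<^sub>R d"
  have w: "w \<in> D" unfolding w_def using segment_small[OF assms(1,2) t(2), of "t/2"] t by simp
  have "w \<notin> interior D" using neg t assms(2) unfolding inward_def w_def
    by (smt (verit, ccfv_SIG) half_gt_zero mem_Collect_eq)
  then obtain a where a: "a \<noteq> 0" "\<And>z. z \<in> D \<Longrightarrow> cr a (z - w) \<ge> 0"
    using supporting_direction[OF assms(1,5) w] by blast
  have "cr a (y - w) \<ge> 0" "cr a (y + t *\<^sub>R d - w) \<ge> 0" using a assms(2) t by blast+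
  then have "t * cr a d \<le> 0" "t * cr a d \<ge> 0" by (auto simp: w_def algebra_simps)
  then have "cr a d = 0" using t by (smt (verit) mult_eq_0_iff)
  then obtain c where c: "d = c *\<^sub>R a" using cr_zero_imp_parallel a(1) by blast
  have "c \<noteq> 0" using assms(3) c by auto
  have ge: "c * cr d (z - y) \<ge> 0" if "z \<in> D" for z
  proof -
    have "cr d (z - y) = cr d (z - w)" by (simp add: w_def)
    moreover have "cr d (z - w) = c * cr a (z - w)" by (subst c) (rule cr_simps)
    ultimately have "c * cr d (z - y) = c\<^sup>2 * cr a (z - w)" by (simp only: power2_eq_square mult.assoc)
    then show ?thesis using a(2)[OF that] by simp
  qed
  have "(\<forall>z\<in>D. cr d (z - y) \<ge> 0) \<or> (\<forall>z\<in>D. cr d (z - y) \<le> 0)"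
    using ge \<open>c \<noteq> 0\<close> by (metis linorder_neqE_linordered_idom zero_le_mult_iff not_less)
  then show False using neg t assms(2,4) unfolding along_def by force
qed

lemma along_perturb:
  assumes D: "convex D" "interior D \<noteq> {}" and "d \<noteq> 0"
    and \<sigma>: "\<sigma> = 1 \<or> \<sigma> = -1" and n: "cr d n = \<sigma>"
    and y: "y \<in> along \<sigma> D d"
  shows "\<forall>\<^sub>F t in at_right 0. \<forall>\<^sub>F s in at_right 0. y + t *\<^sub>R d + s *\<^sub>R n \<in> interior D"
proof -
  obtain t1 where t1: "t1 > 0" "y + t1 *\<^sub>R d \<in> D" and yD: "y \<in> D"
    and sup: "\<forall>z\<in>D. \<sigma> * cr d (z - y) \<ge> 0" using y unfolding along_def by blast
  obtain c where c: "c \<in> interior D" using D by blast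
  have pos: "\<sigma> * cr d (c - y) > 0" using interior_cr_pos[OF c \<open>d \<noteq> 0\<close> sup] \<sigma> by auto
  have "\<forall>\<^sub>F s in at_right 0. y + t *\<^sub>R d + s *\<^sub>R n \<in> interior D" if t: "0 < t" "t < t1" for t
  proof -
    define \<zeta> where "\<zeta> = y + t *\<^sub>R d"
    define \<alpha> where "\<alpha> = cr n d / cr (c - \<zeta>) d"
    define \<beta> where "\<beta> = cr (c - \<zeta>) n / cr (c - \<zeta>) d"
    have cz: "cr (c - \<zeta>) d = - cr d (c - y)" by (simp add: \<zeta>_def cr_swap[of _ d])
    have "n = \<alpha> *\<^sub>R (c - \<zeta>) + \<beta> *\<^sub>R d"
      unfolding \<alpha>_def \<beta>_def by (rule cr_decomp) (use cz pos in auto)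
    moreover have \<alpha>: "\<alpha> > 0" unfolding \<alpha>_def cz using pos \<sigma> n by (auto simp: cr_swap[of n d] zero_less_divide_iff zero_less_mult_iff)
    ultimately have neq: "n = \<alpha> *\<^sub>R (c - \<zeta>) + \<beta> *\<^sub>R d" by blast
    have lim: "((\<lambda>s. t + s * \<beta> / (1 - s * \<alpha>)) \<longlongrightarrow> t + 0 * \<beta> / (1 - 0 * \<alpha>)) (at_right 0)"
      by (intro tendsto_intros) auto
    have ev1: "\<forall>\<^sub>F s in at_right 0. t + s * \<beta> / (1 - s * \<alpha>) > 0"
      using order_tendstoD(1)[OF lim, of 0] t by simp
    have ev2: "\<forall>\<^sub>F s in at_right 0. t + s * \<beta> / (1 - s * \<alpha>) < t1"
      using order_tendstoD(2)[OF lim, of t1] t by simp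
    have lim2: "((\<lambda>s. s * \<alpha>) \<longlongrightarrow> 0 * \<alpha>) (at_right 0)"
      by (intro tendsto_intros)
    have ev3: "\<forall>\<^sub>F s in at_right 0. s * \<alpha> < 1"
      using order_tendstoD(2)[OF lim2, of 1] by simp
    have ev4: "\<forall>\<^sub>F s in at_right 0. s > (0::real)"
      by (simp add: eventually_at_right_less)
    show ?thesis using ev1 ev2 ev3 ev4
    proof eventually_elim
      case (elim s)
      \<comment> \<open>The base point slides along the edge from \<open>t\<close> to
        \<open>q\<close> so that the test point lies on the segment from
        \<open>y + q *\<^sub>R d\<close> to the interior point \<open>c\<close>, at the fraction
        \<open>s * \<alpha>\<close>; that \<open>\<alpha>\<close> is positive says that
        \<open>n\<close> points to the inner side.\<close>
      define q where "q = t + s * \<beta> / (1 - s * \<alpha>)"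
      have w: "y + q *\<^sub>R d \<in> D" using elim by (intro segment_small[OF D(1) yD t1(2)]) (auto simp: q_def)
      have "(y + q *\<^sub>R d) - (s * \<alpha>) *\<^sub>R ((y + q *\<^sub>R d) - c) \<in> interior D"
        by (rule mem_interior_convex_shrink[OF D(1) c w]) (use elim \<alpha> in auto)
      moreover have "(y + q *\<^sub>R d) - (s * \<alpha>) *\<^sub>R ((y + q *\<^sub>R d) - c)
          = y + t *\<^sub>R d + s *\<^sub>R n"
      proof -
        have q1: "(1 - s * \<alpha>) * q = (1 - s * \<alpha>) * t + s * \<beta>" using elim by (simp add: q_def distrib_left)
        have "(y + q *\<^sub>R d) - (s * \<alpha>) *\<^sub>R ((y + q *\<^sub>R d) - c)
           = (1 - s * \<alpha>) *\<^sub>R y + ((1 - s * \<alpha>) * q) *\<^sub>R d + (s * \<alpha>) *\<^sub>R c"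
          by (simp add: algebra_simps)
        also have "\<dots> = y + t *\<^sub>R d + s *\<^sub>R (\<alpha> *\<^sub>R (c - \<zeta>) + \<beta> *\<^sub>R d)"
          unfolding q1 \<zeta>_def by (simp add: algebra_simps)
        finally show ?thesis using neq by simp
      qed
      ultimately show ?case by simp
    qed
  qed
  then show ?thesis unfolding eventually_at_right[OF t1(1)] using t1(1) by blast
qed

text \<open>The order of the limits matters: \<open>t\<close> is fixed before \<open>s\<close>, so
  the test point lies beside the ray and not merely near its origin. A tile that the ray leaves at
  once misses \<open>y + t *\<^sub>R d\<close> and hence a neighbourhood of it; a tile on the wrong
  side of the line is missed for every \<open>s > 0\<close>.\<close>

lemma ray_perturb:
  assumes D: "convex D" "closed D" "interior D \<noteq> {}" and "d \<noteq> 0"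
    and \<sigma>: "\<sigma> = 1 \<or> \<sigma> = -1" and n: "cr d n = \<sigma>"
  shows "\<forall>\<^sub>F t in at_right 0. \<forall>\<^sub>F s in at_right 0.
    if y \<in> inward D d \<union> along \<sigma> D d then y + t *\<^sub>R d + s *\<^sub>R n \<in> interior D
    else y + t *\<^sub>R d + s *\<^sub>R n \<notin> D"
proof -
  have opn: "open (- D)" using D by auto
  have pos: "\<forall>\<^sub>F s in at_right 0. s > (0::real)"
    by (simp add: eventually_at_right_less)
  consider "y \<notin> D" | "y \<in> inward D d" | "y \<in> along \<sigma> D d"
    | "y \<in> D" "y \<notin> inward D d" "y \<notin> along \<sigma> D d" "\<forall>t>0. y + t *\<^sub>R d \<notin> D"
    | "y \<in> D" "y \<notin> inward D d" "y \<notin> along \<sigma> D d" "y \<in> along (-\<sigma>) D d"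
    using ray_cases[OF D(1) _ \<open>d \<noteq> 0\<close> \<sigma> D(3)] by blast
  then show ?thesis
  proof cases
    case 1
    then have "y \<notin> inward D d \<union> along \<sigma> D d" by (auto simp: inward_def along_def)
    moreover have "\<forall>\<^sub>F t in at_right 0. y + t *\<^sub>R d \<in> - D" using eventually_right_open[OF opn] 1 by blast
    then have "\<forall>\<^sub>F t in at_right 0. \<forall>\<^sub>F s in at_right 0. y + t *\<^sub>R d + s *\<^sub>R n \<in> - D"
      by eventually_elim (use eventually_right_open[OF opn] in blast)
    ultimately show ?thesis by simp
  next
    case 2
    then obtain t0 where "t0 > 0" "y \<in> D" "y + t0 *\<^sub>R d \<in> interior D" by (auto simp: inward_def)
    then have "\<forall>\<^sub>F t in at_right 0. y + t *\<^sub>R d \<in> interior D"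
      unfolding eventually_at_right[OF \<open>t0 > 0\<close>]
      using inward_small[OF D(1)] by (meson less_imp_le)
    then have "\<forall>\<^sub>F t in at_right 0. \<forall>\<^sub>F s in at_right 0. y + t *\<^sub>R d + s *\<^sub>R n \<in> interior D"
      by eventually_elim (use eventually_right_open[OF open_interior] in blast)
    then show ?thesis using 2 by simp
  next
    case 3
    then show ?thesis using along_perturb[OF D(1,3) \<open>d \<noteq> 0\<close> \<sigma> n 3] by simp
  next
    case 4
    have "\<forall>\<^sub>F t in at_right 0. \<forall>\<^sub>F s in at_right 0. y + t *\<^sub>R d + s *\<^sub>R n \<in> - D"
      using pos by eventually_elim (use eventually_right_open[OF opn] 4 in blast)
    then show ?thesis using 4 by simp
  next
    case 5
    then have "\<forall>z\<in>D. - \<sigma> * cr d (z - y) \<ge> 0" by (auto simp: along_def)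
    moreover have "- \<sigma> * cr d (y + t *\<^sub>R d + s *\<^sub>R n - y) < 0" if "s > 0" for s t
      using that n \<sigma> by auto
    ultimately have "y + t *\<^sub>R d + s *\<^sub>R n \<notin> D" if "s > 0" for s t
      using that by (meson not_less)
    then have "\<forall>\<^sub>F s in at_right 0. y + t *\<^sub>R d + s *\<^sub>R n \<notin> D" for t
      using pos by (rule eventually_mono[rotated]) auto
    then show ?thesis using 5 by simp
  qed
qed

locale tiling =
  fixes D :: "plane set" and X :: "plane \<Rightarrow> nat" and k :: nat
  assumes domain: "convex_domain D" and discrete: "discrete_mset X"
    and tiles: "kfold_tiling k D X" and k_pos: "k > 0"
begin

lemma D_facts: "convex D" "compact D" "closed D" "bounded D" "interior D \<noteq> {}"
  using domain by (auto simp: convex_domain_def compact_imp_closed compact_imp_bounded)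

lemma cover_ge: "k \<le> cover_count D X p" and cover_le: "cover_count (interior D) X p \<le> k"
  using tiles by (auto simp: kfold_tiling_def)

lemma bounded_sub: "A \<subseteq> D \<Longrightarrow> bounded A"
  using D_facts bounded_subset by blast

lemma along_sub: "along \<sigma> D d \<subseteq> D" and inward_sub: "inward D d \<subseteq> D"
  by (auto simp: along_def inward_def)

text \<open>Just beside the ray from \<open>p\<close> in direction \<open>d\<close>, on the side chosen by \<open>\<sigma>\<close>, every tile
  contains the point in its interior or not at all, so the covering number there is exactly \<open>k\<close>.\<close>

lemma local_balance:
  assumes "d \<noteq> 0" "\<sigma> = 1 \<or> \<sigma> = -1"
  shows "cover_count (inward D d) X p + cover_count (along \<sigma> D d) X p = k"
proof -
  obtain n0 where n0: "cr d n0 = 1" using cr_nonzero_exists[OF assms(1)] .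
  define n where "n = \<sigma> *\<^sub>R n0"
  have n: "cr d n = \<sigma>" by (simp add: n_def n0)
  define G where "G = inward D d \<union> along \<sigma> D d"
  obtain R where R: "\<And>y. y \<in> D \<Longrightarrow> norm y \<le> R" using D_facts(4) bounded_iff by blast
  \<comment> \<open>Contains all tiles that meet \<open>p\<close> or the test point \<open>z\<close>
    below, since \<open>z\<close> is displaced by less than 1/2 + 1/2.\<close>
  define N where "N = {x. X x > 0 \<and> p - x \<in> cball 0 (R + 1)}"
  have finN: "finite N" unfolding N_def by (rule finite_cover[OF bounded_cball discrete])
  have "\<forall>\<^sub>F t in at_right 0. norm (t *\<^sub>R d) < 1/2"
    using eventually_right_open[OF open_ball[of 0 "1/2"], of 0 d] by simp
  moreover have sm: "\<forall>\<^sub>F s in at_right 0. norm (s *\<^sub>R n) < 1/2"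
    using eventually_right_open[OF open_ball[of 0 "1/2"], of 0 n] by simp
  moreover have "\<forall>\<^sub>F t in at_right 0. \<forall>x\<in>N. \<forall>\<^sub>F s in at_right 0.
    if p - x \<in> G then (p - x) + t *\<^sub>R d + s *\<^sub>R n \<in> interior D
    else (p - x) + t *\<^sub>R d + s *\<^sub>R n \<notin> D"
    unfolding G_def
    by (intro eventually_ball_finite[OF finN] ballI ray_perturb D_facts assms n)
  ultimately have "\<forall>\<^sub>F t in at_right (0::real). norm (t *\<^sub>R d) < 1/2 \<and> (\<forall>x\<in>N. \<forall>\<^sub>F s in at_right 0.
    if p - x \<in> G then (p - x) + t *\<^sub>R d + s *\<^sub>R n \<in> interior D
    else (p - x) + t *\<^sub>R d + s *\<^sub>R n \<notin> D)"
    by (simp add: eventually_conj_iff)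
  from eventually_right_pos[OF this] obtain t where t: "norm (t *\<^sub>R d) < 1/2" "\<forall>x\<in>N. \<forall>\<^sub>F s in at_right 0.
    if p - x \<in> G then (p - x) + t *\<^sub>R d + s *\<^sub>R n \<in> interior D
    else (p - x) + t *\<^sub>R d + s *\<^sub>R n \<notin> D"
    by auto
  have "\<forall>\<^sub>F s in at_right 0. norm (s *\<^sub>R n) < 1/2 \<and> (\<forall>x\<in>N.
    if p - x \<in> G then (p - x) + t *\<^sub>R d + s *\<^sub>R n \<in> interior D
    else (p - x) + t *\<^sub>R d + s *\<^sub>R n \<notin> D)"
    using sm eventually_ball_finite[OF finN t(2)] by (simp add: eventually_conj_iff)
  from eventually_right_pos[OF this] obtain s where s: "norm (s *\<^sub>R n) < 1/2" "\<forall>x\<in>N.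
    if p - x \<in> G then (p - x) + t *\<^sub>R d + s *\<^sub>R n \<in> interior D
    else (p - x) + t *\<^sub>R d + s *\<^sub>R n \<notin> D" by auto
  define z where "z = p + t *\<^sub>R d + s *\<^sub>R n"
  have zx: "z - x = (p - x) + t *\<^sub>R d + s *\<^sub>R n" for x by (simp add: z_def)
  have inN: "x \<in> N" if "X x > 0" "z - x \<in> D" for x
  proof -
    have "norm (p - x) \<le> norm (z - x) + norm (t *\<^sub>R d + s *\<^sub>R n)"
      using norm_triangle_ineq4[of "z - x" "t *\<^sub>R d + s *\<^sub>R n"] by (simp add: z_def algebra_simps)
    also have "\<dots> \<le> R + 1" using R[OF that(2)] norm_triangle_ineq[of "t *\<^sub>R d" "s *\<^sub>R n"] t s by linarith
    finally show ?thesis using that by (simp add: N_def)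
  qed
  have GN: "x \<in> N" if "X x > 0" "p - x \<in> G" for x
    using that R[of "p - x"] along_sub inward_sub by (fastforce simp: N_def G_def)
  have "{x. X x > 0 \<and> z - x \<in> D} = {x. X x > 0 \<and> p - x \<in> G}"
    "{x. X x > 0 \<and> z - x \<in> interior D} = {x. X x > 0 \<and> p - x \<in> G}"
    using inN GN s(2) interior_subset[of D] zx by (auto split: if_splits; metis subsetD)+
  then have "cover_count D X z = cover_count G X p" "cover_count (interior D) X z = cover_count G X p"
    by (simp_all add: cover_count_eq)
  then have "cover_count G X p = k" using cover_ge[of z] cover_le[of z] by simp
  moreover have "inward D d \<inter> along \<sigma> D d = {}"
  proof -
    have False if y: "y \<in> along \<sigma> D d" and t: "y + t *\<^sub>R d \<in> interior D" for y t
      using interior_cr_pos[OF t assms(1), of \<sigma> y] y assms(2) by (auto simp: along_def)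
    then show ?thesis by (auto simp: inward_def)
  qed
  ultimately show ?thesis
    unfolding G_def by (simp add: cover_count_Un bounded_sub along_sub inward_sub discrete)
qed

end

section \<open>Finitely many vertices\<close>

lemma le_of_le_add_small:
  fixes u w b :: real
  assumes "\<And>s. 0 < s \<Longrightarrow> s \<le> 1 \<Longrightarrow> b \<le> u + s * w"
  shows "b \<le> u"
proof (rule tendsto_lowerbound)
  have "((\<lambda>s. u + s * w) \<longlongrightarrow> u + 0 * w) (at_right 0)" by (intro tendsto_intros)
  then show "((\<lambda>s. u + s * w) \<longlongrightarrow> u) (at_right 0)" by simp
  show "\<forall>\<^sub>F s in at_right 0. b \<le> u + s * w"
    unfolding eventually_at_right[OF zero_less_one] using assms by (meson less_imp_le zero_less_one)
qed simp

text \<open>With \<open>e = c - p0\<close>, the directions \<open>d\<close> satisfying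
  \<open>cr d e = 1\<close> form the line \<open>d0 + l *\<^sub>R e\<close>, and growing
  \<open>l\<close> turns them towards \<open>c\<close>. The supporting ones among them form a closed
  bounded set of parameters; its supremum is the one-sided tangent at \<open>p0\<close>, beyond
  which every ray enters the interior.\<close>

lemma tangent_direction:
  fixes D :: "plane set"
  assumes D: "convex D" and p0: "p0 \<in> D" "p0 \<notin> interior D" and c: "c \<in> interior D"
  obtains d where "\<And>q. q \<in> D \<Longrightarrow> cr d (q - p0) \<ge> 0" "cr d (c - p0) = 1"
    "\<And>\<epsilon>. \<epsilon> > 0 \<Longrightarrow> \<exists>t>0. p0 + t *\<^sub>R (d + \<epsilon> *\<^sub>R (c - p0)) \<in> interior D"
proof -
  define e where "e = c - p0"
  have ne: "interior D \<noteq> {}" using c by auto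
  have "e \<noteq> 0" using c p0 by (auto simp: e_def)
  then obtain n where n: "cr e n = 1" using cr_nonzero_exists by blast
  define d0 where "d0 = - n"
  have d0: "cr d0 e = 1" "cr e d0 = -1" using n cr_swap[of n e] by (simp_all add: d0_def)
  define S where "S = {l. \<forall>q\<in>D. cr (d0 + l *\<^sub>R e) (q - p0) \<ge> 0}"
  have sup_in: "cr a e > 0 \<and> cr d0 a / cr a e \<in> S"
    if a: "a \<noteq> 0" "\<And>z. z \<in> D \<Longrightarrow> cr a (z - p0) \<ge> 0" for a
  proof -
    have pos: "cr a e > 0" using interior_cr_pos[OF c a(1), of 1 p0] a(2) by (auto simp: e_def)
    have "a = cr a e *\<^sub>R d0 + cr d0 a *\<^sub>R e" using cr_decomp[of d0 e a] d0 by simp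
    then have "(1 / cr a e) *\<^sub>R a = (1 / cr a e) *\<^sub>R (cr a e *\<^sub>R d0 + cr d0 a *\<^sub>R e)" by simp
    then have "(1 / cr a e) *\<^sub>R a = d0 + (cr d0 a / cr a e) *\<^sub>R e" using pos
      by (simp add: scaleR_add_right)
    moreover have "cr ((1 / cr a e) *\<^sub>R a) (z - p0) \<ge> 0" if "z \<in> D" for z
      using a(2)[OF that] pos unfolding cr_simps(7) by simp
    ultimately show ?thesis using pos by (simp add: S_def)
  qed
  have Sne: "S \<noteq> {}" using supporting_direction[OF D ne p0] sup_in by blast
  obtain s where s: "c + s *\<^sub>R - n \<in> interior D" "s > 0"
    using eventually_right_pos[OF eventually_right_open[OF open_interior c]] by blast
  \<comment> \<open>A point of \<open>D\<close> to the right of the line from \<open>p0\<close> to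
    \<open>c\<close>: a supporting direction must keep it on its left, which bounds \<open>l\<close>
    from above.\<close>
  define q where "q = c - s *\<^sub>R n"
  have q: "q \<in> D" using s interior_subset by (auto simp: q_def)
  have "q - p0 = e - s *\<^sub>R n" by (simp add: q_def e_def)
  then have qe: "cr e (q - p0) = - s" using n by simp
  have "l \<le> cr d0 (q - p0) / s" if "l \<in> S" for l
  proof -
    have "cr (d0 + l *\<^sub>R e) (q - p0) \<ge> 0" using that q unfolding S_def by blast
    then have "cr d0 (q - p0) + l * - s \<ge> 0" by (simp only: cr_simps(1,7) qe)
    then show ?thesis using s by (simp add: field_simps)
  qed
  then have bdd: "bdd_above S" by (meson bdd_aboveI)
  have "closed S"
  proof -
    have "S = (\<Inter>q\<in>D. {l. 0 \<le> cr d0 (q - p0) + l * cr e (q - p0)})"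
      unfolding S_def cr_simps(1,7) by auto
    moreover have "closed {l. 0 \<le> cr d0 (q - p0) + l * cr e (q - p0)}" for q
      by (intro closed_Collect_le continuous_intros)
    ultimately show ?thesis by auto
  qed
  define l where "l = Sup S"
  have lS: "l \<in> S" unfolding l_def by (rule closed_contains_Sup[OF Sne bdd \<open>closed S\<close>])
  define d where "d = d0 + l *\<^sub>R e"
  show thesis
  proof
    show "cr d (q - p0) \<ge> 0" if "q \<in> D" for q using lS that unfolding S_def d_def by blast
    show "cr d (c - p0) = 1" using d0 by (simp add: d_def flip: e_def)
    fix \<epsilon> :: real assume "\<epsilon> > 0"
    define f where "f = d + \<epsilon> *\<^sub>R e"
    show "\<exists>t>0. p0 + t *\<^sub>R (d + \<epsilon> *\<^sub>R (c - p0)) \<in> interior D"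
    proof (rule ccontr)
      assume neg: "\<not> ?thesis"
      \<comment> \<open>Separating this ray from the interior gives a supporting direction at
        \<open>p0\<close> whose parameter is at least \<open>l + \<epsilon>\<close>, against the
        choice of \<open>l\<close>.\<close>
      define R where "R = (\<lambda>t. p0 + t *\<^sub>R f) ` {0<..}"
      have "R \<inter> interior D = {}" using neg by (auto simp: R_def f_def e_def)
      moreover have "convex R"
      proof -
        have "R = (+) p0 ` ((\<lambda>t. t *\<^sub>R f) ` {0<..})" by (auto simp: R_def image_image)
        moreover have "convex ((\<lambda>t. t *\<^sub>R f) ` {0<..})"
          by (intro convex_linear_image bounded_linear.linear bounded_linear_scaleR_left) auto
        ultimately show ?thesis by (simp add: convex_translation)
      qed
      moreover have "R \<noteq> {}" unfolding R_def by simp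
      ultimately obtain a' b where ab: "a' \<noteq> 0" "\<forall>x\<in>R. a' \<bullet> x \<le> b" "\<forall>x\<in>interior D. b \<le> a' \<bullet> x"
        using separating_hyperplane_sets[of R "interior D"] convex_interior[OF D] ne by blast
      obtain a where a: "\<And>z. a' \<bullet> z = cr a z" using inner_eq_cr by metis
      have "a \<noteq> 0" using ab(1) a[of a'] by auto
      have bD: "b \<le> cr a x" if "x \<in> D" for x
      proof (rule le_of_le_add_small)
        fix r :: real assume "0 < r" "r \<le> 1"
        then have "x + r *\<^sub>R (c - x) \<in> interior D"
          using inward_small[OF D that, of 1 "c - x" r] c by simp
        then show "b \<le> cr a x + r * cr a (c - x)" using ab(3) a by fastforce
      qed
      have "cr a (p0 + t *\<^sub>R f) \<le> b" if "t > 0" for t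
        using ab(2) that by (auto simp: R_def a)
      then have tb: "- b \<le> - cr a p0 + t * - cr a f" if "t > 0" for t
        using that by fastforce
      then have "- b \<le> - cr a p0" by (rule le_of_le_add_small)
      then have "cr a (z - p0) \<ge> 0" if "z \<in> D" for z using bD[OF that] by simp
      then have pos: "cr a e > 0" and "cr d0 a / cr a e \<in> S" using sup_in[OF \<open>a \<noteq> 0\<close>] by blast+
      then have "cr d0 a / cr a e \<le> l" unfolding l_def by (intro cSup_upper bdd)
      then have le: "cr d0 a \<le> l * cr a e" using pos by (simp add: field_simps)
      have "cr a f \<le> 0" using tb[of 1] bD[OF p0(1)] by simp
      moreover have "cr a f = cr a d0 + (l + \<epsilon>) * cr a e" by (simp add: f_def d_def algebra_simps)
      ultimately have "(l + \<epsilon>) * cr a e \<le> cr d0 a" using cr_swap[of a d0] by simp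
      then have "\<epsilon> * cr a e \<le> 0" using le by (simp add: algebra_simps)
      then show False using pos \<open>\<epsilon> > 0\<close> by (simp add: mult_le_0_iff)
    qed
  qed
qed

lemma face_segment:
  fixes D :: "plane set"
  assumes "convex D" "compact D" "d \<noteq> 0" "p \<in> D"
  obtains a b where "{z \<in> D. cr d (z - p) = 0} = closed_segment a b"
proof -
  have eq: "{z \<in> D. cr d (z - p) = 0} = D \<inter> {z. cr d z = cr d p}" by auto
  have cont: "continuous_on UNIV (cr d)" using bounded_linear_cr linear_continuous_on by blast
  have "closed {z. cr d z = cr d p}" by (intro closed_Collect_eq cont continuous_on_const)
  then have 1: "compact (D \<inter> {z. cr d z = cr d p})" using assms(2) by blast
  have 2: "convex (D \<inter> {z. cr d z = cr d p})"
  proof (rule convex_Int[OF assms(1)])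
    show "convex {z. cr d z = cr d p}"
      by (auto simp: convex_def simp flip: distrib_right)
  qed
  have 3: "collinear (D \<inter> {z. cr d z = cr d p})"
    unfolding collinear_def
  proof (intro exI[of _ d] ballI)
    fix x y assume "x \<in> D \<inter> {z. cr d z = cr d p}" "y \<in> D \<inter> {z. cr d z = cr d p}"
    then have "cr d (x - y) = 0" by simp
    then show "\<exists>c. x - y = c *\<^sub>R d" using cr_zero_imp_parallel[OF assms(3)] by metis
  qed
  have 4: "D \<inter> {z. cr d z = cr d p} \<noteq> {}" using assms(4) by auto
  show thesis using compact_convex_collinear_segment[OF 4 1 2 3] that eq by metis
qed

text \<open>Half-open because \<open>along\<close> asks for a positive distance to go in direction
  \<open>d\<close>: the start of an edge qualifies, its far end does not.\<close>

definition half_open_edge :: "plane \<Rightarrow> real \<Rightarrow> plane \<Rightarrow> plane set" where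
  "half_open_edge d \<nu> s = {s + t *\<^sub>R d | t. 0 \<le> t \<and> t < \<nu>}"

lemma closed_segment_ray:
  fixes e d :: plane
  assumes "\<mu> > 0"
  shows "closed_segment e (e + \<mu> *\<^sub>R d) = {e + t *\<^sub>R d | t. 0 \<le> t \<and> t \<le> \<mu>}"
proof (intro equalityI subsetI)
  fix z assume "z \<in> closed_segment e (e + \<mu> *\<^sub>R d)"
  then obtain s where s: "0 \<le> s" "s \<le> 1" "z = (1 - s) *\<^sub>R e + s *\<^sub>R (e + \<mu> *\<^sub>R d)"
    by (auto simp: in_segment)
  then have "z = e + (s * \<mu>) *\<^sub>R d" by (simp add: algebra_simps)
  moreover have "0 \<le> s * \<mu>" "s * \<mu> \<le> \<mu>" using s assms by (auto simp: mult_left_le_one_le)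
  ultimately show "z \<in> {e + t *\<^sub>R d | t. 0 \<le> t \<and> t \<le> \<mu>}" by blast
next
  fix z assume "z \<in> {e + t *\<^sub>R d | t. 0 \<le> t \<and> t \<le> \<mu>}"
  then obtain t where t: "z = e + t *\<^sub>R d" "0 \<le> t" "t \<le> \<mu>" by blast
  then have "z = (1 - t / \<mu>) *\<^sub>R e + (t / \<mu>) *\<^sub>R (e + \<mu> *\<^sub>R d)" using assms by (simp add: algebra_simps)
  moreover have "0 \<le> t / \<mu>" "t / \<mu> \<le> 1" using t assms by auto
  ultimately show "z \<in> closed_segment e (e + \<mu> *\<^sub>R d)" by (auto simp: in_segment)
qed

lemma extreme_point_of_support_face:
  fixes D :: "plane set"
  assumes sup: "\<And>z. z \<in> D \<Longrightarrow> \<sigma> * cr d (z - w) \<ge> 0" and "\<sigma> \<noteq> 0"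
    and e: "e extreme_point_of {z \<in> D. cr d (z - w) = 0}"
  shows "e extreme_point_of D"
  unfolding extreme_point_of_def
proof (intro conjI ballI)
  show "e \<in> D" using e by (simp add: extreme_point_of_def)
  fix a b assume ab: "a \<in> D" "b \<in> D"
  show "e \<notin> open_segment a b"
  proof
    assume seg: "e \<in> open_segment a b"
    then obtain t where t: "0 < t" "t < 1" "e = (1 - t) *\<^sub>R a + t *\<^sub>R b" by (auto simp: in_segment)
    have "cr d (e - w) = 0" using e by (simp add: extreme_point_of_def)
    moreover have "e - w = (1 - t) *\<^sub>R (a - w) + t *\<^sub>R (b - w)" by (simp add: t algebra_simps)
    ultimately have "(1 - t) * cr d (a - w) + t * cr d (b - w) = 0" by (simp only: cr_simps(2,8))
    then have "\<sigma> * ((1 - t) * cr d (a - w) + t * cr d (b - w)) = 0" by simp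
    then have "(1 - t) * (\<sigma> * cr d (a - w)) + t * (\<sigma> * cr d (b - w)) = 0"
      by (simp only: distrib_left mult.left_commute)
    moreover have "(1 - t) * (\<sigma> * cr d (a - w)) \<ge> 0" "t * (\<sigma> * cr d (b - w)) \<ge> 0"
      using sup ab t by (auto simp del: cr_simps)
    ultimately have "(1 - t) * (\<sigma> * cr d (a - w)) = 0" "t * (\<sigma> * cr d (b - w)) = 0" by linarith+
    then have "cr d (a - w) = 0" "cr d (b - w) = 0" using t assms(2) by (auto simp del: cr_simps)
    then show False using e seg ab by (auto simp: extreme_point_of_def simp del: cr_simps)
  qed
qed

lemma along_face:
  fixes D :: "plane set"
  assumes "convex D" "d \<noteq> 0" "\<mu> > 0" and sup: "\<And>z. z \<in> D \<Longrightarrow> \<sigma> * cr d (z - w) \<ge> 0" and "\<sigma> \<noteq> 0" "w \<in> D"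
    and F: "{z \<in> D. cr d (z - w) = 0} = closed_segment e (e + \<mu> *\<^sub>R d)"
  shows "along \<sigma> D d = half_open_edge d \<mu> e"
proof -
  note seg = closed_segment_ray[OF assms(3), of e d]
  show ?thesis
  proof (intro equalityI subsetI)
    fix z assume "z \<in> along \<sigma> D d"
    then obtain r where z: "z \<in> D" "r > 0" "z + r *\<^sub>R d \<in> D" "\<forall>y\<in>D. \<sigma> * cr d (y - z) \<ge> 0"
      by (auto simp: along_def simp del: cr_simps)
    have "\<sigma> * cr d (w - z) \<ge> 0" using z(4) assms(6) by (rule bspec)
    moreover have "\<sigma> * cr d (z - w) \<ge> 0" by (rule sup[OF z(1)])
    moreover have "\<sigma> * cr d (w - z) = - (\<sigma> * cr d (z - w))" by (simp add: algebra_simps)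
    ultimately have "\<sigma> * cr d (z - w) = 0" by linarith
    then have 0: "cr d (z - w) = 0" using assms(5) by (simp only: mult_eq_0_iff simp_thms)
    moreover from 0 have "cr d (z + r *\<^sub>R d - w) = 0" by simp
    ultimately have "z \<in> {z \<in> D. cr d (z - w) = 0}" "z + r *\<^sub>R d \<in> {z \<in> D. cr d (z - w) = 0}"
      using z(1,3) by blast+
    then have "z \<in> closed_segment e (e + \<mu> *\<^sub>R d)" "z + r *\<^sub>R d \<in> closed_segment e (e + \<mu> *\<^sub>R d)"
      unfolding F .
    then obtain t t' where t: "z = e + t *\<^sub>R d" "0 \<le> t" "z + r *\<^sub>R d = e + t' *\<^sub>R d" "t' \<le> \<mu>"
      unfolding seg by blast
    then have "(t + r - t') *\<^sub>R d = 0" by (simp add: algebra_simps)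
    then have "t < \<mu>" using assms(2) t(4) z(2) by auto
    then show "z \<in> half_open_edge d \<mu> e" using t by (auto simp: half_open_edge_def)
  next
    fix z assume "z \<in> half_open_edge d \<mu> e"
    then obtain t where t: "z = e + t *\<^sub>R d" "0 \<le> t" "t < \<mu>" by (auto simp: half_open_edge_def)
    have in1: "z \<in> {z \<in> D. cr d (z - w) = 0}" unfolding F seg using t by auto
    have "z + (\<mu> - t) *\<^sub>R d = e + \<mu> *\<^sub>R d" by (simp add: t algebra_simps)
    then have "z + (\<mu> - t) *\<^sub>R d \<in> {z \<in> D. cr d (z - w) = 0}" unfolding F by simp
    moreover have "\<sigma> * cr d (y - z) \<ge> 0" if "y \<in> D" for y
    proof -
      have "cr d (y - z) = cr d (y - w)" using in1 by simp
      then show ?thesis using sup[OF that] by (simp only:)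
    qed
    ultimately show "z \<in> along \<sigma> D d" using in1 t unfolding along_def
      by (auto intro!: exI[of _ "\<mu> - t"] simp del: cr_simps)
  qed
qed

section \<open>Opposed edges and the finiteness of the vertex set\<close>

context tiling
begin

lemma translate_exists: obtains x0 where "X x0 > 0"
  using cover_count_pos[of D X 0] cover_ge[of 0] k_pos by (metis le_zero_eq neq0_conv)

text \<open>Turning the tangent direction \<open>d\<close> slightly inwards gains the tile itself and loses no tile that
  \<open>d\<close> enters, so some tile must be left over that \<open>d\<close> merely runs along.\<close>

lemma edge_at_boundary:
  assumes p0: "p0 \<in> D" "p0 \<notin> interior D"
  obtains d where "d \<noteq> 0" "\<And>q. q \<in> D \<Longrightarrow> cr d (q - p0) \<ge> 0" "along 1 D d \<noteq> {}"
proof -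
  obtain x0 where x0: "X x0 > 0" by (rule translate_exists)
  obtain c where c: "c \<in> interior D" using D_facts by blast
  define e where "e = c - p0"
  obtain d where d: "\<And>q. q \<in> D \<Longrightarrow> cr d (q - p0) \<ge> 0" "cr d e = 1"
    "\<And>\<epsilon>. \<epsilon> > 0 \<Longrightarrow> \<exists>t>0. p0 + t *\<^sub>R (d + \<epsilon> *\<^sub>R e) \<in> interior D"
    using tangent_direction[OF D_facts(1) p0 c] unfolding e_def by metis
  have "d \<noteq> 0" using d(2) by auto
  define p where "p = p0 + x0"
  define M where "M = {x. X x > 0 \<and> p - x \<in> inward D d}"
  have finM: "finite M" unfolding M_def by (intro finite_cover bounded_sub inward_sub discrete)
  have "\<forall>\<^sub>F \<epsilon> in at_right 0. \<forall>x\<in>M. p - x \<in> inward D (d + \<epsilon> *\<^sub>R e)"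
  proof (intro eventually_ball_finite[OF finM] ballI)
    fix x assume "x \<in> M"
    then obtain t where t: "p - x \<in> D" "t > 0" "p - x + t *\<^sub>R d \<in> interior D"
      by (auto simp: M_def inward_def)
    have "\<forall>\<^sub>F \<epsilon> in at_right 0. (p - x + t *\<^sub>R d) + \<epsilon> *\<^sub>R (t *\<^sub>R e) \<in> interior D"
      by (rule eventually_right_open[OF open_interior t(3)])
    then show "\<forall>\<^sub>F \<epsilon> in at_right 0. p - x \<in> inward D (d + \<epsilon> *\<^sub>R e)"
    proof eventually_elim
      case (elim \<epsilon>)
      then have "p - x + t *\<^sub>R (d + \<epsilon> *\<^sub>R e) \<in> interior D" by (simp add: algebra_simps)
      then show ?case using t by (auto simp: inward_def)
    qed
  qed
  then obtain \<epsilon> where \<epsilon>: "\<forall>x\<in>M. p - x \<in> inward D (d + \<epsilon> *\<^sub>R e)" "\<epsilon> > 0"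
    using eventually_right_pos by blast
  define f where "f = d + \<epsilon> *\<^sub>R e"
  have in0: "p0 \<in> inward D f" using d(3)[OF \<epsilon>(2)] p0 by (auto simp: inward_def f_def)
  have "f \<noteq> 0" using d(3)[OF \<epsilon>(2)] p0 by (auto simp: f_def)
  have "p0 \<notin> inward D d"
  proof
    assume "p0 \<in> inward D d"
    then obtain t where "p0 + t *\<^sub>R d \<in> interior D" by (auto simp: inward_def)
    from interior_cr_pos[OF this \<open>d \<noteq> 0\<close>, of 1 p0] d(1) show False by auto
  qed
  then have "x0 \<notin> M" by (simp add: M_def p_def)
  have "X x0 + sum X M = sum X (insert x0 M)" using finM \<open>x0 \<notin> M\<close> by simp
  also have "\<dots> \<le> sum X {x. X x > 0 \<and> p - x \<in> inward D f}"
  proof (rule sum_mono2)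
    show "finite {x. X x > 0 \<and> p - x \<in> inward D f}"
      by (intro finite_cover bounded_sub inward_sub discrete)
    show "insert x0 M \<subseteq> {x. X x > 0 \<and> p - x \<in> inward D f}"
      using \<epsilon>(1) x0 in0 by (auto simp: M_def p_def f_def)
  qed auto
  finally have "X x0 + cover_count (inward D d) X p \<le> cover_count (inward D f) X p"
    by (simp add: cover_count_eq M_def)
  then have "cover_count (along 1 D d) X p > 0"
    using local_balance[OF \<open>d \<noteq> 0\<close>, of 1 p] local_balance[OF \<open>f \<noteq> 0\<close>, of 1 p] x0 by simp
  then have "along 1 D d \<noteq> {}" by auto
  then show thesis using that \<open>d \<noteq> 0\<close> d(1) by blast
qed

text \<open>Every edge is opposed by an edge of one of the finitely many tiles meeting \<open>D\<close>, and the
  translation \<open>w\<close> of that tile determines the direction of the edge.\<close>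

lemma finite_extreme_points: "finite {v. v extreme_point_of D}"
proof -
  obtain x0 where x0: "X x0 > 0" by (rule translate_exists)
  obtain c where c: "c \<in> interior D" using D_facts by blast
  obtain R where R: "\<And>y. y \<in> D \<Longrightarrow> norm y \<le> R" using D_facts(4) bounded_iff by blast
  define N where "N = (\<lambda>x. x - x0) ` {x. X x > 0 \<and> x0 - x \<in> cball 0 (2 * R)}"
  have finN: "finite N" unfolding N_def by (intro finite_imageI finite_cover bounded_cball discrete)
  \<comment> \<open>Here \<open>w\<close> is the displacement of a tile that touches
    \<open>D\<close> at \<open>p\<close> across the line in direction \<open>d\<close>. The point
    \<open>p\<close> is the middle of a segment of \<open>D\<close> on that line; this is what makes
    \<open>w\<close> determine \<open>d\<close> up to a positive factor.\<close>
  define Q where "Q w d \<longleftrightarrow> d \<noteq> 0 \<and> (\<exists>p y s. w = p - y \<and> p \<in> D \<and> y \<in> D \<and> s > 0 \<and>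
     p + s *\<^sub>R d \<in> D \<and> p - s *\<^sub>R d \<in> D \<and> (\<forall>z\<in>D. cr d (z - p) \<ge> 0) \<and> (\<forall>z\<in>D. cr d (z - y) \<le> 0))"
    for w d
  have par: "\<exists>r>0. d' = r *\<^sub>R d" if Q12: "Q w d" "Q w d'" for w d d'
  proof -
    obtain p y s where 1: "d \<noteq> 0" "w = p - y" "p \<in> D" "y \<in> D" "s > 0" "p + s *\<^sub>R d \<in> D"
      "p - s *\<^sub>R d \<in> D" "\<forall>z\<in>D. cr d (z - p) \<ge> 0" "\<forall>z\<in>D. cr d (z - y) \<le> 0"
      using Q12(1) unfolding Q_def by blast
    obtain p' y' where 2: "w = p' - y'" "p' \<in> D" "y' \<in> D"
      "\<forall>z\<in>D. cr d' (z - p') \<ge> 0" "\<forall>z\<in>D. cr d' (z - y') \<le> 0"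
      using Q12(2) unfolding Q_def by blast
    have eq: "p - p' = y - y'" using 1 2 by (simp add: algebra_simps)
    have "cr d' (p - p') \<ge> 0" "cr d' (y - y') \<le> 0" using 1 2 by blast+
    moreover have "cr d' (p - p') = cr d' (y - y')" by (simp only: eq)
    ultimately have z: "cr d' p = cr d' p'" by simp
    have "cr d' (p + s *\<^sub>R d - p') \<ge> 0" "cr d' (p - s *\<^sub>R d - p') \<ge> 0" using 1 2 by blast+
    then have "s * cr d' d \<le> 0" "s * cr d' d \<ge> 0" using z by auto
    then have "cr d' d = 0" using 1(5) by (smt (verit) mult_eq_0_iff)
    then have "cr d d' = 0" by (simp add: cr_swap[of d d'])
    then obtain r where r: "d' = r *\<^sub>R d" using cr_zero_imp_parallel[OF 1(1)] by metis
    have "r \<noteq> 0" using r Q12(2) by (auto simp: Q_def)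
    \<comment> \<open>Opposite directions would squeeze \<open>D\<close> into a line.\<close>
    moreover have False if "r < 0"
    proof -
      have le: "cr d (z - p') \<le> 0" if "z \<in> D" for z
      proof -
        have "r * cr d (z - p') \<ge> 0" using 2(4) that unfolding r cr_simps(7) by blast
        then show ?thesis using \<open>r < 0\<close> by (simp add: zero_le_mult_iff)
      qed
      have ge: "cr d (z - y') \<ge> 0" if "z \<in> D" for z
      proof -
        have "r * cr d (z - y') \<le> 0" using 2(5) that unfolding r cr_simps(7) by blast
        then show ?thesis using \<open>r < 0\<close> by (simp add: mult_le_0_iff)
      qed
      have "cr d (p - p') = cr d (y - y')" by (simp only: eq)
      then have "cr d p = cr d p'" using le[OF 1(3)] ge[OF 1(4)] by simp
      moreover have "cr d (c - p) > 0" using interior_cr_pos[OF c 1(1), of 1 p] 1(8) by simp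
      moreover have "cr d (c - p') \<le> 0" using le c interior_subset by blast
      ultimately show False by simp
    qed
    ultimately have "r > 0" by force
    then show ?thesis using r by blast
  qed
  \<comment> \<open>All points of \<open>T w\<close> are supported in one common direction, hence
    lie on one face, and a segment has at most two extreme points.\<close>
  define T where "T w = {v. v extreme_point_of D \<and> (\<exists>d. Q w d \<and> (\<forall>q\<in>D. cr d (q - v) \<ge> 0))}" for w
  have "finite (T w)" for w
  proof (cases "T w = {}")
    case False
    then obtain v d where v: "v extreme_point_of D" "Q w d" "\<forall>q\<in>D. cr d (q - v) \<ge> 0"
      by (auto simp: T_def)
    have vD: "v \<in> D" "d \<noteq> 0" using v by (auto simp: extreme_point_of_def Q_def)
    obtain a b where ab: "{z \<in> D. cr d (z - v) = 0} = closed_segment a b"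
      using face_segment[OF D_facts(1,2) vD(2,1)] by blast
    have "v' \<in> {a, b}" if "v' \<in> T w" for v'
    proof -
      obtain d' where d': "v' extreme_point_of D" "Q w d'" "\<forall>q\<in>D. cr d' (q - v') \<ge> 0"
        using \<open>v' \<in> T w\<close> by (auto simp: T_def)
      have v'D: "v' \<in> D" using d' by (auto simp: extreme_point_of_def)
      obtain r where r: "r > 0" "d' = r *\<^sub>R d" using par[OF v(2) d'(2)] by blast
      have "r * cr d (v - v') \<ge> 0" using d'(3) vD(1) unfolding r(2) cr_simps(7) by blast
      then have "cr d (v - v') \<ge> 0" using r(1) by (simp add: zero_le_mult_iff)
      moreover have "cr d (v' - v) \<ge> 0" using v(3) v'D by blast
      ultimately have "v' \<in> closed_segment a b" using v'D unfolding ab[symmetric] by simp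
      moreover have "closed_segment a b \<subseteq> D" using ab by blast
      ultimately have "v' extreme_point_of closed_segment a b"
        using d'(1) by (auto simp: extreme_point_of_def)
      then show ?thesis by (simp add: extreme_point_of_segment)
    qed
    then show ?thesis by (meson finite.emptyI finite.insertI finite_subset subsetI)
  qed simp
  moreover have "{v. v extreme_point_of D} \<subseteq> (\<Union>w\<in>N. T w)"
  proof
    fix v assume "v \<in> {v. v extreme_point_of D}"
    then have v: "v extreme_point_of D" by simp
    then have vD: "v \<in> D" "v \<notin> interior D" 
      using extreme_point_not_in_interior[OF v] by (auto simp: extreme_point_of_def)
    obtain d where d: "d \<noteq> 0" "\<And>q. q \<in> D \<Longrightarrow> cr d (q - v) \<ge> 0" "along 1 D d \<noteq> {}"
      using edge_at_boundary[OF vD] by blast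
    then obtain y t where y: "y \<in> D" "t > 0" "y + t *\<^sub>R d \<in> D" "\<forall>z\<in>D. cr d (z - y) \<ge> 0"
      by (auto simp: along_def)
    define p where "p = y + (t/2) *\<^sub>R d"
    have p: "p \<in> D" "p + (t/2) *\<^sub>R d \<in> D" "p - (t/2) *\<^sub>R d \<in> D"
      using segment_small[OF D_facts(1) y(1,3), of "t/2"] y by (auto simp: p_def algebra_simps simp flip: scaleR_left_distrib)
    have pz: "\<forall>z\<in>D. cr d (z - p) \<ge> 0" using y(4) by (simp add: p_def)
    have "p \<in> along 1 D d" using p pz y(2) by (auto simp: along_def intro!: exI[of _ "t/2"])
    then have "X (p + x0 - p) \<le> cover_count (along 1 D d) X (p + x0)"
      by (intro cover_count_ge bounded_sub along_sub discrete)
    then have "cover_count (along (-1) D d) X (p + x0) > 0"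
      using x0 local_balance[OF d(1), of 1 "p + x0"] local_balance[OF d(1), of "-1" "p + x0"] by simp
    then obtain y' where y': "y' \<in> along (-1) D d" "X (p + x0 - y') > 0"
      by (rule cover_count_pos)
    have y'D: "y' \<in> D" "\<forall>z\<in>D. cr d (z - y') \<le> 0" using y'(1) by (auto simp: along_def)
    have Q: "Q (p - y') d" unfolding Q_def using d(1) p pz y(2) y'D
      by (intro conjI exI[of _ p] exI[of _ y'] exI[of _ "t/2"]) auto
    have "norm (y' - p) \<le> 2 * R" using R[OF p(1)] R[OF y'D(1)] norm_triangle_ineq4[of y' p] by linarith
    then have "p - y' \<in> N" unfolding N_def using y'(2)
      by (intro image_eqI[of _ _ "p + x0 - y'"]) auto
    moreover have "v \<in> T (p - y')" unfolding T_def using v Q d(2) by blast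
    ultimately show "v \<in> (\<Union>w\<in>N. T w)" by blast
  qed
  ultimately show ?thesis using finN by (meson finite_UN_I finite_subset)
qed

end

section \<open>The boundary of a convex polygon\<close>

lemma cr_plucker: "cr g h * cr x y = cr g x * cr h y - cr g y * cr h x"
  by (simp add: cr_def algebra_simps)

locale polygon =
  fixes D :: "plane set"
  assumes cvx: "convex D" and cpt: "compact D" and int_ne: "interior D \<noteq> {}"
    and fin: "finite {v. v extreme_point_of D}"
begin

definition edge :: "plane \<Rightarrow> plane \<Rightarrow> bool" where
  "edge v w \<longleftrightarrow> v extreme_point_of D \<and> w extreme_point_of D \<and> v \<noteq> w \<and>
     (\<forall>q\<in>D. cr (w - v) (q - v) \<ge> 0)"

lemma D_hull: "D = convex hull {v. v extreme_point_of D}"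
  using Krein_Milman_Minkowski[OF cpt cvx] .

lemma polytope_D: "polytope D"
  using D_hull fin unfolding polytope_def by blast

lemma extreme_in: "v extreme_point_of D \<Longrightarrow> v \<in> D"
  by (simp add: extreme_point_of_def)

text \<open>Gift wrapping: a vertex of a polytope is exposed, so \<open>cr g\<close> is positive on
  all other points seen from \<open>v\<close>. The vertex of least slope \<open>r\<close> is the
  next one, and the Pluecker relation turns the comparison of slopes into the sign of a cross
  product.\<close>

lemma edge_exists:
  assumes v: "v extreme_point_of D"
  obtains w where "edge v w"
proof -
  have "{v} face_of D" using v by (simp add: face_of_singleton)
  then have "{v} exposed_face_of D"
    using exposed_face_of_polyhedron polytope_D polytope_imp_polyhedron by blast
  then obtain a b where ab: "D \<subseteq> {x. a \<bullet> x \<le> b}" "{v} = D \<inter> {x. a \<bullet> x = b}"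
    unfolding exposed_face_of_def by blast
  obtain g where g: "\<And>z. - a \<bullet> z = cr g z" using inner_eq_cr by metis
  have gpos: "cr g (q - v) > 0" if "q \<in> D" "q \<noteq> v" for q
  proof -
    have "a \<bullet> q \<le> b" "a \<bullet> q \<noteq> b" "a \<bullet> v = b" using ab that by auto
    then have "- a \<bullet> (q - v) > 0" by (simp add: inner_diff_right)
    then show ?thesis by (simp only: g)
  qed
  define T where "T = {w. w extreme_point_of D} - {v}"
  have "T \<noteq> {}"
  proof
    assume "T = {}"
    then have "{w. w extreme_point_of D} \<subseteq> {v}" by (auto simp: T_def)
    then have "D \<subseteq> {v}" by (subst D_hull) (metis hull_mono convex_hull_singleton)
    then show False using int_ne interior_mono[of D "{v}"] by simp
  qed
  then obtain q0 where "q0 \<in> T" by blast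
  then have "g \<noteq> 0" using gpos[of q0] extreme_in by (auto simp: T_def)
  then obtain h where h: "cr g h = 1" using cr_nonzero_exists by blast
  define r where "r q = cr h (q - v) / cr g (q - v)" for q
  have "finite T" using fin by (simp add: T_def)
  then obtain w where w: "w \<in> T" "\<And>q. q \<in> T \<Longrightarrow> r w \<le> r q"
    using \<open>T \<noteq> {}\<close> by (metis ex_is_arg_min_if_finite is_arg_min_linorder)
  have wD: "w extreme_point_of D" "w \<noteq> v" "w \<in> D" using w(1) extreme_in by (auto simp: T_def)
  have pos: "cr (w - v) (q - v) \<ge> 0" if "q extreme_point_of D" for q
  proof (cases "q = v")
    case False
    then have q: "q \<in> T" "q \<in> D" using that extreme_in by (auto simp: T_def)
    have G: "cr g (w - v) > 0" "cr g (q - v) > 0" using gpos wD q False by auto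
    have "r w \<le> r q" using w(2) q by blast
    then have "cr h (w - v) * cr g (q - v) \<le> cr h (q - v) * cr g (w - v)"
      using G unfolding r_def by (simp add: divide_simps mult.commute split: if_splits)
    moreover have "cr g h * cr (w - v) (q - v) = cr g (w - v) * cr h (q - v) - cr g (q - v) * cr h (w - v)"
      by (rule cr_plucker)
    ultimately show ?thesis unfolding h by (simp only: mult.commute)
  qed simp
  have "convex hull {q. q extreme_point_of D} \<subseteq> {q. cr (w - v) (q - v) \<ge> 0}"
    using pos by (intro hull_minimal convex_cr_halfplane) auto
  then have "\<forall>q\<in>D. cr (w - v) (q - v) \<ge> 0" using D_hull by blast
  then show thesis using that[of w] v wD by (simp add: edge_def)
qed

lemma extreme_of_segment:
  assumes "closed_segment a b \<subseteq> D" "v extreme_point_of D" "v \<in> closed_segment a b"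
  shows "v = a \<or> v = b"
proof -
  have "v extreme_point_of closed_segment a b"
    using assms by (auto simp: extreme_point_of_def)
  then show ?thesis by (simp add: extreme_point_of_segment)
qed

lemma edge_face:
  assumes "edge v w"
  shows "{q \<in> D. cr (w - v) (q - v) = 0} = closed_segment v w"
proof -
  have e: "v extreme_point_of D" "w extreme_point_of D" "v \<noteq> w" using assms by (auto simp: edge_def)
  obtain a b where ab: "{q \<in> D. cr (w - v) (q - v) = 0} = closed_segment a b"
    using face_segment[OF cvx cpt, of "w - v" v] e extreme_in by auto
  have "closed_segment a b \<subseteq> D" using ab by blast
  moreover have "v \<in> {q \<in> D. cr (w - v) (q - v) = 0}" "w \<in> {q \<in> D. cr (w - v) (q - v) = 0}"
    using e extreme_in by (auto simp: cr_swap[of w v])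
  ultimately have "v = a \<or> v = b" "w = a \<or> w = b" using extreme_of_segment e unfolding ab by blast+
  then show ?thesis using e(3) ab closed_segment_commute by metis
qed

lemma edge_face_extreme:
  assumes "edge v w" "q extreme_point_of D" "cr (w - v) (q - v) = 0"
  shows "q = v \<or> q = w"
proof -
  have "q \<in> closed_segment v w" using edge_face[OF assms(1)] extreme_in[OF assms(2)] assms(3) by blast
  moreover have "closed_segment v w \<subseteq> D" using edge_face[OF assms(1)] by blast
  ultimately show ?thesis using extreme_of_segment assms(2) by blast
qed

lemma edge_unique:
  assumes "edge v w" "edge v w'" shows "w = w'"
proof -
  have e: "v extreme_point_of D" "w extreme_point_of D" "w' extreme_point_of D" "v \<noteq> w'"
    using assms by (auto simp: edge_def)
  have "cr (w - v) (w' - v) \<ge> 0" "cr (w' - v) (w - v) \<ge> 0"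
    using assms extreme_in e unfolding edge_def by blast+
  then have "cr (w - v) (w' - v) = 0" using cr_swap[of "w' - v" "w - v"] by linarith
  then show ?thesis using edge_face_extreme[OF assms(1) e(3)] e by auto
qed

lemma edge_inj:
  assumes "edge v w" "edge v' w" shows "v = v'"
proof -
  have e: "v extreme_point_of D" "w extreme_point_of D" "v' extreme_point_of D" "w \<noteq> v'"
    using assms by (auto simp: edge_def)
  have "cr (w - v) (v' - v) \<ge> 0" "cr (w - v') (v - v') \<ge> 0"
    using assms extreme_in e unfolding edge_def by blast+
  moreover have "cr (w - v') (v - v') = - cr (w - v) (v' - v)"
    by (simp add: cr_def algebra_simps)
  ultimately have "cr (w - v) (v' - v) = 0" by linarith
  then show ?thesis using edge_face_extreme[OF assms(1) e(3)] e by auto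
qed

lemma edge_asym: "edge v w \<Longrightarrow> \<not> edge w v"
proof
  assume "edge v w" "edge w v"
  obtain c where c: "c \<in> interior D" using int_ne by blast
  have "cr (w - v) (c - v) > 0" "cr (v - w) (c - w) > 0"
    using interior_cr_pos[OF c, of "w - v" 1 v] interior_cr_pos[OF c, of "v - w" 1 w]
      \<open>edge v w\<close> \<open>edge w v\<close> by (auto simp: edge_def)
  moreover have "cr (v - w) (c - w) = - cr (w - v) (c - v)" by (simp add: cr_def algebra_simps)
  ultimately show False by simp
qed

text \<open>Following successors must repeat a vertex. Since a vertex also has only one predecessor,
  the repetition can be pulled back to \<open>v0\<close>, and the chain is periodic without a
  preperiod.\<close>

lemma chain_exists:
  assumes "v0 extreme_point_of D"
  obtains v N where "v 0 = v0" "N > 0" "\<And>n. edge (v n) (v (Suc n))" "\<And>n. v (n + N) = v n"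
proof -
  define nx where "nx v = (SOME w. edge v w)" for v
  have nx: "edge v (nx v)" if "v extreme_point_of D" for v
    unfolding nx_def using edge_exists[OF that] by (metis someI)
  define v where "v n = (nx ^^ n) v0" for n
  have ext: "v n extreme_point_of D" for n
    by (induction n) (use assms nx edge_def in \<open>auto simp: v_def\<close>)
  have e: "edge (v n) (v (Suc n))" for n
    using nx[OF ext] by (simp add: v_def)
  have "\<not> inj v"
  proof
    assume "inj v"
    have "range v \<subseteq> {w. w extreme_point_of D}" using ext by auto
    then have "finite (range v)" using fin finite_subset by blast
    then show False using finite_imageD[OF _ \<open>inj v\<close>] infinite_UNIV_nat by blast
  qed
  then obtain i j where ij: "i < j" "v i = v j" unfolding inj_def by (metis linorder_neqE_nat)
  have "v 0 = v (j - i)" using ij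
  proof (induction i arbitrary: j)
    case (Suc i)
    then obtain j' where j': "j = Suc j'" by (cases j) auto
    then have "v i = v j'" using Suc.prems edge_inj e by metis
    then show ?case using Suc.IH[of j'] Suc.prems j' by simp
  qed simp
  then have "v (n + (j - i)) = v n" for n by (induction n) (auto simp: v_def)
  then show thesis using that[of v "j - i"] e ij by (simp add: v_def)
qed

end

section \<open>Closed chains of edges\<close>

locale polygon_chain = polygon +
  fixes v :: "nat \<Rightarrow> plane" and N :: nat
  assumes N_pos: "N > 0" and chain: "\<And>n. edge (v n) (v (Suc n))" and period: "\<And>n. v (n + N) = v n"
begin

definition u :: "nat \<Rightarrow> plane" where "u n = v (Suc n) - v n"

lemma v_extreme: "v n extreme_point_of D" and v_in: "v n \<in> D"
  using chain[of n] extreme_in by (auto simp: edge_def)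

lemma u_nonzero: "u n \<noteq> 0"
  using chain[of n] by (auto simp: edge_def u_def)

lemma u_support: "q \<in> D \<Longrightarrow> cr (u n) (q - v n) \<ge> 0"
  using chain[of n] by (auto simp: edge_def u_def)

lemma u_turn: "cr (u n) (u (Suc n)) > 0"
proof -
  have "cr (u n) (v (Suc (Suc n)) - v n) \<ge> 0" using u_support v_in by blast
  moreover have "cr (u n) (v (Suc (Suc n)) - v n) \<noteq> 0"
  proof
    assume "cr (u n) (v (Suc (Suc n)) - v n) = 0"
    then have "v (Suc (Suc n)) = v n \<or> v (Suc (Suc n)) = v (Suc n)"
      using edge_face_extreme[OF chain v_extreme] by (simp add: u_def)
    then show False using chain[of n] chain[of "Suc n"] edge_asym edge_def by metis
  qed
  moreover have "cr (u n) (v (Suc (Suc n)) - v n) = cr (u n) (u (Suc n))"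
    by (simp add: u_def) (simp add: cr_def algebra_simps)
  ultimately show ?thesis by linarith
qed

lemma local_min_global:
  assumes "cr d (u n) \<le> 0" "cr d (u (Suc n)) \<ge> 0" "q \<in> D"
  shows "cr d (q - v (Suc n)) \<ge> 0"
proof (rule cr_cone[of "u n" "u (Suc n)"])
  have "cr (u n) (q - v (Suc n)) = cr (u n) (q - v n)" unfolding u_def by (simp add: cr_def algebra_simps)
  then show "cr (u n) (q - v (Suc n)) \<ge> 0" using u_support[OF assms(3)] by simp
qed (use u_turn u_support assms in auto)

lemma period_mult: "v (n + j * N) = v n"
proof (induction j)
  case (Suc j)
  have "v (n + Suc j * N) = v ((n + j * N) + N)" by (simp add: algebra_simps)
  then show ?case using Suc period by simp
qed simp

lemma min_on_chain:
  obtains n where "\<And>q. q \<in> D \<Longrightarrow> cr d (q - v n) \<ge> 0"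
proof -
  have "range v \<subseteq> {v. v extreme_point_of D}" using v_extreme by auto
  then have "finite (range v)" using fin finite_subset by blast
  then obtain n where n: "\<And>i. cr d (v n) \<le> cr d (v i)" using min_on_finite_range[of v "cr d"] by blast
  obtain n' where n': "v (Suc n') = v n" using period[of n] N_pos by (metis add_Suc_right gr0_conv_Suc)
  have "cr d (u n') \<le> 0" using n[of n'] n' by (simp add: u_def)
  moreover have "cr d (u (Suc n')) \<ge> 0" using n[of "Suc (Suc n')"] n' by (simp add: u_def)
  ultimately show thesis using that[of "Suc n'"] local_min_global by blast
qed

text \<open>The chain started at \<open>w\<close> contains a vertex of least height over edge
  \<open>0\<close> of the given chain, hence an end of that edge. From a common vertex on the two
  chains agree, and the periodicity of the second one leads back to \<open>w\<close>.\<close>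

lemma chain_covers:
  assumes "w extreme_point_of D" shows "w \<in> range v"
proof -
  obtain v' N' where v': "v' 0 = w" "N' > 0" "\<And>n. edge (v' n) (v' (Suc n))" "\<And>n. v' (n + N') = v' n"
    using chain_exists[OF assms] by blast
  interpret c: polygon_chain D v' N' by unfold_locales (use v' in auto)
  obtain n where n: "\<And>q. q \<in> D \<Longrightarrow> cr (u 0) (q - v' n) \<ge> 0" using c.min_on_chain by blast
  have "cr (u 0) (v 0 - v' n) \<ge> 0" "cr (u 0) (v' n - v 0) \<ge> 0"
    using n v_in u_support c.v_in by blast+
  then have "cr (v 1 - v 0) (v' n - v 0) = 0" by (simp add: u_def)
  then have "v' n = v 0 \<or> v' n = v 1"
    using edge_face_extreme[OF chain[of 0] c.v_extreme[of n]] by simp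
  then obtain i where i: "v' n = v i" by blast
  have "v' (n + j) = v (i + j)" for j
    by (induction j) (use i edge_unique chain v'(3) in \<open>auto, metis\<close>)
  moreover have "w = v' (n + (n * N' - n))"
    using c.period_mult[of 0 n] v'(1,2) by simp
  ultimately show ?thesis by (metis rangeI)
qed

text \<open>The first edge after the \<open>n\<close>-th one that no longer ascends relative to it starts at
  a vertex of maximal height, hence is the opposite edge.\<close>

lemma opposite_shift:
  assumes opp: "\<And>n. \<exists>s. edge s (s - u n)"
  obtains m where "m \<ge> 2" "\<And>n. u (n + m) = - u n" "\<And>n i. 0 < i \<Longrightarrow> i < m \<Longrightarrow> cr (u n) (u (n + i)) > 0"
proof -
  define P where "P n i \<longleftrightarrow> i \<ge> 1 \<and> cr (u n) (u (n + i)) \<le> 0" for n i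
  have ex: "\<exists>i. P n i" for n
  proof (rule ccontr)
    assume "\<nexists>i. P n i"
    then have pos: "cr (u n) (u (n + i)) > 0" if "i \<ge> 1" for i using that by (auto simp: P_def)
    have "cr (u n) (v (n + 1 + i)) \<ge> cr (u n) (v (n + 1))" for i
    proof (induction i)
      case (Suc i)
      then show ?case using pos[of "Suc i"] by (simp add: u_def)
    qed simp
    then have ge: "cr (u n) (v (n + 1 + i)) \<ge> cr (u n) (v (n + 1))" for i .
    have "cr (u n) (v (n + 1 + N)) > cr (u n) (v (n + 1))"
    proof (cases N)
      case (Suc N')
      then show ?thesis using pos[of "Suc N'"] ge[of N'] by (simp add: u_def)
    qed (use N_pos in simp)
    then show False using period[of "n + 1"] by simp
  qed
  define M where "M n = (LEAST i. P n i)" for n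
  have M: "P n (M n)" for n unfolding M_def by (rule LeastI_ex[OF ex])
  have less: "cr (u n) (u (n + i)) > 0" if "0 < i" "i < M n" for n i
    using not_less_Least[of i "P n"] that unfolding M_def P_def by auto
  have M2: "M n \<ge> 2" for n
  proof (rule ccontr)
    assume "\<not> M n \<ge> 2"
    then have "M n = 1" using M[of n] by (auto simp: P_def)
    then show False using M[of n] u_turn[of n] by (simp add: P_def)
  qed
  have uM: "u (n + M n) = - u n" for n
  proof -
    obtain j where j: "M n = Suc j" "j \<ge> 1" using M2[of n] by (cases "M n") auto
    have up: "cr (u n) (u (n + j)) > 0" using less[of j n] j by simp
    have mx: "cr (- u n) (q - v (n + M n)) \<ge> 0" if "q \<in> D" for q
      using local_min_global[of "- u n" "n + j" q] up M[of n] j that by (simp add: P_def)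
    obtain s where s: "edge s (s - u n)" using opp by blast
    have sD: "s \<in> D" using s extreme_in by (simp add: edge_def)
    have "cr (- u n) (v (n + M n) - s) \<ge> 0" using s v_in[of "n + M n"] by (simp add: edge_def)
    then have "cr (s - u n - s) (v (n + M n) - s) = 0" using mx[OF sD] by simp
    then have "v (n + M n) = s \<or> v (n + M n) = s - u n"
      using edge_face_extreme[OF s v_extreme] by blast
    \<comment> \<open>The highest vertex is one end of the opposite edge. Were it the later end, the
      edge just passed would already be \<open>- u n\<close>, although the height was still rising
      there.\<close>
    moreover have False if "v (n + M n) = s - u n"
    proof -
      have "edge (v (n + j)) (s - u n)" using chain[of "n + j"] j that by simp
      then have "v (n + j) = s" using edge_inj s by blast
      then have "u (n + j) = - u n" using that j by (simp add: u_def)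
      then show False using up by simp
    qed
    ultimately have "v (n + M n) = s" by blast
    moreover from this have "v (Suc (n + M n)) = s - u n" using chain[of "n + M n"] s edge_unique by metis
    ultimately show ?thesis by (simp add: u_def)
  qed
  \<comment> \<open>If the shift dropped, \<open>- u (Suc n)\<close> would appear no later than
    \<open>- u n\<close>, which the left turn from \<open>u n\<close> to \<open>u (Suc n)\<close>
    excludes. Nondecreasing and periodic, the shift is constant.\<close>
  have mono: "M n \<le> M (Suc n)" for n
  proof (rule ccontr)
    assume "\<not> M n \<le> M (Suc n)"
    then have lt: "M (Suc n) < M n" by simp
    have e: "u (n + Suc (M (Suc n))) = - u (Suc n)" using uM[of "Suc n"] by simp
    show False
    proof (cases "Suc (M (Suc n)) = M n")
      case True
      then have "u n = u (Suc n)" using uM[of n] e by simp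
      then show False using u_turn[of n] by simp
    next
      case False
      then show False using less[of "Suc (M (Suc n))" n] lt e u_turn[of n] by simp
    qed
  qed
  have upN: "u (n + j * N) = u n" for n j
    using period_mult[of n j] period_mult[of "Suc n" j] by (simp add: u_def)
  have "P (n * N) = P 0" for n
  proof -
    have "u (n * N + i) = u i" for i using upN[of i n] by (simp add: add.commute)
    then show ?thesis using upN[of 0 n] by (auto simp: P_def fun_eq_iff)
  qed
  then have MN: "M (n * N) = M 0" for n by (simp add: M_def)
  have mono2: "i \<le> j \<Longrightarrow> M i \<le> M j" for i j using mono lift_Suc_mono_le by blast
  have "M n = M 0" for n
    using mono2[of 0 n] mono2[of n "n * N"] MN[of n] N_pos by simp
  then show thesis using that[of "M 0"] M2 uM less by metis
qed

end

section \<open>Opposite edges have equal length\<close>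

text \<open>The half-open edge swept along \<open>n\<close>: for \<open>cr d n = 1\<close> the two
  cross products are the coordinates of \<open>z - s\<close> with respect to \<open>d\<close> and
  \<open>n\<close>.\<close>

definition parallelogram_cell :: "plane \<Rightarrow> plane \<Rightarrow> real \<Rightarrow> plane \<Rightarrow> plane set" where
  "parallelogram_cell d n \<nu> s = {z. 0 \<le> cr (z - s) n \<and> cr (z - s) n < \<nu> \<and> 0 \<le> cr d (z - s) \<and> cr d (z - s) < 1}"

lemma half_open_edge_iff:
  assumes "cr d n = 1"
  shows "z \<in> half_open_edge d \<nu> s \<longleftrightarrow> cr d (z - s) = 0 \<and> 0 \<le> cr (z - s) n \<and> cr (z - s) n < \<nu>"
proof
  assume "z \<in> half_open_edge d \<nu> s"
  then obtain t where "z = s + t *\<^sub>R d" "0 \<le> t" "t < \<nu>" by (auto simp: half_open_edge_def)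
  then show "cr d (z - s) = 0 \<and> 0 \<le> cr (z - s) n \<and> cr (z - s) n < \<nu>" using assms by simp
next
  assume a: "cr d (z - s) = 0 \<and> 0 \<le> cr (z - s) n \<and> cr (z - s) n < \<nu>"
  then have "z - s = cr (z - s) n *\<^sub>R d" using cr_decomp[of d n "z - s"] assms by simp
  then have "z = s + cr (z - s) n *\<^sub>R d" by (metis add.commute diff_add_cancel)
  then show "z \<in> half_open_edge d \<nu> s" using a by (auto simp: half_open_edge_def)
qed

lemma bounded_cell:
  assumes "cr d n = 1" shows "bounded (parallelogram_cell d n \<nu> s)"
proof -
  have "norm z \<le> norm s + (\<nu> * norm d + norm n)" if z: "z \<in> parallelogram_cell d n \<nu> s" for z
  proof -
    have "z - s = cr (z - s) n *\<^sub>R d + cr d (z - s) *\<^sub>R n" using cr_decomp[of d n "z - s"] assms by simp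
    then have "norm (z - s) \<le> \<bar>cr (z - s) n\<bar> * norm d + \<bar>cr d (z - s)\<bar> * norm n"
      by (metis norm_scaleR norm_triangle_ineq)
    also have "\<dots> \<le> \<nu> * norm d + 1 * norm n"
      using z by (intro add_mono mult_right_mono) (auto simp: parallelogram_cell_def simp del: cr_simps)
    finally show ?thesis using norm_triangle_ineq[of s "z - s"] by simp
  qed
  then show ?thesis unfolding bounded_iff by blast
qed

text \<open>Every tile counted by the cell is counted by exactly one slice, the one at height
  \<open>r = cr d (p - x - s)\<close>. Only finitely many heights occur at a given \<open>p\<close>,
  so a finite \<open>R\<close> replaces the continuum of slices.\<close>

lemma cover_count_cell:
  assumes dn: "cr d n = 1" and N: "finite N" "{x. X x > 0 \<and> p - x \<in> parallelogram_cell d n \<nu> s} \<subseteq> N"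
    and R: "finite R" "R \<subseteq> {0..<1}" "\<And>x. x \<in> N \<Longrightarrow> 0 \<le> cr d (p - x - s) \<Longrightarrow> cr d (p - x - s) < 1 \<Longrightarrow> cr d (p - x - s) \<in> R"
  shows "cover_count (parallelogram_cell d n \<nu> s) X p = (\<Sum>r\<in>R. cover_count (half_open_edge d \<nu> s) X (p - r *\<^sub>R n))"
proof -
  have shift: "p - r *\<^sub>R n - x \<in> half_open_edge d \<nu> s \<longleftrightarrow>
      cr d (p - x - s) = r \<and> 0 \<le> cr (p - x - s) n \<and> cr (p - x - s) n < \<nu>" for r x
    using dn by (auto simp: half_open_edge_iff[OF dn] algebra_simps)
  have sub: "{x. X x > 0 \<and> p - r *\<^sub>R n - x \<in> half_open_edge d \<nu> s} \<subseteq> N" if "r \<in> R" for r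
  proof
    fix x assume "x \<in> {x. X x > 0 \<and> p - r *\<^sub>R n - x \<in> half_open_edge d \<nu> s}"
    moreover have "0 \<le> r" "r < 1" using that R(2) by auto
    ultimately have "x \<in> {x. X x > 0 \<and> p - x \<in> parallelogram_cell d n \<nu> s}"
      unfolding shift by (auto simp: parallelogram_cell_def simp del: cr_simps)
    then show "x \<in> N" using N(2) by blast
  qed
  have one: "of_bool (p - x \<in> parallelogram_cell d n \<nu> s) = (\<Sum>r\<in>R. of_bool (p - r *\<^sub>R n - x \<in> half_open_edge d \<nu> s) :: nat)"
    if "x \<in> N" for x
  proof (cases "p - x \<in> parallelogram_cell d n \<nu> s")
    case True
    define r0 where "r0 = cr d (p - x - s)"
    have r0: "r0 \<in> R" using R(3)[OF that] True by (simp add: r0_def parallelogram_cell_def del: cr_simps)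
    have "(\<Sum>r\<in>R. of_bool (p - r *\<^sub>R n - x \<in> half_open_edge d \<nu> s) :: nat) = (\<Sum>r\<in>R. of_bool (r0 = r))"
      unfolding shift r0_def[symmetric] using True by (intro sum.cong) (auto simp: parallelogram_cell_def simp del: cr_simps)
    also have "\<dots> = 1" using r0 R(1) by (simp add: of_bool_def)
    finally show ?thesis using True by simp
  next
    case False
    have "(\<Sum>r\<in>R. of_bool (p - r *\<^sub>R n - x \<in> half_open_edge d \<nu> s) :: nat) = (\<Sum>r\<in>R. 0)"
      unfolding shift using False R(2) by (intro sum.cong) (auto simp: parallelogram_cell_def simp del: cr_simps)
    then show ?thesis using False by simp
  qed
  have "cover_count (parallelogram_cell d n \<nu> s) X p = (\<Sum>x\<in>N. X x * (\<Sum>r\<in>R. of_bool (p - r *\<^sub>R n - x \<in> half_open_edge d \<nu> s)))"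
    using cover_count_of_bool[OF N] one by simp
  also have "\<dots> = (\<Sum>r\<in>R. \<Sum>x\<in>N. X x * of_bool (p - r *\<^sub>R n - x \<in> half_open_edge d \<nu> s))"
    unfolding sum_distrib_left by (rule sum.swap)
  also have "\<dots> = (\<Sum>r\<in>R. cover_count (half_open_edge d \<nu> s) X (p - r *\<^sub>R n))"
    using cover_count_of_bool[OF N(1) sub] by simp
  finally show ?thesis .
qed

lemma cell_borel: "parallelogram_cell d n \<nu> s \<in> sets borel"
proof -
  have 1: "continuous_on UNIV (\<lambda>z. cr d (z - s))"
    by (intro continuous_on_compose2[OF linear_continuous_on[OF bounded_linear_cr]] continuous_intros) auto
  have 2: "continuous_on UNIV (\<lambda>z. cr (z - s) n)"
  proof -
    have "continuous_on UNIV (\<lambda>z. - cr n (z - s))"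
      by (intro continuous_on_minus continuous_on_compose2[OF linear_continuous_on[OF bounded_linear_cr]] continuous_intros) auto
    then show ?thesis using cr_swap[of _ n] by simp
  qed
  have [measurable]: "(\<lambda>z. cr d (z - s)) \<in> borel_measurable borel" "(\<lambda>z. cr (z - s) n) \<in> borel_measurable borel"
    using 1 2 borel_measurable_continuous_onI by blast+
  show ?thesis unfolding parallelogram_cell_def by measurable
qed

lemma nn_integral_translate:
  fixes f :: "plane \<Rightarrow> ennreal"
  assumes [measurable]: "f \<in> borel_measurable borel"
  shows "(\<integral>\<^sup>+p. f (p - x) \<partial>lborel) = (\<integral>\<^sup>+p. f p \<partial>lborel)"
proof -
  have "(\<integral>\<^sup>+p. f p \<partial>lborel) = (\<integral>\<^sup>+p. f p \<partial>distr lborel borel ((+) (- x)))"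
    by (simp add: lborel_distr_plus)
  also have "\<dots> = (\<integral>\<^sup>+p. f (- x + p) \<partial>lborel)" by (subst nn_integral_distr) auto
  finally show ?thesis by simp
qed

text \<open>It suffices that the area grows strictly with \<open>\<nu>\<close>: the longer cell
  contains the shorter one together with a disjoint nonempty open set, and the areas are
  finite.\<close>

lemma cell_emeasure:
  assumes dn: "cr d n = 1" and "0 < \<nu>" "0 < \<nu>'"
    and eq: "emeasure lborel (parallelogram_cell d n \<nu> s) = emeasure lborel (parallelogram_cell d n \<nu>' s')"
  shows "\<nu> = \<nu>'"
proof -
  let ?P = "\<lambda>\<nu>. parallelogram_cell d n \<nu> 0"
  have base: "emeasure lborel (parallelogram_cell d n \<nu> s) = emeasure lborel (?P \<nu>)" for \<nu> s
  proof -
    have "emeasure lborel (parallelogram_cell d n \<nu> s) = (\<integral>\<^sup>+p. indicator (parallelogram_cell d n \<nu> s) p \<partial>lborel)"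
      by (rule nn_integral_indicator[symmetric]) (simp add: cell_borel)
    also have "\<dots> = (\<integral>\<^sup>+p. indicator (?P \<nu>) (p - s) \<partial>lborel)"
      by (rule nn_integral_cong) (simp add: indicator_def parallelogram_cell_def)
    also have "\<dots> = (\<integral>\<^sup>+p. indicator (?P \<nu>) p \<partial>lborel)"
      by (rule nn_integral_translate) (use cell_borel in auto)
    finally show ?thesis using cell_borel by simp
  qed
  have less: "emeasure lborel (?P a) < emeasure lborel (?P b)" if ab: "0 < a" "a < b" for a b
  proof -
    define U where "U = {z. a < cr z n} \<inter> {z. cr z n < b} \<inter> {z. 0 < cr d z} \<inter> {z. cr d z < 1}"
    have c1: "continuous_on UNIV (cr d)" by (intro linear_continuous_on bounded_linear_cr)
    have "continuous_on UNIV (\<lambda>z. - cr n z)" by (intro continuous_on_minus linear_continuous_on bounded_linear_cr)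
    then have c2: "continuous_on UNIV (\<lambda>z. cr z n)" using cr_swap[of _ n] by simp
    have "open U" unfolding U_def by (intro open_Int open_Collect_less c1 c2 continuous_on_const)
    moreover have "((a + b) / 2) *\<^sub>R d + (1/2) *\<^sub>R n \<in> U" using ab dn by (simp add: U_def)
    ultimately have "\<not> negligible U" using open_not_negligible by blast
    then have U: "emeasure lborel U > 0" "U \<in> sets lborel"
      using \<open>open U\<close> by (auto simp: negligible_iff_emeasure0 zero_less_iff_neq_zero)
    have "U \<inter> ?P a = {}" by (auto simp: U_def parallelogram_cell_def)
    then have un: "emeasure lborel (U \<union> ?P a) = emeasure lborel U + emeasure lborel (?P a)"
      using U cell_borel by (intro plus_emeasure[symmetric]) auto
    have "U \<union> ?P a \<subseteq> ?P b" using ab by (auto simp: U_def parallelogram_cell_def)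
    then have le: "emeasure lborel (U \<union> ?P a) \<le> emeasure lborel (?P b)"
      using cell_borel by (intro emeasure_mono) auto
    have "emeasure lborel (?P a) < \<infinity>"
      using bounded_cell[OF dn] emeasure_bounded_finite by blast
    then have "emeasure lborel (?P a) + 0 < emeasure lborel (?P a) + emeasure lborel U"
      unfolding ennreal_add_left_cancel_less using U(1) by auto
    then have "emeasure lborel (?P a) < emeasure lborel (?P a) + emeasure lborel U"
      by (simp only: add_0_right)
    also have "\<dots> = emeasure lborel (U \<union> ?P a)" unfolding un by (rule add.commute)
    also have "\<dots> \<le> emeasure lborel (?P b)" by (rule le)
    finally show ?thesis .
  qed
  have "emeasure lborel (?P \<nu>) = emeasure lborel (?P \<nu>')"
    using eq base[of \<nu> s] base[of \<nu>' s'] by presburger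
  then show ?thesis using less[of \<nu> \<nu>'] less[of \<nu>' \<nu>] assms(2,3)
    by (cases \<nu> \<nu>' rule: linorder_cases) auto
qed

section \<open>Double counting against the reflected tile\<close>

context tiling
begin

text \<open>Substituting \<open>p + x\<close> for \<open>p\<close> in the summand of
  \<open>x\<close> moves the translation from \<open>A\<close> to the reflected tile. Then
  \<open>A\<close> is integrated against the covering number of the tiling at \<open>- p\<close>,
  which is \<open>k\<close> almost everywhere. Since \<open>D\<close> and \<open>A\<close> are
  bounded, finitely many \<open>x\<close> contribute.\<close>

lemma cover_count_integral:
  assumes A: "bounded A" "A \<in> sets borel"
  shows "(\<integral>\<^sup>+p. indicator D (- p) * of_nat (cover_count A X p) \<partial>lborel) = of_nat k * emeasure lborel A"
proof -
  obtain R where R: "\<And>y. y \<in> D \<Longrightarrow> norm y \<le> R" using D_facts(4) bounded_iff by blast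
  obtain R' where R': "\<And>y. y \<in> A \<Longrightarrow> norm y \<le> R'" using A(1) bounded_iff by blast
  define N where "N = {x. X x > 0 \<and> 0 - x \<in> cball 0 (R + R')}"
  have finN: "finite N" unfolding N_def by (intro finite_cover bounded_cball discrete)
  have inN: "x \<in> N" if "X x > 0" "- p \<in> D" "p - x \<in> A" for x p
  proof -
    have "norm x \<le> norm (- p) + norm (p - x)" using norm_triangle_ineq4[of p "p - x"] by simp
    then show ?thesis using R[OF that(2)] R'[OF that(3)] that(1) by (simp add: N_def)
  qed
  have Db: "D \<in> sets borel" using D_facts(3) by (rule borel_closed)
  have [measurable]: "indicator D \<in> borel_measurable borel" "indicator A \<in> borel_measurable borel"
    using Db A by auto
  have "(\<integral>\<^sup>+p. indicator D (- p) * of_nat (cover_count A X p) \<partial>lborel)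
      = (\<integral>\<^sup>+p. (\<Sum>x\<in>N. of_nat (X x) * (indicator D (- p) * indicator A (p - x))) \<partial>lborel)"
  proof (rule nn_integral_cong)
    fix p :: plane
    show "indicator D (- p) * of_nat (cover_count A X p) = (\<Sum>x\<in>N. of_nat (X x) * (indicator D (- p) * indicator A (p - x)) :: ennreal)"
    proof (cases "- p \<in> D")
      case True
      then have "cover_count A X p = (\<Sum>x\<in>N. X x * of_bool (p - x \<in> A))"
        using inN by (intro cover_count_of_bool finN) auto
      then show ?thesis using True by (auto simp: indicator_def of_bool_def intro!: sum.cong)
    qed simp
  qed
  also have "\<dots> = (\<Sum>x\<in>N. of_nat (X x) * (\<integral>\<^sup>+p. indicator D (- p) * indicator A (p - x) \<partial>lborel))"
    by (subst nn_integral_sum) (auto simp: nn_integral_cmult)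
  also have "\<dots> = (\<Sum>x\<in>N. of_nat (X x) * (\<integral>\<^sup>+p. indicator D (- p - x) * indicator A p \<partial>lborel))"
  proof (intro sum.cong refl)
    fix x
    have "(\<integral>\<^sup>+p. indicator D (- (p - x) - x) * indicator A (p - x) \<partial>lborel) =
      (\<integral>\<^sup>+p. indicator D (- p - x) * indicator A p \<partial>(lborel :: plane measure))"
      by (rule nn_integral_translate[of "\<lambda>p. indicator D (- p - x) * indicator A p"]) measurable
    then show "of_nat (X x) * (\<integral>\<^sup>+p. indicator D (- p) * indicator A (p - x) \<partial>lborel)
      = of_nat (X x) * (\<integral>\<^sup>+p. indicator D (- p - x) * indicator A p \<partial>lborel)" by simp
  qed
  also have "\<dots> = (\<integral>\<^sup>+p. (\<Sum>x\<in>N. of_nat (X x) * (indicator D (- p - x) * indicator A p)) \<partial>lborel)"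
    by (subst nn_integral_sum) (auto simp: nn_integral_cmult)
  also have "\<dots> = (\<integral>\<^sup>+p. of_nat k * indicator A p \<partial>lborel)"
  proof (rule nn_integral_cong_AE)
    \<comment> \<open>A point \<open>p\<close> is in \<open>D' x\<close> when \<open>- p\<close>
      lies in the tile \<open>D + x\<close>. Off the frontiers, which are null sets, the closed and
      open covering numbers at \<open>- p\<close> agree, so both equal \<open>k\<close>.\<close>
    define D' where "D' x = {w. - w - x \<in> D}" for x
    have neg: "frontier (D' x) \<in> null_sets lborel" for x
    proof -
      have "convex (D' x)"
        unfolding convex_def
      proof (intro ballI allI impI)
        fix a b and \<alpha> \<beta> :: real
        assume ab: "a \<in> D' x" "b \<in> D' x" "0 \<le> \<alpha>" "0 \<le> \<beta>" "\<alpha> + \<beta> = 1"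
        have "\<alpha> *\<^sub>R (- a - x) + \<beta> *\<^sub>R (- b - x) \<in> D"
          using D_facts(1) ab by (intro convexD) (auto simp: D'_def)
        moreover have "\<alpha> *\<^sub>R (- a - x) + \<beta> *\<^sub>R (- b - x) = - (\<alpha> *\<^sub>R a + \<beta> *\<^sub>R b) - (\<alpha> + \<beta>) *\<^sub>R x"
          by (simp add: algebra_simps)
        ultimately show "\<alpha> *\<^sub>R a + \<beta> *\<^sub>R b \<in> D' x" using ab by (simp add: D'_def)
      qed
      then have "negligible (frontier (D' x))" by (rule negligible_convex_frontier)
      then show ?thesis by (simp add: negligible_iff_null_sets null_sets_completion_iff)
    qed
    have "(\<Union>x\<in>N. frontier (D' x)) \<in> null_sets lborel"
      using finN neg by (intro null_sets_UN') (auto intro: countable_finite)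
    then show "AE p in lborel. (\<Sum>x\<in>N. of_nat (X x) * (indicator D (- p - x) * indicator A p)) = (of_nat k * indicator A p :: ennreal)"
    proof (rule AE_I')
      show "{p \<in> space lborel. (\<Sum>x\<in>N. of_nat (X x) * (indicator D (- p - x) * indicator A p)) \<noteq> (of_nat k * indicator A p :: ennreal)}
        \<subseteq> (\<Union>x\<in>N. frontier (D' x))"
      proof (rule ccontr)
        assume "\<not> ?thesis"
        then obtain p where p: "(\<Sum>x\<in>N. of_nat (X x) * (indicator D (- p - x) * indicator A p)) \<noteq> (of_nat k * indicator A p :: ennreal)"
          "\<And>x. x \<in> N \<Longrightarrow> p \<notin> frontier (D' x)" by auto
        have "p \<in> A" using p(1) by (cases "p \<in> A") auto
        have N': "x \<in> N" if "X x > 0" "- p - x \<in> D" for x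
        proof -
          have "norm x \<le> norm (- p - x) + norm p" using norm_triangle_ineq4[of "- p - x" "- p"] by simp
          then show ?thesis using R[OF that(2)] R'[OF \<open>p \<in> A\<close>] that(1) by (simp add: N_def)
        qed
        have int: "- p - x \<in> interior D" if "x \<in> N" "- p - x \<in> D" for x
        proof -
          have "p \<in> D' x" using that by (simp add: D'_def)
          then have "p \<in> interior (D' x)" using p(2)[OF that(1)] closure_subset by (auto simp: frontier_def)
          then obtain e where e: "e > 0" "ball p e \<subseteq> D' x" using mem_interior by blast
          have "ball (- p - x) e \<subseteq> D"
          proof
            fix q assume "q \<in> ball (- p - x) e"
            moreover have "p - (- q - x) = - (- p - x - q)" by simp
            ultimately have "- q - x \<in> ball p e"
              by (metis dist_norm mem_ball norm_minus_cancel)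
            then have "- (- q - x) - x \<in> D" using e(2) unfolding D'_def by blast
            then show "q \<in> D" by simp
          qed
          then show ?thesis using e(1) mem_interior by blast
        qed
        have "{x. X x > 0 \<and> - p - x \<in> D} = {x. X x > 0 \<and> - p - x \<in> interior D}"
          using int N' interior_subset by blast
        then have "cover_count D X (- p) = cover_count (interior D) X (- p)" by (simp add: cover_count_eq)
        then have "cover_count D X (- p) = k" using cover_ge[of "- p"] cover_le[of "- p"] by simp
        moreover have "cover_count D X (- p) = (\<Sum>x\<in>N. X x * of_bool (- p - x \<in> D))"
          using N' by (intro cover_count_of_bool finN) auto
        ultimately have "of_nat k = (\<Sum>x\<in>N. of_nat (X x) * indicator D (- p - x) :: ennreal)"
          by (auto simp: indicator_def of_bool_def intro!: sum.cong)
        then show False using p(1) \<open>p \<in> A\<close> by simp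
      qed
    qed
  qed
  also have "\<dots> = of_nat k * emeasure lborel A" using A by (simp add: nn_integral_cmult)
  finally show ?thesis .
qed

text \<open>The edges on either side of a line balance pointwise, hence so do the cells obtained by sweeping
  them along \<open>n\<close>; integrating against the reflected tile compares the areas of these cells.\<close>

lemma opposite_edge_length:
  assumes "d \<noteq> 0" "\<mu> > 0" and L: "along 1 D d = half_open_edge d 1 s" and R: "along (-1) D d = half_open_edge d \<mu> e"
  shows "\<mu> = 1"
proof -
  obtain n where dn: "cr d n = 1" using cr_nonzero_exists[OF assms(1)] .
  have eq: "cover_count (half_open_edge d 1 s) X p = cover_count (half_open_edge d \<mu> e) X p" for p
    using local_balance[OF assms(1), of 1 p] local_balance[OF assms(1), of "-1" p] L R by simp
  have "cover_count (parallelogram_cell d n 1 s) X p = cover_count (parallelogram_cell d n \<mu> e) X p" for p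
  proof -
    define N where "N = {x. X x > 0 \<and> p - x \<in> parallelogram_cell d n 1 s \<union> parallelogram_cell d n \<mu> e}"
    have N: "finite N" unfolding N_def by (intro finite_cover discrete bounded_Un[THEN iffD2] conjI bounded_cell dn)
    \<comment> \<open>One set of heights serves both cells, so that the two sums can be compared
      slice by slice.\<close>
    define Q where "Q = ((\<lambda>x. cr d (p - x - s)) ` N \<union> (\<lambda>x. cr d (p - x - e)) ` N) \<inter> {0..<1}"
    have Q: "finite Q" using N by (simp add: Q_def)
    have "cover_count (parallelogram_cell d n 1 s) X p = (\<Sum>r\<in>Q. cover_count (half_open_edge d 1 s) X (p - r *\<^sub>R n))"
      by (rule cover_count_cell[OF dn N _ Q]) (auto simp: N_def Q_def simp del: cr_simps)
    moreover have "cover_count (parallelogram_cell d n \<mu> e) X p = (\<Sum>r\<in>Q. cover_count (half_open_edge d \<mu> e) X (p - r *\<^sub>R n))"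
      by (rule cover_count_cell[OF dn N _ Q]) (auto simp: N_def Q_def simp del: cr_simps)
    ultimately show ?thesis by (simp add: eq)
  qed
  then have "of_nat k * emeasure lborel (parallelogram_cell d n 1 s) = of_nat k * emeasure lborel (parallelogram_cell d n \<mu> e)"
    by (simp only: cover_count_integral[OF bounded_cell[OF dn] cell_borel, symmetric])
  then have "emeasure lborel (parallelogram_cell d n 1 s) = emeasure lborel (parallelogram_cell d n \<mu> e)"
    using k_pos by (simp add: ennreal_mult_cancel_left)
  then show ?thesis using cell_emeasure[OF dn zero_less_one assms(2)] by blast
qed

end

section \<open>Centrally symmetric polygons\<close>

text \<open>A polygon centred at the origin. Indexing by all naturals with antiperiod
  \<open>m\<close> makes passing to the opposite vertex or side a shift by \<open>m\<close>; left
  turns over half a period express strict convexity with a single turn per \<open>2 * m\<close>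
  vertices.\<close>

locale gon =
  fixes m :: nat and v :: "nat \<Rightarrow> plane"
  assumes m2: "m \<ge> 2" and v_anti: "v (n + m) = - v n"
    and turn0: "0 < i \<Longrightarrow> i < m \<Longrightarrow> cr (v (Suc n) - v n) (v (Suc (n + i)) - v (n + i)) > 0"
begin

definition u :: "nat \<Rightarrow> plane" where "u n = v (Suc n) - v n"

definition body :: "plane set" where "body = convex hull (range v)"

lemma v_Suc: "v (Suc n) = v n + u n" by (simp add: u_def)

lemma turn: "0 < i \<Longrightarrow> i < m \<Longrightarrow> cr (u n) (u (n + i)) > 0"
  using turn0[of i n] by (simp add: u_def)

lemma u_anti: "u (n + m) = - u n"
  using v_anti[of n] v_anti[of "Suc n"] by (simp add: u_def)

lemma v_per: "v (n + 2 * m) = v n"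
  using v_anti[of "n + m"] v_anti[of n] by (simp add: mult_2 add.assoc)

lemma v_per_mult: "v (n + 2 * m * l) = v n"
proof (induction l)
  case (Suc l)
  have "n + 2 * m * Suc l = (n + 2 * m * l) + 2 * m" by simp
  then show ?case using Suc v_per by metis
qed simp

lemma v_mod: "v (n mod (2 * m)) = v n"
  using v_per_mult[of "n mod (2 * m)" "n div (2 * m)"] by (simp add: mult.commute)

lemma v_cong: "i mod (2 * m) = j mod (2 * m) \<Longrightarrow> v i = v j"
  by (metis v_mod)

lemma u_cong: "i mod (2 * m) = j mod (2 * m) \<Longrightarrow> u i = u j"
  unfolding u_def using v_cong[of i j] v_cong[of "Suc i" "Suc j"] by (metis mod_Suc_eq)

lemma index_shift: obtains s where "s < 2 * m" "(l + s) mod (2 * m) = i mod (2 * m)"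
proof -
  \<comment> \<open>The summand \<open>(2 * m - 1) * l\<close> represents \<open>- l\<close> modulo
    \<open>2 * m\<close>.\<close>
  define s where "s = (i + (2 * m - 1) * l) mod (2 * m)"
  have "(l + s) mod (2 * m) = (l + (i + (2 * m - 1) * l)) mod (2 * m)"
    unfolding s_def by (rule mod_add_right_eq)
  also have "l + (i + (2 * m - 1) * l) = i + 2 * m * l"
    using m2 by (cases m) (auto simp: algebra_simps)
  finally have "(l + s) mod (2 * m) = i mod (2 * m)" by simp
  moreover have "s < 2 * m" using m2 by (simp add: s_def)
  ultimately show thesis using that by blast
qed

lemma mod_Suc_cancel:
  assumes "Suc a mod (2 * m) = Suc b mod (2 * m)" shows "a mod (2 * m) = b mod (2 * m)"
proof -
  have *: "a mod (2 * m) = (Suc a mod (2 * m) + (2 * m - 1)) mod (2 * m)" for a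
  proof -
    have "(Suc a mod (2 * m) + (2 * m - 1)) mod (2 * m) = (Suc a + (2 * m - 1)) mod (2 * m)"
      by (rule mod_add_left_eq)
    also have "Suc a + (2 * m - 1) = a + 2 * m" using m2 by simp
    finally show ?thesis by simp
  qed
  show ?thesis using *[of a] *[of b] assms by simp
qed

lemma turn_neg: "0 < i \<Longrightarrow> i < m \<Longrightarrow> cr (u (n + i)) (u n) < 0"
  using turn[of i n] cr_swap[of "u n"] by simp

lemma u_nonzero: "u n \<noteq> 0"
  using turn[of 1 n] m2 by auto

definition ht :: "nat \<Rightarrow> nat \<Rightarrow> real" where "ht n i = cr (u n) (v (n + i) - v n)"

lemma ht_0: "ht n 0 = 0" and ht_1: "ht n 1 = 0" and ht_Suc: "ht n (Suc i) = ht n i + cr (u n) (u (n + i))"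
  by (simp_all add: ht_def v_Suc)

lemma ht_less: "1 \<le> i \<Longrightarrow> i < j \<Longrightarrow> j \<le> m \<Longrightarrow> ht n i < ht n j"
proof (induction j)
  case (Suc j)
  have "cr (u n) (u (n + j)) > 0" using Suc.prems by (intro turn) auto
  then show ?case using Suc by (cases "i = j") (auto simp: ht_Suc)
qed simp

lemma ht_opposite: "ht n (m + i) = ht n m - ht n i"
proof -
  have "v (n + (m + i)) = - v (n + i)" using v_anti[of "n + i"] by (simp add: add.commute add.left_commute)
  then show ?thesis by (simp add: ht_def v_anti)
qed

text \<open>Seen from side \<open>n\<close>, heights climb strictly up to index \<open>m\<close>;
  beyond it central symmetry turns the climb into a descent that stays positive.\<close>

lemma ht_pos: assumes "2 \<le> i" "i < 2 * m" shows "ht n i > 0"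
proof (cases "i \<le> m")
  case True
  then show ?thesis using ht_less[of 1 i n] assms by (simp add: ht_1[simplified])
next
  case False
  then obtain j where j: "i = m + j" "0 < j" "j < m" using assms
    by (metis add_less_cancel_left le_add_diff_inverse linear mult_2 zero_less_diff not_le)
  then have "ht n j < ht n m" using ht_less[of j m n] by auto
  then show ?thesis by (simp add: j ht_opposite)
qed

lemma ht_m_pos: "ht n m > 0" using ht_pos[of m n] m2 by simp

lemma ht_nonneg: "i < 2 * m \<Longrightarrow> ht n i \<ge> 0"
  using ht_pos[of i n] ht_0[of n] ht_1[of n] by (cases "i = 0"; cases "i = 1") auto

lemma vertex_side:
  obtains s where "s < 2 * m" "(l + s) mod (2 * m) = i mod (2 * m)" "cr (u l) (v i - v l) = ht l s"
proof -
  obtain s where s: "s < 2 * m" "(l + s) mod (2 * m) = i mod (2 * m)" by (rule index_shift)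
  then have "v i = v (l + s)" using v_cong by metis
  then show thesis using that s by (simp add: ht_def)
qed

lemma vertex_nonneg: "cr (u l) (v i - v l) \<ge> 0"
  using vertex_side ht_nonneg by metis

lemma range_v: "range v = v ` {..<2 * m}"
proof
  show "range v \<subseteq> v ` {..<2 * m}"
  proof
    fix x assume "x \<in> range v"
    then obtain i where "x = v i" by blast
    then have "x = v (i mod (2 * m))" "i mod (2 * m) < 2 * m" using v_mod m2 by auto
    then show "x \<in> v ` {..<2 * m}" by blast
  qed
qed blast

lemma finite_range_v: "finite (range v)"
  by (simp add: range_v)

lemma body_compact: "compact body" and body_convex: "convex body"
  using finite_range_v by (auto simp: body_def finite_imp_compact_convex_hull)

lemma v_in_body: "v i \<in> body"
  unfolding body_def by (simp add: hull_inc)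

text \<open>For the inclusion from right to left, a separating functional attains its least value on
  the vertices somewhere, and the half planes of the two sides meeting there already bound it from
  below at \<open>z\<close>, by \<open>cr_cone\<close>.\<close>

lemma body_halfplanes: "body = {z. \<forall>n. cr (u n) (z - v n) \<ge> 0}"
proof (intro equalityI subsetI CollectI allI)
  fix z n assume "z \<in> body"
  moreover have "body \<subseteq> {z. cr (u n) (z - v n) \<ge> 0}"
    unfolding body_def using vertex_nonneg by (intro hull_minimal convex_cr_halfplane) auto
  ultimately show "cr (u n) (z - v n) \<ge> 0" by blast
next
  fix z assume "z \<in> {z. \<forall>n. cr (u n) (z - v n) \<ge> 0}"
  then have z: "cr (u n) (z - v n) \<ge> 0" for n by blast
  show "z \<in> body"
  proof (rule ccontr)
    assume "z \<notin> body"
    then obtain a b where ab: "a \<bullet> z < b" "\<forall>x\<in>body. b < a \<bullet> x"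
      using separating_hyperplane_closed_point[OF body_convex compact_imp_closed[OF body_compact]] by blast
    obtain d where d: "\<And>z. a \<bullet> z = cr d z" using inner_eq_cr by metis
    obtain n where n: "\<And>i. cr d (v n) \<le> cr d (v i)"
      using min_on_finite_range[OF finite_range_v, of "cr d"] by blast
    \<comment> \<open>The predecessor of \<open>n\<close> modulo \<open>2 * m\<close>, as
      \<open>n\<close> itself may be 0.\<close>
    define n' where "n' = n + (2 * m - 1)"
    have n': "v (Suc n') = v n" using v_per[of n] m2 by (simp add: n'_def)
    have "cr d (z - v (Suc n')) \<ge> 0"
    proof (rule cr_cone[of "u n'" "u (Suc n')"])
      show "cr (u n') (u (Suc n')) > 0" using turn[of 1 n'] m2 by simp
      show "cr (u n') (z - v (Suc n')) \<ge> 0" using z[of n'] by (simp add: v_Suc)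
      show "cr (u (Suc n')) (z - v (Suc n')) \<ge> 0" by (rule z)
      show "cr d (u n') \<le> 0" using n[of n'] n' by (simp add: u_def)
      show "cr d (u (Suc n')) \<ge> 0" using n[of "Suc (Suc n')"] n' by (simp add: u_def)
    qed
    then have "cr d (v n) \<le> cr d z" using n' by simp
    moreover have "b < cr d (v n)" using ab(2) v_in_body d by metis
    ultimately show False using ab(1) d by simp
  qed
qed

lemma interior_body: "interior body = {z. \<forall>n. cr (u n) (z - v n) > 0}"
proof
  show "interior body \<subseteq> {z. \<forall>n. cr (u n) (z - v n) > 0}"
  proof (intro subsetI CollectI allI)
    fix z n assume "z \<in> interior body"
    from interior_cr_pos[OF this u_nonzero[of n], of 1 "v n"] show "cr (u n) (z - v n) > 0"
      using body_halfplanes by auto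
  qed
  have "{z. \<forall>n. cr (u n) (z - v n) > 0} = (\<Inter>n<2*m. {z. cr (u n) (z - v n) > 0})"
  proof (intro equalityI subsetI)
    fix z assume "z \<in> (\<Inter>n<2*m. {z. cr (u n) (z - v n) > 0})"
    then have "cr (u (n mod (2 * m))) (z - v (n mod (2 * m))) > 0" for n using m2 by simp
    moreover have "u (n mod (2 * m)) = u n" for n by (rule u_cong) simp
    ultimately show "z \<in> {z. \<forall>n. cr (u n) (z - v n) > 0}" by (simp add: v_mod)
  qed auto
  moreover have "open (\<Inter>n<2*m. {z. cr (u n) (z - v n) > 0})"
    by (intro open_INT ballI open_Collect_less continuous_cr continuous_on_const) auto
  ultimately show "{z. \<forall>n. cr (u n) (z - v n) > 0} \<subseteq> interior body"
    by (intro interior_maximal) (auto simp: body_halfplanes intro: less_imp_le simp del: cr_simps)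
qed

lemma zero_interior: "0 \<in> interior body"
proof -
  have "cr (u n) (0 - v n) > 0" for n
  proof -
    have "ht n m = cr (u n) (- v n) - cr (u n) (v n)" by (simp only: ht_def v_anti cr_simps(4))
    then show ?thesis using ht_m_pos[of n] by simp
  qed
  then show ?thesis unfolding interior_body by blast
qed

lemma inj_v: "inj_on v {..<2 * m}"
proof -
  have "v i \<noteq> v j" if "i < j" "j < 2 * m" for i j
  proof
    assume eq: "v i = v j"
    then have "ht i (j - i) = 0" using that by (simp add: ht_def)
    moreover have "j - i < 2 * m" using that by simp
    ultimately have "\<not> 2 \<le> j - i" using ht_pos[of "j - i" i] by linarith
    then have "j = Suc i" using that by linarith
    then show False using eq u_nonzero[of i] by (simp add: u_def)
  qed
  then show ?thesis unfolding inj_on_def by (metis lessThan_iff linorder_neqE_nat)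
qed

lemma v_eq_iff: "v i = v j \<longleftrightarrow> i mod (2 * m) = j mod (2 * m)"
proof
  assume "v i = v j"
  then have "v (i mod (2 * m)) = v (j mod (2 * m))" by (simp add: v_mod)
  then show "i mod (2 * m) = j mod (2 * m)" using inj_onD[OF inj_v] m2 by simp
qed (rule v_cong)

lemma convex_domain_body: "convex_domain body"
  using body_compact body_convex zero_interior by (auto simp: convex_domain_def)

lemma uminus_body: "z \<in> body \<Longrightarrow> - z \<in> body"
proof -
  assume z: "z \<in> body"
  have "cr (u n) (- z - v n) \<ge> 0" for n
  proof -
    have "cr (u (n + m)) (z - v (n + m)) \<ge> 0" using z body_halfplanes by blast
    then show ?thesis by (simp add: u_anti v_anti)
  qed
  then show ?thesis unfolding body_halfplanes by blast
qed

lemma centrally_symmetric_body: "centrally_symmetric body"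
  unfolding centrally_symmetric_def
proof (intro exI[of _ 0] equalityI subsetI)
  fix z assume "z \<in> body"
  then show "z \<in> (\<lambda>x. 2 *\<^sub>R 0 - x) ` body" using uminus_body by (intro image_eqI[of _ _ "- z"]) auto
qed (use uminus_body in auto)

section \<open>Sides and their position relative to a ray\<close>

definition side :: "nat \<Rightarrow> plane set" where "side j = {v j + t *\<^sub>R u j | t. 0 < t \<and> t < 1}"

lemma side_face:
  assumes "z \<in> body" "cr (u j) (z - v j) = 0"
  obtains t where "0 \<le> t" "t \<le> 1" "z = v j + t *\<^sub>R u j"
proof -
  obtain t where t: "z - v j = t *\<^sub>R u j" using cr_zero_imp_parallel[OF u_nonzero assms(2)] .
  then have z: "z = v j + t *\<^sub>R u j" by (simp add: algebra_simps)
  have "cr (u (Suc j)) (z - v (Suc j)) \<ge> 0" using assms(1) body_halfplanes by blast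
  then have "(t - 1) * cr (u (Suc j)) (u j) \<ge> 0" by (simp add: z v_Suc algebra_simps)
  moreover have "cr (u (Suc j)) (u j) < 0" using turn_neg[of 1 j] m2 by simp
  ultimately have "t \<le> 1" by (simp add: zero_le_mult_iff)
  define i where "i = j + (2 * m - 1)"
  have "Suc i = j + 2 * m" using m2 by (simp add: i_def)
  then have i: "v (Suc i) = v j" "u (Suc i) = u j" using v_cong[of "Suc i" j] u_cong[of "Suc i" j] by auto
  have "cr (u i) (z - v i) \<ge> 0" using assms(1) body_halfplanes by blast
  moreover have "z - v i = u i + t *\<^sub>R u (Suc i)" 
  proof -
    have "v j = v i + u i" using i(1) by (simp add: v_Suc)
    then show ?thesis by (simp add: z i(2))
  qed
  ultimately have "t * cr (u i) (u (Suc i)) \<ge> 0" by simp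
  moreover have "cr (u i) (u (Suc i)) > 0" using turn[of 1 i] m2 by simp
  ultimately have "t \<ge> 0" by (simp add: zero_le_mult_iff)
  then show thesis using that z \<open>t \<le> 1\<close> by blast
qed

lemma side_in_body: "0 \<le> t \<Longrightarrow> t \<le> 1 \<Longrightarrow> v j + t *\<^sub>R u j \<in> body"
  by (rule segment_small[OF body_convex v_in_body, of _ 1]) (use v_in_body[of "Suc j"] in \<open>auto simp: v_Suc\<close>)

lemma side_segment: "{z \<in> body. cr (u j) (z - v j) = 0} = closed_segment (v j) (v j + u j)"
proof -
  have "{z \<in> body. cr (u j) (z - v j) = 0} = {v j + t *\<^sub>R u j | t. 0 \<le> t \<and> t \<le> 1}"
  proof (intro equalityI subsetI)
    fix z assume "z \<in> {z \<in> body. cr (u j) (z - v j) = 0}"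
    then have "z \<in> body" "cr (u j) (z - v j) = 0" by blast+
    then obtain t where "0 \<le> t" "t \<le> 1" "z = v j + t *\<^sub>R u j" by (rule side_face)
    then show "z \<in> {v j + t *\<^sub>R u j | t. 0 \<le> t \<and> t \<le> 1}" by blast
  qed (auto intro: side_in_body)
  then show ?thesis using closed_segment_ray[of 1 "v j" "u j"] by simp
qed

lemma body_support: "z \<in> body \<Longrightarrow> cr (u j) (z - v j) \<ge> 0"
  using body_halfplanes by blast

lemma extreme_points_body: "{x. x extreme_point_of body} = range v"
proof
  show "{x. x extreme_point_of body} \<subseteq> range v"
    unfolding body_def by (auto dest: extreme_point_of_convex_hull)
  have "v n extreme_point_of body" for n
  proof (rule extreme_point_of_support_face)
    show "z \<in> body \<Longrightarrow> 1 * cr (u n) (z - v n) \<ge> 0" for z using body_support[of z n] by simp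
  qed (simp_all only: side_segment extreme_point_of_segment, simp)
  then show "range v \<subseteq> {x. x extreme_point_of body}" by blast
qed

lemma convex_ngon_body: "convex_ngon (2 * m) body"
  unfolding convex_ngon_def using convex_domain_body extreme_points_body inj_v
  by (auto simp: range_v card_image polytope_def body_def intro!: exI[of _ "v ` {..<2 * m}"])

lemma along_left: "along 1 body (u j) = insert (v j) (side j)"
proof -
  have "along 1 body (u j) = half_open_edge (u j) 1 (v j)"
  proof (rule along_face[OF body_convex u_nonzero zero_less_one])
    show "z \<in> body \<Longrightarrow> 1 * cr (u j) (z - v j) \<ge> 0" for z using body_support[of z j] by simp
    show "{z \<in> body. cr (u j) (z - v j) = 0} = closed_segment (v j) (v j + 1 *\<^sub>R u j)"
      using side_segment[of j] by simp
  qed (simp_all add: v_in_body)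
  also have "\<dots> = insert (v j) (side j)"
    by (auto simp: half_open_edge_def side_def intro: exI[of _ 0] less_imp_le)
  finally show ?thesis .
qed

text \<open>Side \<open>j + m\<close> runs against \<open>u j\<close>, so in direction
  \<open>u j\<close> it starts at its head \<open>v (Suc (j + m))\<close>. This is the endpoint that
  the half-open edge keeps, and the source of the shift by one in \<open>balance\<close>.\<close>

lemma along_right: "along (-1) body (u j) = insert (v (Suc (j + m))) (side (j + m))"
proof -
  have e: "v (Suc (j + m)) + 1 *\<^sub>R u j = v (j + m)" by (simp add: v_Suc u_anti)
  have "along (-1) body (u j) = half_open_edge (u j) 1 (v (Suc (j + m)))"
  proof (rule along_face[OF body_convex u_nonzero zero_less_one])
    show "z \<in> body \<Longrightarrow> - 1 * cr (u j) (z - v (j + m)) \<ge> 0" for z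
      using body_support[of z "j + m"] by (simp add: u_anti)
    have "{z \<in> body. cr (u j) (z - v (j + m)) = 0} = {z \<in> body. cr (u (j + m)) (z - v (j + m)) = 0}"
      by (auto simp: u_anti)
    also have "\<dots> = closed_segment (v (j + m)) (v (Suc (j + m)))" using side_segment[of "j + m"] by (simp add: v_Suc)
    finally show "{z \<in> body. cr (u j) (z - v (j + m)) = 0} = closed_segment (v (Suc (j + m))) (v (Suc (j + m)) + 1 *\<^sub>R u j)"
      unfolding e by (simp only: closed_segment_commute)
  qed (simp_all add: v_in_body)
  also have "\<dots> = insert (v (Suc (j + m))) (side (j + m))"
  proof (intro equalityI subsetI)
    fix z assume "z \<in> half_open_edge (u j) 1 (v (Suc (j + m)))"
    then obtain t where t: "0 \<le> t" "t < 1" "z = v (Suc (j + m)) + t *\<^sub>R u j" by (auto simp: half_open_edge_def)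
    then have "z = v (j + m) + (1 - t) *\<^sub>R u (j + m)" by (simp add: v_Suc u_anti algebra_simps)
    then show "z \<in> insert (v (Suc (j + m))) (side (j + m))"
      using t by (cases "t = 0") (auto simp: side_def intro!: exI[of _ "1 - t"])
  next
    fix z assume "z \<in> insert (v (Suc (j + m))) (side (j + m))"
    then have "\<exists>t. 0 < t \<and> t \<le> 1 \<and> z = v (j + m) + t *\<^sub>R u (j + m)"
      by (auto simp: side_def v_Suc intro: exI[of _ 1] less_imp_le)
    then obtain t where "0 < t" "t \<le> 1" "z = v (j + m) + t *\<^sub>R u (j + m)" by blast
    then show "z \<in> half_open_edge (u j) 1 (v (Suc (j + m)))"
      by (auto simp: half_open_edge_def v_Suc u_anti algebra_simps intro!: exI[of _ "1 - t"])
  qed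
  finally show ?thesis .
qed

lemma side_zero:
  assumes "z \<in> side i" "cr (u l) (z - v l) = 0"
  shows "l mod (2 * m) = i mod (2 * m)"
proof -
  obtain t where t: "0 < t" "t < 1" "z = v i + t *\<^sub>R u i" using assms(1) by (auto simp: side_def)
  have "z - v l = (1 - t) *\<^sub>R (v i - v l) + t *\<^sub>R (v (Suc i) - v l)"
    by (simp add: t v_Suc algebra_simps)
  then have "(1 - t) * cr (u l) (v i - v l) + t * cr (u l) (v (Suc i) - v l) = 0"
    using assms(2) by (simp only: cr_simps(2,8))
  moreover have "(1 - t) * cr (u l) (v i - v l) \<ge> 0" "t * cr (u l) (v (Suc i) - v l) \<ge> 0"
    using t vertex_nonneg by auto
  ultimately have "(1 - t) * cr (u l) (v i - v l) = 0" "t * cr (u l) (v (Suc i) - v l) = 0" by linarith+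
  then have z: "cr (u l) (v i - v l) = 0" "cr (u l) (v (Suc i) - v l) = 0" using t by (auto simp del: cr_simps)
  obtain s where s: "s < 2 * m" "(l + s) mod (2 * m) = i mod (2 * m)" "cr (u l) (v i - v l) = ht l s"
    by (rule vertex_side)
  have "s \<le> 1" using ht_pos[of s l] z s by fastforce
  moreover have "s \<noteq> 1"
  proof
    assume "s = 1"
    then have "v (Suc i) = v (l + 2)" using s(2) v_cong[of "Suc i" "l + 2"] by (metis add_2_eq_Suc' mod_Suc_eq Suc_eq_plus1)
    then have "ht l 2 = 0" using z by (simp add: ht_def)
    then show False using ht_pos[of 2 l] m2 by simp
  qed
  ultimately have "s = 0" by simp
  then show ?thesis using s(2) by simp
qed

lemma vertex_zero:
  assumes "cr (u l) (v i - v l) = 0"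
  shows "l mod (2 * m) = i mod (2 * m) \<or> Suc l mod (2 * m) = i mod (2 * m)"
proof -
  obtain s where s: "s < 2 * m" "(l + s) mod (2 * m) = i mod (2 * m)" "cr (u l) (v i - v l) = ht l s"
    by (rule vertex_side)
  have "s \<le> 1" using ht_pos[of s l] assms s by fastforce
  then show ?thesis using s(2) by (cases s) auto
qed

text \<open>Only the sides through \<open>z\<close> can stop the ray: the remaining inequalities are
  strict at \<open>z\<close> and survive a small step.\<close>

lemma inward_if:
  assumes "z \<in> body" "\<And>l. cr (u l) (z - v l) = 0 \<Longrightarrow> cr (u l) d > 0"
  shows "z \<in> inward body d"
proof -
  have "\<forall>\<^sub>F t in at_right 0. cr (u l) (z + t *\<^sub>R d - v l) > 0" for l
  proof (cases "cr (u l) (z - v l) = 0")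
    case True
    then have "cr (u l) d > 0" using assms(2) by blast
    then show ?thesis unfolding eventually_at_right[OF zero_less_one] using True
      by (auto intro!: exI[of _ 1])
  next
    case False
    moreover have "cr (u l) (z - v l) \<ge> 0" using assms(1) body_halfplanes by blast
    ultimately have "cr (u l) (z - v l) > 0" by linarith
    moreover have "open {y. cr (u l) (y - v l) > 0}"
      by (intro open_Collect_less continuous_cr continuous_on_const)
    ultimately show ?thesis using eventually_right_open[of "{y. cr (u l) (y - v l) > 0}" z d] by (simp del: cr_simps)
  qed
  then have "\<forall>\<^sub>F t in at_right 0. \<forall>l\<in>{..<2*m}. cr (u l) (z + t *\<^sub>R d - v l) > 0"
    by (intro eventually_ball_finite) auto
  then obtain t where t: "\<forall>l\<in>{..<2*m}. cr (u l) (z + t *\<^sub>R d - v l) > 0" "t > 0"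
    using eventually_right_pos by blast
  have "cr (u l) (z + t *\<^sub>R d - v l) > 0" for l
  proof -
    have "cr (u (l mod (2*m))) (z + t *\<^sub>R d - v (l mod (2*m))) > 0" using t(1) m2 by simp
    then show ?thesis using u_cong[of "l mod (2*m)" l] v_mod by simp
  qed
  then have "z + t *\<^sub>R d \<in> interior body" unfolding interior_body by blast
  then show ?thesis using assms(1) t(2) by (auto simp: inward_def)
qed

text \<open>The sides meeting at this vertex have directions \<open>- u (j + r - 1)\<close> and
  \<open>- u (j + r)\<close>, and both must come strictly after \<open>- u j\<close> in the turn.
  Hence the lower bound 2, against 1 for sides.\<close>

lemma vertex_inward:
  assumes "2 \<le> r" "r < m" shows "v (j + m + r) \<in> inward body (u j)"
proof (rule inward_if[OF v_in_body])
  fix l assume "cr (u l) (v (j + m + r) - v l) = 0"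
  then consider "l mod (2 * m) = (j + m + r) mod (2 * m)" | "Suc l mod (2 * m) = (j + m + r) mod (2 * m)"
    using vertex_zero by blast
  then show "cr (u l) (u j) > 0"
  proof cases
    case 1
    then have "u l = u (j + r + m)" using u_cong by (metis add.commute add.left_commute)
    then show ?thesis using turn_neg[of r j] assms by (simp add: u_anti)
  next
    case 2
    define r' where "r' = r - 1"
    have r: "j + m + r = Suc (j + r' + m)" using assms by (simp add: r'_def)
    have "l mod (2 * m) = (j + r' + m) mod (2 * m)" using 2 unfolding r by (rule mod_Suc_cancel)
    then have "u l = u (j + r' + m)" by (rule u_cong)
    moreover have "0 < r'" "r' < m" using assms by (simp_all add: r'_def)
    ultimately show ?thesis using turn_neg[of r' j] by (simp add: u_anti)
  qed
qed

lemma side_sub_body: "side j \<subseteq> body"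
  using side_in_body by (force simp: side_def)

lemma side_inward:
  assumes "1 \<le> r" "r < m" shows "side (j + m + r) \<subseteq> inward body (u j)"
proof
  fix z assume z: "z \<in> side (j + m + r)"
  show "z \<in> inward body (u j)"
  proof (rule inward_if)
    show "z \<in> body" using z side_sub_body by blast
    fix l assume "cr (u l) (z - v l) = 0"
    then have "l mod (2 * m) = (j + m + r) mod (2 * m)" using side_zero z by blast
    then have "u l = u (j + r + m)" using u_cong by (metis add.commute add.left_commute)
    then show "cr (u l) (u j) > 0" using turn_neg[of r j] assms by (simp add: u_anti)
  qed
qed

lemma side_not_interior: "side j \<inter> interior body = {}"
proof -
  have "cr (u j) (z - v j) = 0" if "z \<in> side j" for z using that by (auto simp: side_def)
  then show ?thesis unfolding interior_body by (metis (mono_tags, lifting) disjoint_iff less_irrefl mem_Collect_eq)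
qed

lemma vertex_not_interior: "v j \<notin> interior body"
  unfolding interior_body by (metis (mono_tags, lifting) cr_simps(10) diff_self less_irrefl mem_Collect_eq)

lemma vertex_not_side: "v i \<notin> side j"
proof
  assume "v i \<in> side j"
  have "i mod (2 * m) = j mod (2 * m)" using side_zero[OF \<open>v i \<in> side j\<close>, of i] by simp
  then have "v i = v j" by (rule v_cong)
  then show False using \<open>v i \<in> side j\<close> u_nonzero by (auto simp: side_def)
qed

lemma side_disjoint: "i mod (2 * m) \<noteq> j mod (2 * m) \<Longrightarrow> side i \<inter> side j = {}"
proof -
  have "cr (u j) (z - v j) = 0" if "z \<in> side j" for z using that by (auto simp: side_def)
  then show "i mod (2 * m) \<noteq> j mod (2 * m) \<Longrightarrow> side i \<inter> side j = {}"
    using side_zero by (metis disjoint_iff)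
qed

lemma vertex_shift_interior:
  assumes m4: "m \<ge> 4" and q: "q = v (j + 2) \<or> q = v (j + 3)"
  shows "q - u j \<in> interior body"
proof -
  have v2: "v (j + 2) = v j + u j + u (j + 1)" and v3: "v (j + 3) = v j + u j + u (j + 1) + u (j + 2)"
    by (simp_all add: numeral_2_eq_2 numeral_3_eq_3 v_Suc)
  have main: "cr (u (j + l)) (q - u j - v (j + l)) > 0" if "l < 2 * m" for l
  proof -
    have nn: "cr (u (j + l)) (w - v (j + l)) \<ge> 0" if "w = q \<or> w = v j" for w
      using that q vertex_nonneg by auto
    consider "l = 0" | "1 \<le> l" "l < m" | "l = m" | "l = m + 1" | r where "l = m + r" "2 \<le> r" "r < m"
      using \<open>l < 2 * m\<close> by (metis add.commute add_less_cancel_left le_add_diff_inverse less_one linorder_not_less mult_2 nat_less_le numeral_2_eq_2 Suc_leI One_nat_def add_0_right)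
    then show ?thesis
    proof cases
      case 1
      have "ht j 2 > 0" "ht j 3 > 0" using m4 by (auto intro: ht_pos)
      then show ?thesis using q 1 by (auto simp: ht_def)
    next
      case 2
      then show ?thesis using nn[of q] turn_neg[of l j] by simp
    next
      case 3
      have "j + m + (m + 2) = (j + 2) + 2 * m" "j + m + (m + 3) = (j + 3) + 2 * m" by simp_all
      then have "v (j + m + (m + 2)) = v (j + 2)" "v (j + m + (m + 3)) = v (j + 3)"
        using v_per by metis+
      moreover have "ht (j + m) (m + 2) > 0" "ht (j + m) (m + 3) > 0" using m4 by (auto intro!: ht_pos)
      ultimately show ?thesis using q 3 by (auto simp: ht_def u_anti)
    next
      \<comment> \<open>The decisive side: the height of \<open>v (j + 3) - u j\<close> over it is
        \<open>ht (j + 1) (m - 1) - ht (j + 1) 2\<close>, positive because \<open>m - 1 > 2\<close>.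
        For a hexagon it would vanish.\<close>
      case 4
      have ul: "u (j + l) = - u (j + 1)" "v (j + l) = - v (j + 1)"
        using u_anti[of "j + 1"] v_anti[of "j + 1"] 4 by (simp_all add: algebra_simps)
      have vm: "v (j + 1 + (m - 1)) = - v j" using v_anti[of j] m4 by simp
      have h: "ht (j + 1) (m - 1) = cr (u (j + 1)) (- v j - v (j + 1))" unfolding ht_def vm ..
      have 2: "ht (j + 1) 2 = cr (u (j + 1)) (u (j + 2))"
        by (simp add: ht_def numeral_2_eq_2 v_Suc)
      have "ht (j + 1) 2 < ht (j + 1) (m - 1)" by (rule ht_less) (use m4 in auto)
      moreover have "ht (j + 1) (m - 1) > 0" by (rule ht_pos) (use m4 in auto)
      ultimately show ?thesis using q unfolding ul 2 unfolding h v2 v3 by (auto simp: v_Suc)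
    next
      case (5 r)
      have ul: "u (j + l) = - u (j + r)" using u_anti[of "j + r"] 5 by (simp add: algebra_simps)
      have 1: "cr (u (j + l)) (u (j + 1)) > 0"
        using turn_neg[of "r - 1" "j + 1"] 5(2,3) by (simp add: ul)
      have 2: "cr (u (j + l)) (u (j + 2)) \<ge> 0"
      proof (cases "r = 2")
        case False
        have e: "j + 2 + (r - 2) = j + r" using 5(2) by simp
        have "cr (u (j + r)) (u (j + 2)) < 0"
          using turn_neg[of "r - 2" "j + 2", unfolded e] False 5(2,3) by simp
        then show ?thesis by (simp add: ul)
      qed (simp add: ul)
      show ?thesis using q nn[of "v j"] 1 2 unfolding v2 v3 by auto
    qed
  qed
  have "cr (u n) (q - u j - v n) > 0" for n
  proof -
    obtain l where l: "l < 2 * m" "(j + l) mod (2 * m) = n mod (2 * m)" by (rule index_shift)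
    then show ?thesis using main[OF l(1)] u_cong[OF l(2)] v_cong[OF l(2)] by simp
  qed
  then show ?thesis unfolding interior_body by blast
qed

lemma side_shift_interior:
  assumes m4: "m \<ge> 4" and r: "0 \<le> r" "r \<le> 1" and t: "0 < t" "t \<le> 1"
  shows "v (j + 2) + r *\<^sub>R u (j + 2) - t *\<^sub>R u j \<in> interior body"
proof -
  define y where "y = v (j + 2) + r *\<^sub>R u (j + 2)"
  have y: "y = (1 - r) *\<^sub>R v (j + 2) + r *\<^sub>R v (j + 3)"
    by (simp add: y_def numeral_3_eq_3 v_Suc algebra_simps)
  have "(1 - r) *\<^sub>R (v (j + 2) - u j) + r *\<^sub>R (v (j + 3) - u j) \<in> interior body"
    using r by (intro convexD convex_interior body_convex vertex_shift_interior m4) auto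
  moreover have "(1 - r) *\<^sub>R (v (j + 2) - u j) + r *\<^sub>R (v (j + 3) - u j) = y + 1 *\<^sub>R (- u j)"
    by (simp add: y algebra_simps)
  ultimately have "y + 1 *\<^sub>R (- u j) \<in> interior body" by simp
  moreover have "y \<in> body" unfolding y_def by (rule side_in_body) (use r in auto)
  ultimately show ?thesis using inward_small[OF body_convex, of y 1 "- u j" t] t by (simp add: y_def)
qed

end

section \<open>No tiling of multiplicity at most four\<close>

lemma cover_count_UN:
  assumes "finite I" "\<And>i. i \<in> I \<Longrightarrow> bounded (A i)" "discrete_mset X"
    "\<And>i j. i \<in> I \<Longrightarrow> j \<in> I \<Longrightarrow> i \<noteq> j \<Longrightarrow> A i \<inter> A j = {}"
  shows "cover_count (\<Union>i\<in>I. A i) X p = (\<Sum>i\<in>I. cover_count (A i) X p)"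
  using assms
proof (induction I rule: finite_induct)
  case (insert a I)
  have "A a \<inter> (\<Union>i\<in>I. A i) = {}" using insert.hyps insert.prems(3) by blast
  moreover have "bounded (\<Union>i\<in>I. A i)" using insert by (intro bounded_UN) auto
  ultimately have "cover_count (A a \<union> (\<Union>i\<in>I. A i)) X p = cover_count (A a) X p + cover_count (\<Union>i\<in>I. A i) X p"
    using insert.prems by (intro cover_count_Un) auto
  then show ?case using insert by simp
qed simp

lemma mod_eq_close:
  fixes c r r' M :: nat
  assumes "(c + r) mod M = (c + r') mod M" "r \<le> r'" "r' - r < M"
  shows "r = r'"
proof -
  have "M dvd (c + r') - (c + r)" using mod_eq_dvd_iff_nat[of "c + r" "c + r'" M] assms(1,2) by simp
  then have "M dvd r' - r" by simp
  then have "r' - r = 0" using assms(3) by (metis dvd_imp_le gr0I not_less)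
  then show ?thesis using assms(2) by simp
qed

section \<open>Counting the tiles around a node\<close>

locale gon_tiling = gon +
  fixes X :: "plane \<Rightarrow> nat" and k :: nat
  assumes disc: "discrete_mset X" and til: "kfold_tiling k body X" and kpos: "k > 0"
    and m4: "m \<ge> 4" and k4: "k \<le> 4"
begin

sublocale tiling body X k
  by unfold_locales (use convex_domain_body disc til kpos in auto)

text \<open>The tiles at a point \<open>p\<close>: \<open>a p i\<close> and \<open>b p i\<close> count those having \<open>p\<close> as \<open>i\<close>-th vertex or
  inside the \<open>i\<close>-th side. The angles of the tiles at \<open>p\<close> add up to
  \<open>((m - 1) * \<kappa> p + \<beta> p) / 2\<close> full turns.\<close>

definition a :: "plane \<Rightarrow> nat \<Rightarrow> nat" where "a p i = X (p - v i)"
definition b :: "plane \<Rightarrow> nat \<Rightarrow> nat" where "b p i = cover_count (side i) X p"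
definition \<phi> :: "plane \<Rightarrow> nat" where "\<phi> p = cover_count (interior body) X p"
definition \<kappa> :: "plane \<Rightarrow> nat" where "\<kappa> p = a p 0 + a p m"
definition node :: "plane \<Rightarrow> bool" where "node p \<longleftrightarrow> (\<exists>i. a p i > 0)"

lemma a_cong: "i mod (2 * m) = j mod (2 * m) \<Longrightarrow> a p i = a p j"
  unfolding a_def by (drule v_cong) simp

lemma side_cong: "i mod (2 * m) = j mod (2 * m) \<Longrightarrow> side i = side j"
proof -
  assume "i mod (2 * m) = j mod (2 * m)"
  then have "v i = v j" "u i = u j" by (rule v_cong, rule u_cong)
  then show "side i = side j" by (simp only: side_def)
qed

lemma b_cong: "i mod (2 * m) = j mod (2 * m) \<Longrightarrow> b p i = b p j"
  unfolding b_def by (drule side_cong) simp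

lemma a_add [simp]: "a p (i + 2 * m) = a p i" and b_add [simp]: "b p (i + 2 * m) = b p i"
  by (auto intro: a_cong b_cong)

lemma bounded_side: "bounded (side j)"
  using bounded_sub side_sub_body by blast

lemma cover_along_left: "cover_count (along 1 body (u j)) X p = a p j + b p j"
proof -
  have "insert (v j) (side j) = {v j} \<union> side j" by simp
  then show ?thesis unfolding along_left a_def b_def
    using cover_count_Un[of "{v j}" "side j" X p] vertex_not_side bounded_side disc by simp
qed

lemma cover_along_right: "cover_count (along (-1) body (u j)) X p = a p (j + m + 1) + b p (j + m)"
proof -
  have "insert (v (Suc (j + m))) (side (j + m)) = {v (Suc (j + m))} \<union> side (j + m)" by simp
  then show ?thesis unfolding along_right a_def b_def
    using cover_count_Un[of "{v (Suc (j + m))}" "side (j + m)" X p] vertex_not_side bounded_side disc by simp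
qed

text \<open>Tiles to the left of direction \<open>u j\<close> have \<open>p\<close> at vertex
  \<open>j\<close> or inside side \<open>j\<close>, those to the right inside side
  \<open>j + m\<close> or at its end \<open>j + m + 1\<close>. Both families complete the same
  tiles, entered by the ray, to \<open>k\<close>.\<close>

lemma balance: "a p j + b p j = a p (j + m + 1) + b p (j + m)"
  using local_balance[OF u_nonzero, of 1 j p] local_balance[OF u_nonzero, of "-1" j p]
  by (simp add: cover_along_left cover_along_right)

text \<open>Adding \<open>balance\<close> for the opposite directions \<open>u i\<close> and
  \<open>u (i + m)\<close> cancels the side counts, so the count of an opposite pair of vertices
  does not change from \<open>i\<close> to \<open>Suc i\<close>.\<close>

lemma a_pair: "a p i + a p (i + m) = \<kappa> p"
proof (induction i)
  case (Suc i)
  have "i + m + m + 1 = Suc i + 2 * m" "i + m + m = i + 2 * m" by simp_all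
  then have "a p (i + m) + b p (i + m) = a p (Suc i) + b p i"
    using balance[of p "i + m"] by (simp only: a_add b_add)
  then show ?case using Suc balance[of p i] by simp
qed (simp add: \<kappa>_def)

lemma node_iff: "node p \<longleftrightarrow> \<kappa> p > 0"
proof
  assume "node p"
  then obtain i where "a p i > 0" by (auto simp: node_def)
  then show "\<kappa> p > 0" using a_pair[of p i] by simp
qed (auto simp: node_def \<kappa>_def)

text \<open>If no tile has \<open>p\<close> at an end of its side \<open>j\<close>, then by
  \<open>a_pair\<close> some tile has it at the vertex opposite to \<open>Suc j\<close>, and
  \<open>balance\<close> demands a tile with \<open>p\<close> inside side \<open>j\<close>.\<close>

lemma node_meets_side:
  assumes "node p"
  obtains t where "0 \<le> t" "t \<le> 1" "X (p - (v j + t *\<^sub>R u j)) > 0"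
proof -
  consider "a p j > 0" | "a p (Suc j) > 0" | "a p j = 0" "a p (Suc j) = 0" by linarith
  then show thesis
  proof cases
    case 1
    then show ?thesis using that[of 0] by (simp add: a_def)
  next
    case 2
    then show ?thesis using that[of 1] by (simp add: a_def v_Suc)
  next
    case 3
    then have "a p (j + m + 1) > 0" using a_pair[of p "Suc j"] assms node_iff by simp
    then have "b p j > 0" using balance[of p j] 3 by linarith
    then obtain z where "z \<in> side j" "X (p - z) > 0" unfolding b_def by (rule cover_count_pos)
    moreover from this obtain t where "0 < t" "t < 1" "z = v j + t *\<^sub>R u j" by (auto simp: side_def)
    ultimately show ?thesis using that[of t] by simp
  qed
qed

text \<open>Some tile has the node \<open>p + u j\<close> on its side \<open>j + 2\<close>. Moving
  back by \<open>u j\<close> leads from that side into the interior, so the same tile has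
  \<open>p\<close> in its interior.\<close>

lemma node_neighbour:
  assumes "node (p + u j)"
  obtains y t where "y \<in> interior body" "X (p - y) > 0" "0 \<le> t" "t \<le> 1" "y + u j = v (j + 2) + t *\<^sub>R u (j + 2)"
proof -
  obtain t where t: "0 \<le> t" "t \<le> 1" "X (p + u j - (v (j + 2) + t *\<^sub>R u (j + 2))) > 0"
    using node_meets_side[OF assms] by blast
  define y where "y = v (j + 2) + t *\<^sub>R u (j + 2) - u j"
  have "y \<in> interior body" using side_shift_interior[OF m4 t(1,2), of 1 j] by (simp add: y_def)
  moreover have "p - y = p + u j - (v (j + 2) + t *\<^sub>R u (j + 2))" by (simp add: y_def)
  then have "X (p - y) > 0" using t(3) by metis
  moreover have "y + u j = v (j + 2) + t *\<^sub>R u (j + 2)" by (simp add: y_def)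
  ultimately show thesis using that t(1,2) by blast
qed

lemma a_shift: "a (p + u j) (Suc j) = a p j"
  by (simp add: a_def v_Suc algebra_simps)

lemma node_forward: "a p j > 0 \<Longrightarrow> node (p + u j)"
  unfolding node_def using a_shift by metis

lemma node_backward: "a p (Suc j) > 0 \<Longrightarrow> node (p + u (j + m))"
proof -
  have "p + u (j + m) - v j = p - v (Suc j)" by (simp add: v_Suc u_anti)
  then show "a p (Suc j) > 0 \<Longrightarrow> node (p + u (j + m))" unfolding node_def a_def by metis
qed

lemma interior_points_le:
  assumes "finite Y" "\<And>y. y \<in> Y \<Longrightarrow> y \<in> interior body \<and> X (p - y) > 0"
  shows "card Y \<le> \<phi> p"
  unfolding \<phi>_def using assms interior_subset
  by (intro cover_count_ge_card bounded_sub disc) auto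

text \<open>Otherwise a tile at index \<open>i\<close> leaves \<open>i + m - 1\<close> empty, so the
  opposite index, \<open>i - 1\<close>, is occupied; descending in this way reaches
  \<open>i + m - 1\<close> after all.\<close>

lemma wheel_pair:
  assumes "node p" obtains i where "a p i > 0" "a p (i + m - 1) > 0"
proof -
  obtain i where i: "a p i > 0" using assms by (auto simp: node_def)
  have "\<exists>i. a p i > 0 \<and> a p (i + m - 1) > 0"
  proof (rule ccontr)
    assume neg: "\<nexists>i. a p i > 0 \<and> a p (i + m - 1) > 0"
    have pos: "a p (i + s * (2 * m - 1)) > 0" for s
    proof (induction s)
      case (Suc s)
      define l where "l = i + s * (2 * m - 1)"
      have "a p (l + m - 1) = 0" using Suc neg unfolding l_def by (metis gr0I)
      then have "a p (l + m - 1 + m) > 0" using a_pair[of p "l + m - 1"] assms node_iff by simp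
      moreover have "l + m - 1 + m = i + Suc s * (2 * m - 1)" using m2 by (simp add: l_def)
      ultimately show ?case by simp
    qed (use i in simp)
    \<comment> \<open>Steps of \<open>2 * m - 1\<close> are steps of -1 modulo \<open>2 * m\<close>;
      after \<open>m + 1\<close> of them the index is \<open>i + m - 1\<close>.\<close>
    have "(m + 1) * (2 * m - 1) = 2 * m * m + (m - 1)" using m2 by (cases m) (auto simp: algebra_simps)
    then have "i + (m + 1) * (2 * m - 1) = (i + m - 1) + 2 * m * m" using m2 by simp
    then have "a p (i + (m + 1) * (2 * m - 1)) = a p (i + m - 1)" by (intro a_cong) simp
    then show False using pos[of "m + 1"] i neg by metis
  qed
  then show thesis using that by blast
qed

text \<open>Three neighbouring nodes each force a tile around \<open>p\<close>; if these were all the same tile,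
  three of its sides would have to contain points in impossible relative position.\<close>

lemma phi_ge_2:
  assumes "node p" shows "\<phi> p \<ge> 2"
proof -
  obtain i where i: "a p i > 0" "a p (i + m - 1) > 0" using wheel_pair[OF assms] .
  \<comment> \<open>This is \<open>i - 2\<close> modulo \<open>2 * m\<close>. Vertices
    \<open>j + 2\<close> and \<open>j + m + 1\<close> then occur at \<open>p\<close>, and the three
    neighbours lie in the directions \<open>u (j + 2)\<close>, \<open>- u (j + 1)\<close> and
    \<open>u j\<close>.\<close>
  define j where "j = i + 2 * m - 2"
  have ji: "j + 2 = i + 2 * m" "Suc (j + m) = (i + m - 1) + 2 * m" using m4 by (simp_all add: j_def)
  have j: "a p (j + 2) > 0" "a p (Suc (j + m)) > 0" unfolding ji using i by simp_all
  have n1: "node (p + u (j + 2))" using node_forward j(1) .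
  have n2: "node (p + u (j + 1 + m))" using node_backward[of p "j + 1"] j(1) by (simp add: numeral_2_eq_2)
  have "node (p + u (j + m + m))" using node_backward j(2) by blast
  moreover have e: "j + m + m = j + 2 * m" by simp
  have "u (j + m + m) = u j" unfolding e by (rule u_cong) simp
  ultimately have n3: "node (p + u j)" by metis
  obtain y1 t1 where y1: "y1 \<in> interior body" "X (p - y1) > 0" "0 \<le> t1" "t1 \<le> 1"
    "y1 + u (j + 2) = v (j + 2 + 2) + t1 *\<^sub>R u (j + 2 + 2)" using node_neighbour[OF n1] .
  obtain y2 t2 where y2: "y2 \<in> interior body" "X (p - y2) > 0" "0 \<le> t2" "t2 \<le> 1"
    "y2 + u (j + 1 + m) = v (j + 1 + m + 2) + t2 *\<^sub>R u (j + 1 + m + 2)" using node_neighbour[OF n2] .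
  obtain y3 t3 where y3: "y3 \<in> interior body" "X (p - y3) > 0" "0 \<le> t3" "t3 \<le> 1"
    "y3 + u j = v (j + 2) + t3 *\<^sub>R u (j + 2)" using node_neighbour[OF n3] .
  have "\<not> (y1 = y2 \<and> y2 = y3)"
  proof
    assume eq: "y1 = y2 \<and> y2 = y3"
    define y where "y = y3"
    have yy: "y1 = y" "y2 = y" using eq by (simp_all add: y_def)
    have i1: "j + 2 + 2 = j + 4" and i2: "j + 1 + m + 2 = j + 3 + m" by simp_all
    have e1: "y + u (j + 2) = v (j + 4) + t1 *\<^sub>R u (j + 4)" using y1(5) unfolding i1 yy .
    have e2: "y - u (j + 1) = - v (j + 3) - t2 *\<^sub>R u (j + 3)"
      using y2(5) unfolding i2 yy u_anti v_anti by simp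
    have e3: "y + u j = v (j + 2) + t3 *\<^sub>R u (j + 2)" using y3(5) unfolding y_def .
    have vs: "v (j + 1) = v j + u j" "v (j + 2) = v (j + 1) + u (j + 1)" "v (j + 3) = v (j + 2) + u (j + 2)"
      "v (j + 4) = v (j + 3) + u (j + 3)"
      by (simp_all add: numeral_2_eq_2 numeral_3_eq_3 numeral_eq_Suc v_Suc)
    \<comment> \<open>Eliminating \<open>y\<close> from \<open>e1\<close> and \<open>e2\<close>
      shows that, over side \<open>j + 3\<close>, the vertex \<open>m - 2\<close> steps on is at
      most as high as the one two steps on. As heights climb strictly, \<open>m = 4\<close>, and
      then \<open>t1 = 1\<close> and \<open>t2 = 0\<close>; finally \<open>e3\<close> makes two
      consecutive sides parallel.\<close>
    have "- v (j + 1) - v (j + 3) = u (j + 3) + t1 *\<^sub>R u (j + 4) + t2 *\<^sub>R u (j + 3)"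
    proof -
      have "u (j + 1) + u (j + 2) = (y + u (j + 2)) - (y - u (j + 1))" by simp
      also have "\<dots> = v (j + 4) + t1 *\<^sub>R u (j + 4) + v (j + 3) + t2 *\<^sub>R u (j + 3)" unfolding e1 e2 by simp
      finally have *: "u (j + 1) + u (j + 2) = v (j + 4) + t1 *\<^sub>R u (j + 4) + v (j + 3) + t2 *\<^sub>R u (j + 3)" .
      have "- v (j + 1) - v (j + 3) = (u (j + 1) + u (j + 2)) - v (j + 3) - v (j + 3)" unfolding vs by simp
      then show ?thesis unfolding * vs(4) by simp
    qed
    moreover have "v (j + 3 + (m - 2)) = - v (j + 1)" using v_anti[of "j + 1"] m4 by simp
    ultimately have E: "v (j + 3 + (m - 2)) - v (j + 3) = u (j + 3) + t1 *\<^sub>R u (j + 4) + t2 *\<^sub>R u (j + 3)" by simp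
    then have "ht (j + 3) (m - 2) = t1 * cr (u (j + 3)) (u (j + 4))" by (simp add: ht_def)
    moreover have h2: "ht (j + 3) 2 = cr (u (j + 3)) (u (j + 4))"
      using vs v_Suc[of "j + 4"] by (simp add: ht_def numeral_eq_Suc)
    ultimately have h: "ht (j + 3) (m - 2) = t1 * ht (j + 3) 2" by simp
    have pos: "ht (j + 3) 2 > 0" using ht_pos[of 2 "j + 3"] m4 by simp
    have le: "ht (j + 3) (m - 2) \<le> ht (j + 3) 2" unfolding h using y1(3,4) pos by (simp add: mult_left_le_one_le)
    have "m = 4"
    proof (rule ccontr)
      assume "m \<noteq> 4"
      then have "ht (j + 3) 2 < ht (j + 3) (m - 2)" using m4 by (intro ht_less) auto
      then show False using le by simp
    qed
    have "t1 = 1" using h pos \<open>m = 4\<close> by simp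
    have "v (j + 3 + (m - 2)) = v (j + 3) + u (j + 3) + u (j + 4)" using \<open>m = 4\<close> vs v_Suc[of "j + 4"]
      by (simp add: numeral_eq_Suc)
    then have "t2 *\<^sub>R u (j + 3) = 0" using E \<open>t1 = 1\<close> by simp
    then have "t2 = 0" using u_nonzero by simp
    have "u j + u (j + 1) = (y + u j) - (y - u (j + 1))" by simp
    also have "\<dots> = v (j + 2) + t3 *\<^sub>R u (j + 2) + v (j + 3)" unfolding e3 e2 \<open>t2 = 0\<close> by simp
    finally have *: "u j + u (j + 1) = v (j + 2) + t3 *\<^sub>R u (j + 2) + v (j + 3)" .
    have "- v j = (u j + u (j + 1)) - v (j + 2)" unfolding vs by simp
    then have "- v j = v (j + 3) + t3 *\<^sub>R u (j + 2)" unfolding * by simp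
    moreover have "- v j = v (j + 4)" using v_anti[of j] \<open>m = 4\<close> by simp
    ultimately have "u (j + 3) = t3 *\<^sub>R u (j + 2)" using vs by simp
    then have "cr (u (j + 2)) (u (j + 3)) = 0" by simp
    then show False using turn[of 1 "j + 2"] m4 by (simp add: numeral_eq_Suc)
  qed
  then have "2 \<le> card {y1, y2, y3}" by (auto simp: card_insert_if)
  also have "\<dots> \<le> \<phi> p" using y1 y2 y3 by (intro interior_points_le) auto
  finally show ?thesis .
qed

definition \<beta> :: "plane \<Rightarrow> nat" where "\<beta> p = (\<Sum>r=1..m. b p r + b p (m + r))"

text \<open>All these positions belong to tiles that the ray in direction \<open>u j\<close> enters
  or has along it on the left, and there are exactly \<open>k\<close> such tiles. The index
  \<open>r = m\<close> stands for vertex or side \<open>j\<close> itself. Vertex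
  \<open>j + m + 1\<close> ends the opposite side and belongs to the right, so vertices start at
  \<open>r = 2\<close>.\<close>

lemma half_count:
  "\<phi> p + (\<Sum>r=2..m. a p (j + m + r)) + (\<Sum>r=1..m. b p (j + m + r)) \<le> k"
proof -
  define V where "V = (\<Union>r\<in>{2..m}. {v (j + m + r)})"
  define S where "S = (\<Union>r\<in>{1..m}. side (j + m + r))"
  have idx: "r = r'" if "(j + m + r) mod (2 * m) = (j + m + r') mod (2 * m)" "1 \<le> r" "r \<le> m" "1 \<le> r'" "r' \<le> m" for r r'
  proof (cases "r \<le> r'")
    case True
    moreover have "r' - r < 2 * m" using that m4 by linarith
    ultimately show ?thesis using mod_eq_close[OF that(1)] by blast
  next
    case False
    then have "r' \<le> r" "r - r' < 2 * m" using that m4 by linarith+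
    then show ?thesis using mod_eq_close[OF that(1)[symmetric]] by blast
  qed
  have V: "cover_count V X p = (\<Sum>r=2..m. a p (j + m + r))"
  proof -
    have "cover_count V X p = (\<Sum>r=2..m. cover_count {v (j + m + r)} X p)"
      unfolding V_def
    proof (rule cover_count_UN)
      fix r r' assume r: "r \<in> {2..m}" "r' \<in> {2..m}" "r \<noteq> r'"
      then have "v (j + m + r) \<noteq> v (j + m + r')" using idx[of r r'] r unfolding v_eq_iff by (metis atLeastAtMost_iff order_trans one_le_numeral)
      then show "{v (j + m + r)} \<inter> {v (j + m + r')} = {}" by blast
    qed (use disc in auto)
    then show ?thesis by (simp add: a_def)
  qed
  have S: "cover_count S X p = (\<Sum>r=1..m. b p (j + m + r))"
    unfolding S_def b_def
  proof (rule cover_count_UN)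
    fix r r' assume r: "r \<in> {1..m}" "r' \<in> {1..m}" "r \<noteq> r'"
    then show "side (j + m + r) \<inter> side (j + m + r') = {}"
      using idx[of r r'] r by (intro side_disjoint notI) (metis atLeastAtMost_iff)
  qed (use disc bounded_side in auto)
  have jm: "j + m + m = j + 2 * m" by simp
  have up: "v (j + m + m) = v j" "side (j + m + m) = side j"
    unfolding jm by (rule v_cong, simp) (rule side_cong, simp)
  have Vsub: "V \<subseteq> inward body (u j) \<union> along 1 body (u j)"
  proof
    fix z assume "z \<in> V"
    then obtain r where r: "2 \<le> r" "r \<le> m" "z = v (j + m + r)" by (auto simp: V_def)
    then show "z \<in> inward body (u j) \<union> along 1 body (u j)"
      using vertex_inward[of r j] along_left[of j] up(1) by (cases "r = m") auto
  qed
  have Ssub: "S \<subseteq> inward body (u j) \<union> along 1 body (u j)"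
  proof
    fix z assume "z \<in> S"
    then obtain r where r: "1 \<le> r" "r \<le> m" "z \<in> side (j + m + r)" by (auto simp: S_def)
    then show "z \<in> inward body (u j) \<union> along 1 body (u j)"
      using side_inward[of r j] along_left[of j] up(2) by (cases "r = m") auto
  qed
  have Isub: "interior body \<subseteq> inward body (u j)"
  proof
    fix z assume z: "z \<in> interior body"
    then have "cr (u l) (z - v l) > 0" for l unfolding interior_body by blast
    then show "z \<in> inward body (u j)" using z interior_subset
      by (intro inward_if) (auto simp del: cr_simps, metis less_irrefl)
  qed
  have d1: "V \<inter> S = {}" using vertex_not_side by (auto simp: V_def S_def)
  have d2: "interior body \<inter> (V \<union> S) = {}"
    using vertex_not_interior side_not_interior by (fastforce simp: V_def S_def)
  have bd: "bounded V" "bounded S" "bounded (interior body)"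
    using Vsub Ssub along_sub[of 1 "u j"] inward_sub[of "u j"] interior_subset[of body] by (auto intro!: bounded_sub)
  have "\<phi> p + (\<Sum>r=2..m. a p (j + m + r)) + (\<Sum>r=1..m. b p (j + m + r)) = cover_count (interior body \<union> (V \<union> S)) X p"
    using cover_count_Un[OF d2 bd(3) _ disc] cover_count_Un[OF d1 bd(1,2) disc] bd by (simp add: V S \<phi>_def)
  also have "\<dots> \<le> cover_count (inward body (u j) \<union> along 1 body (u j)) X p"
    using Vsub Ssub Isub along_sub[of 1 "u j"] inward_sub[of "u j"]
    by (intro cover_count_mono bounded_sub disc) auto
  also have "\<dots> = cover_count (inward body (u j)) X p + cover_count (along 1 body (u j)) X p"
  proof (rule cover_count_Un)
    have "z \<notin> inward body (u j)" if "z \<in> along 1 body (u j)" for z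
    proof
      assume "z \<in> inward body (u j)"
      then obtain t where "z + t *\<^sub>R u j \<in> interior body" by (auto simp: inward_def)
      from interior_cr_pos[OF this u_nonzero[of j], of 1 z] show False using that by (auto simp: along_def)
    qed
    then show "inward body (u j) \<inter> along 1 body (u j) = {}" by blast
  qed (use bounded_sub along_sub inward_sub disc in auto)
  also have "\<dots> = k" using local_balance[OF u_nonzero, of 1 j p] by simp
  finally show ?thesis .
qed

text \<open>Counting in two opposite directions, each pair of opposite vertices is seen \<open>m - 1\<close> times.\<close>

lemma weight_bound: "(m - 1) * \<kappa> p + \<beta> p + 2 * \<phi> p \<le> 2 * k"
proof -
  have "(\<Sum>r=2..m. a p (0 + m + r)) + (\<Sum>r=2..m. a p (m + m + r)) = (\<Sum>r=2..m. \<kappa> p)"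
  proof (subst sum.distrib[symmetric], rule sum.cong)
    fix r
    have "m + m + r = r + 2 * m" by simp
    then have "a p (m + m + r) = a p r" by (simp only: a_add)
    then show "a p (0 + m + r) + a p (m + m + r) = \<kappa> p" using a_pair[of p r] by (simp add: add.commute)
  qed simp
  moreover have "(\<Sum>r=1..m. b p (0 + m + r)) + (\<Sum>r=1..m. b p (m + m + r)) = \<beta> p"
  proof -
    have "m + m + r = r + 2 * m" for r by simp
    then have "b p (m + m + r) = b p r" for r by (simp only: b_add)
    then show ?thesis by (simp add: \<beta>_def sum.distrib)
  qed
  ultimately show ?thesis using half_count[of p 0] half_count[of p m] by simp
qed

text \<open>The budget is \<open>2 * k \<le> 8\<close> and two interior tiles cost 4. Since
  \<open>m - 1 \<ge> 3\<close>, the remaining 4 allow only \<open>\<kappa> p = 1\<close>; conversely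
  a weight of at least 3 leaves room for at most two interior tiles. So \<open>\<beta> p\<close> is
  0 for \<open>m = 5\<close> and at most 1 for \<open>m = 4\<close>.\<close>

lemma node_weight:
  assumes "node p"
  shows "(m - 1) * \<kappa> p + \<beta> p \<le> 4" "\<kappa> p = 1" "m \<le> 5" "\<phi> p \<le> 2"
proof -
  have pos: "\<kappa> p > 0" using assms node_iff by simp
  show le: "(m - 1) * \<kappa> p + \<beta> p \<le> 4" using weight_bound[of p] phi_ge_2[OF assms] k4 by linarith
  show 1: "\<kappa> p = 1"
  proof (rule ccontr)
    assume "\<kappa> p \<noteq> 1"
    then have "(m - 1) * \<kappa> p \<ge> 3 * 2" using pos m4 by (intro mult_le_mono) auto
    then show False using le by simp
  qed
  show "m \<le> 5" using le 1 by simp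
  show "\<phi> p \<le> 2" using weight_bound[of p] 1 m4 k4 by simp
qed

section \<open>The surviving cases m = 5 and m = 4\<close>

lemma three_interior:
  assumes "node p" "\<And>y. y \<in> {y1, y2, y3} \<Longrightarrow> y \<in> interior body \<and> X (p - y) > 0"
  shows "y1 = y2 \<or> y1 = y3 \<or> y2 = y3"
proof (rule ccontr)
  assume "\<not> ?thesis"
  then have "card {y1, y2, y3} = 3" by auto
  moreover have "card {y1, y2, y3} \<le> \<phi> p" using assms by (intro interior_points_le) auto
  ultimately show False using node_weight(4)[OF assms(1)] by simp
qed

lemma b_two_le:
  assumes "i mod (2 * m) \<noteq> j mod (2 * m)" shows "b p i + b p j \<le> \<beta> p"
proof -
  define f where "f n = b p n" for n
  have l: "\<beta> p = sum f {1..2 * m}"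
  proof -
    have "sum f {1..2 * m} = sum f {1..m} + sum f {m + 1..m + m}"
      by (subst sum.ub_add_nat[symmetric]) (simp_all add: mult_2)
    also have "sum f {m + 1..m + m} = (\<Sum>r=1..m. f (m + r))"
      using sum.shift_bounds_cl_nat_ivl[of f 1 m m] by (simp add: add.commute)
    finally show ?thesis by (simp add: \<beta>_def f_def sum.distrib)
  qed
  have rep: "\<exists>n\<in>{1..2 * m}. n mod (2 * m) = i mod (2 * m)" for i
  proof (cases "i mod (2 * m) = 0")
    case True
    then show ?thesis using m4 by (intro bexI[of _ "2 * m"]) auto
  next
    case False
    have "i mod (2 * m) < 2 * m" using m4 by simp
    then show ?thesis using False by (intro bexI[of _ "i mod (2 * m)"]) auto
  qed
  obtain i' j' where ij: "i' \<in> {1..2 * m}" "i' mod (2 * m) = i mod (2 * m)" "j' \<in> {1..2 * m}" "j' mod (2 * m) = j mod (2 * m)"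
    using rep by metis
  have "i' \<noteq> j'" using assms ij by auto
  then have "f i' + f j' = sum f {i', j'}" by simp
  also have "\<dots> \<le> sum f {1..2 * m}" using ij by (intro sum_mono2) auto
  finally show ?thesis using b_cong[OF ij(2)] b_cong[OF ij(4)] by (simp add: l f_def)
qed

text \<open>All nodes carry regular wheels of five tiles. The interior tiles \<open>y j\<close> forced by the five
  neighbours of \<open>p\<close> differ cyclically, which two tiles do not allow on a cycle of odd length.\<close>

lemma no_decagon: "m \<noteq> 5"
proof
  assume m5: "m = 5"
  have step4: "a q (i + 4) = a q i" and step6: "a q (i + 6) = a q i" if q: "node q" for q i
  proof -
    have "\<beta> q = 0" using node_weight(1,2)[OF q] m5 by simp
    moreover have "b q i \<le> \<beta> q" for i
    proof -
      have "Suc i mod (2 * m) \<noteq> i mod (2 * m)"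
      proof
        assume "Suc i mod (2 * m) = i mod (2 * m)"
        then have "(i + 0) mod (2 * m) = (i + 1) mod (2 * m)" by simp
        from mod_eq_close[OF this] m5 show False by simp
      qed
      then show ?thesis using b_two_le[of "Suc i" i q] by simp
    qed
    ultimately have b0: "b q i = 0" for i by (metis le_zero_eq)
    have st: "a q (i + 6) = a q i" for i using balance[of q i] b0 m5 by (simp add: add.commute)
    then show "a q (i + 6) = a q i" .
    \<comment> \<open>Four shifts by 6 make 24, which is 4 modulo 10.\<close>
    have "a q (i + 24) = a q i" using st[of i] st[of "i + 6"] st[of "i + 12"] st[of "i + 18"]
      by (simp add: add.commute)
    moreover have "i + 24 = (i + 4) + 2 * m + 2 * m" using m5 by simp
    then have "a q (i + 24) = a q (i + 4)" by (simp only: a_add)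
    ultimately show "a q (i + 4) = a q i" by simp
  qed
  obtain x0 where "X x0 > 0" by (rule translate_exists)
  define p where "p = x0 + v 0"
  have p: "a p 0 > 0" using \<open>X x0 > 0\<close> by (simp add: p_def a_def)
  then have np: "node p" by (auto simp: node_def)
  \<comment> \<open>The node \<open>p + u j\<close> is vertex \<open>j + 1\<close> of some tile,
    hence also vertex \<open>j + 13\<close> of one, which is \<open>j + 3\<close> modulo 10; in the
    latter tile \<open>p\<close> sits at \<open>y j\<close>.\<close>
  define y where "y j = v (j + 3) - u j" for j
  have ypos: "y j \<in> interior body \<and> X (p - y j) > 0" if "a p j > 0" for j
  proof
    show "y j \<in> interior body" unfolding y_def using vertex_shift_interior[OF m4] by blast
    have n: "node (p + u j)" using node_forward that .
    have "a (p + u j) (j + 13) > 0"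
      using step6[OF n, of "j + 1"] step6[OF n, of "j + 7"] a_shift[of p j] that by (simp add: add.commute)
    moreover have "j + 13 = (j + 3) + 2 * m" using m5 by simp
    then have "a (p + u j) (j + 13) = a (p + u j) (j + 3)" by (simp only: a_add)
    ultimately have "X (p + u j - v (j + 3)) > 0" unfolding a_def by metis
    moreover have "p - y j = p + u j - v (j + 3)" by (simp add: y_def)
    ultimately show "X (p - y j) > 0" by metis
  qed
  have ne: "y j \<noteq> y (j + 4)" for j
  proof
    assume "y j = y (j + 4)"
    moreover have "v (j + 4 + 3) = - v (j + 2)" "v (j + 5) = - v j"
      using v_anti[of "j + 2"] v_anti[of j] m5 by (simp_all add: algebra_simps)
    moreover have "u (j + 4) = v (j + 5) - v (j + 4)" "u j = v (j + 1) - v j"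
      "u (j + 1) = v (j + 2) - v (j + 1)" "u (j + 3) = v (j + 4) - v (j + 3)"
      by (simp_all add: u_def numeral_eq_Suc)
    ultimately have "v (j + 1) + u (j + 1) = v (j + 1) + u (j + 3)" by (simp add: y_def algebra_simps)
    then have "u (j + 1) = u (j + 3)" by (rule add_left_imp_eq)
    then show False using turn[of 2 "j + 1"] m5 by (simp add: numeral_eq_Suc)
  qed
  \<comment> \<open>Modulo 10 the indices 0, 4, 8, 12, 16 form a cycle of length five under the
    shift by 4.\<close>
  have ap: "a p 4 > 0" "a p 8 > 0" "a p 12 > 0" "a p 16 > 0"
    using p step4[OF np, of 0] step4[OF np, of 4] step4[OF np, of 8] step4[OF np, of 12] by simp_all
  have y20: "y 20 = y 0"
    unfolding y_def using v_cong[of 23 3] u_cong[of 20 0] m5 by simp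
  have n: "y 0 \<noteq> y 4" "y 4 \<noteq> y 8" "y 8 \<noteq> y 12" "y 12 \<noteq> y 16" "y 16 \<noteq> y 0"
    using ne[of 0] ne[of 4] ne[of 8] ne[of 12] ne[of 16] y20 by simp_all
  have tri: "y i = y j \<or> y i = y l \<or> y j = y l" if "a p i > 0" "a p j > 0" "a p l > 0" for i j l
    by (rule three_interior[OF np]) (use ypos that in auto)
  have 1: "y 8 = y 0" using tri[OF p ap(1,2)] n by metis
  have 3: "y 16 = y 8" using tri[OF ap(2,3,4)] n by metis
  show False using 1 3 n by simp
qed

lemma side_b: "X (p - (v j + s *\<^sub>R u j)) > 0 \<Longrightarrow> 0 < s \<Longrightarrow> s < 1 \<Longrightarrow> b p j > 0"
proof -
  assume s: "X (p - (v j + s *\<^sub>R u j)) > 0" "0 < s" "s < 1"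
  have "v j + s *\<^sub>R u j \<in> side j" using s by (auto simp: side_def)
  then have "X (p - (v j + s *\<^sub>R u j)) \<le> b p j" unfolding b_def
    by (intro cover_count_ge bounded_side disc)
  then show "b p j > 0" using s(1) by simp
qed

text \<open>As \<open>\<beta> p \<le> 1\<close>, side \<open>j\<close> is the only side with
  \<open>p\<close> inside, and \<open>balance\<close> propagates this single defect around the
  indices. The four vertices found contain one of each opposite pair, so with
  \<open>\<kappa> p = 1\<close> the pattern at \<open>p\<close> is complete.\<close>

lemma octagon_type:
  assumes "m = 4" "node p" "b p j > 0"
  shows "a p (j + 2) > 0" "a p (j + 4) > 0" "a p (j + 5) > 0" "a p (j + 7) > 0"
proof -
  have l: "\<beta> p \<le> 1" using node_weight(1,2)[OF assms(2)] assms(1) by simp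
  have b0: "b p (j + i) = 0" if "0 < i" "i < 8" for i
  proof -
    have "j mod (2 * m) \<noteq> (j + i) mod (2 * m)" 
      using mod_eq_close[of j 0 "2 * m" i] that assms(1) by (metis add_0_right diff_zero less_irrefl mult_2 numeral_Bit0 zero_le)
    then have "b p j + b p (j + i) \<le> 1" using b_two_le l le_trans by blast
    then show ?thesis using assms(3) by linarith
  qed
  have bal: "a p (j + i) + b p (j + i) = a p (j + (i + 5)) + b p (j + (i + 4))" for i
    using balance[of p "j + i"] assms(1) by (simp add: ac_simps)
  have c: "a p (j + 9) = a p (j + 1)" "b p (j + 8) = b p j" "a p (j + 12) = a p (j + 4)" "b p (j + 11) = b p (j + 3)"
  proof -
    have "j + 9 = (j + 1) + 2 * m" "j + 8 = j + 2 * m" "j + 12 = (j + 4) + 2 * m" "j + 11 = (j + 3) + 2 * m"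
      using assms(1) by simp_all
    then show "a p (j + 9) = a p (j + 1)" "b p (j + 8) = b p j" "a p (j + 12) = a p (j + 4)" "b p (j + 11) = b p (j + 3)"
      by (simp_all only: a_add b_add)
  qed
  show 5: "a p (j + 5) > 0" using bal[of 0] b0[of 4] assms(3) by simp
  show 4: "a p (j + 4) > 0" using bal[of 4] b0[of 4] c assms(3) by simp
  show 7: "a p (j + 7) > 0" using bal[of 7] b0[of 7] b0[of 3] c 4 by simp
  show "a p (j + 2) > 0" using bal[of 2] b0[of 2] b0[of 6] 7 by simp
qed

text \<open>A tile with \<open>p\<close> inside its side \<open>j\<close> fixes the type of the nodes next to \<open>p\<close> on the line of
  that side; these force four interior points, and no coincidences reduce them to two.\<close>

lemma no_octagon: "m \<noteq> 4"
proof
  assume m: "m = 4"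
  obtain x0 where "X x0 > 0" by (rule translate_exists)
  define p where "p = x0 + v 0"
  have "a p 0 > 0" using \<open>X x0 > 0\<close> by (simp add: p_def a_def)
  then have np: "node p" by (auto simp: node_def)
  \<comment> \<open>Otherwise \<open>balance\<close> reads \<open>a p (i + 5) = a p i\<close>. Four
    steps lead from 0 to 20, which is 4 modulo 8, so \<open>\<kappa> p\<close> would be even instead
    of 1.\<close>
  have "\<exists>j. b p j > 0"
  proof (rule ccontr)
    assume "\<nexists>j. b p j > 0"
    then have "a p (i + 5) = a p i" for i using balance[of p i] m by (simp add: add.commute)
    from this[of 0] this[of 5] this[of 10] this[of 15] have "a p 20 = a p 0" by simp
    moreover have "20 = 4 + 2 * m + 2 * m" using m by simp
    then have "a p 20 = a p 4" by (simp only: a_add)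
    ultimately have "a p 0 + a p m = 2 * a p 0" using m by simp
    then have "\<kappa> p = 2 * a p 0" by (simp only: \<kappa>_def)
    then show False using node_weight(2)[OF np] by presburger
  qed
  then obtain j where j: "b p j > 0" by blast
  then obtain z where "z \<in> side j" "X (p - z) > 0" unfolding b_def by (rule cover_count_pos)
  then obtain s where s: "0 < s" "s < 1" "X (p - (v j + s *\<^sub>R u j)) > 0" by (auto simp: side_def)
  note tp = octagon_type[OF m np j]
  define U where "U = u j"
  have vs: "v (j + 1) = v j + U" "v (j + 3) = v (j + 2) + u (j + 2)"
    by (simp_all add: U_def numeral_2_eq_2 numeral_3_eq_3 v_Suc)
  have u4: "u (j + 4) = - U" "v (j + 4) = - v j" "v (j + 5) = - v j - U" "v (j + 6) = - v (j + 2)" "v (j + 7) = - v (j + 3)"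
    using u_anti[of j] v_anti[of j] v_anti[of "j + 1"] v_anti[of "j + 2"] v_anti[of "j + 3"] m vs
    by (simp_all add: U_def add.commute add.left_commute)
  have c8: "a q (j + 4 + 4) = a q j" "a q (j + 4 + 5) = a q (j + 1)" "a q (j + 4 + 7) = a q (j + 3)" for q
  proof -
    have "j + 4 + 4 = j + 2 * m" "j + 4 + 5 = (j + 1) + 2 * m" "j + 4 + 7 = (j + 3) + 2 * m"
      using m by simp_all
    then show "a q (j + 4 + 4) = a q j" "a q (j + 4 + 5) = a q (j + 1)" "a q (j + 4 + 7) = a q (j + 3)"
      by (simp_all only: a_add)
  qed
  have x4: "X (p - v (j + 4)) > 0" "X (p - v (j + 5)) > 0" using tp by (simp_all add: a_def)
  \<comment> \<open>The points \<open>q1\<close> and \<open>q2\<close> are the ends of the side that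
    has \<open>p\<close> inside; \<open>q3\<close> and \<open>q4\<close> are the other ends of side
    \<open>j + 4\<close> in tiles with \<open>p\<close> at its vertex \<open>j + 5\<close> and
    \<open>j + 4\<close>. Each of the four nodes again lies inside a side, at the same ratio
    \<open>s\<close>, which fixes its type.\<close>
  define q1 where "q1 = p - s *\<^sub>R U"
  have "q1 - v j = p - (v j + s *\<^sub>R u j)" by (simp add: q1_def U_def)
  then have n1: "node q1" using s(3) unfolding node_def a_def by metis
  have "q1 - (v (j + 4) + s *\<^sub>R u (j + 4)) = p - v (j + 4)" by (simp add: q1_def u4)
  then have "b q1 (j + 4) > 0" using side_b[of q1 "j + 4" s] s x4 by metis
  note t1 = octagon_type[OF m n1 this, unfolded c8]
  define q2 where "q2 = p + (1 - s) *\<^sub>R U"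
  have "q2 - v (j + 1) = p - (v j + s *\<^sub>R u j)" unfolding q2_def vs(1) U_def[symmetric] by (simp add: algebra_simps)
  then have n2: "node q2" using s(3) unfolding node_def a_def by metis
  have "q2 - (v (j + 4) + s *\<^sub>R u (j + 4)) = p - v (j + 5)" by (simp add: q2_def u4 algebra_simps)
  then have "b q2 (j + 4) > 0" using side_b[of q2 "j + 4" s] s x4 by metis
  note t2 = octagon_type[OF m n2 this, unfolded c8]
  define q3 where "q3 = p + U"
  have "q3 - v (j + 4) = p - v (j + 5)" by (simp add: q3_def u4 algebra_simps)
  then have n3: "node q3" using x4 unfolding node_def a_def by metis
  have "q3 - (v j + s *\<^sub>R u j) = q2 - v j" by (simp add: q3_def q2_def U_def algebra_simps)
  then have "X (q3 - (v j + s *\<^sub>R u j)) > 0" using t2(2) unfolding a_def by metis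
  from side_b[OF this s(1,2)] have "b q3 j > 0" .
  note t3 = octagon_type[OF m n3 this]
  define q4 where "q4 = p - U"
  have "q4 - v (j + 5) = p - v (j + 4)" by (simp add: q4_def u4 algebra_simps)
  then have n4: "node q4" using x4 unfolding node_def a_def by metis
  have "q4 - (v j + s *\<^sub>R u j) = q1 - v (j + 1)" unfolding q4_def q1_def vs(1) U_def[symmetric] by (simp add: algebra_simps)
  then have "X (q4 - (v j + s *\<^sub>R u j)) > 0" using t1(3) unfolding a_def by metis
  from side_b[OF this s(1,2)] have "b q4 j > 0" .
  note t4 = octagon_type[OF m n4 this]
  \<comment> \<open>The four positions of \<open>p\<close> are those in tiles that have
    \<open>q1\<close>, \<open>q2\<close>, \<open>q3\<close>, \<open>q4\<close> at vertex
    \<open>j + 6\<close>, \<open>j + 3\<close>, \<open>j + 2\<close>, \<open>j + 7\<close>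
    respectively.\<close>
  define ya where "ya = v (j + 6) + s *\<^sub>R U"
  define yb where "yb = v (j + 3) - (1 - s) *\<^sub>R U"
  define y0 where "y0 = v (j + 2) - U"
  define y4 where "y4 = v (j + 7) + U"
  have c6: "j + 4 + 2 = j + 6" "j + 4 + 3 = j + 7" by simp_all
  have ia: "ya \<in> interior body" using side_shift_interior[OF m4, of 0 s "j + 4", unfolded c6] s
    by (simp add: ya_def u4(1))
  have ib: "yb \<in> interior body" using side_shift_interior[OF m4, of 1 "1 - s" j] s
    by (simp add: yb_def vs U_def)
  have i0: "y0 \<in> interior body" using vertex_shift_interior[OF m4] by (simp add: y0_def U_def)
  have i4: "y4 \<in> interior body" using vertex_shift_interior[OF m4, of "v (j + 7)" "j + 4", unfolded c6]
    by (simp add: y4_def u4(1))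
  have "p - ya = q1 - v (j + 6)" "p - yb = q2 - v (j + 3)" "p - y0 = q3 - v (j + 2)" "p - y4 = q4 - v (j + 7)"
    by (simp_all add: ya_def yb_def y0_def y4_def q1_def q2_def q3_def q4_def)
  then have X: "X (p - ya) > 0" "X (p - yb) > 0" "X (p - y0) > 0" "X (p - y4) > 0"
    using t1(1)[unfolded c6] t2(4) t3(1) t4(4) unfolding a_def by metis+
  have c2: "cr U (u (j + 2)) > 0" using turn[of 2 j] m by (simp add: U_def)
  have n1: "ya \<noteq> y4"
  proof
    assume "ya = y4"
    then have "v (j + 3) - v (j + 2) = (1 - s) *\<^sub>R U" by (simp add: ya_def y4_def u4 algebra_simps)
    then have "u (j + 2) = (1 - s) *\<^sub>R U" using vs by simp
    then show False using c2 by simp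
  qed
  have n2: "yb \<noteq> y0"
  proof
    assume "yb = y0"
    then have "u (j + 2) + s *\<^sub>R U = 0" by (simp add: yb_def y0_def vs algebra_simps)
    then have "cr U (u (j + 2) + s *\<^sub>R U) = cr U 0" by (rule arg_cong)
    then show False using c2 by simp
  qed
  have tri: "z1 = z2 \<or> z1 = z3 \<or> z2 = z3" if "{z1, z2, z3} \<subseteq> {ya, yb, y0, y4}" for z1 z2 z3
    by (rule three_interior[OF np]) (use that ia ib i0 i4 X in auto)
  \<comment> \<open>At most two of the positions differ, so they pair off in one of two ways. The
    first would give \<open>U = U + U\<close>, the second would make side \<open>j + 2\<close>
    parallel to side \<open>j\<close>.\<close>
  have 3: "yb = ya \<or> yb = y4" "y0 = ya \<or> y0 = y4"
    using tri[of ya y4 yb] tri[of ya y4 y0] n1 by auto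
  show False
  proof (cases "yb = ya")
    case True
    then have "v (j + 2) + v (j + 3) = U" by (simp add: yb_def ya_def u4 algebra_simps)
    moreover have "y0 = y4" using 3 n2 True by metis
    then have "v (j + 2) + v (j + 3) = U + U" by (simp add: y0_def y4_def u4 algebra_simps)
    ultimately have "U = 0" by simp
    then show False using u_nonzero by (simp add: U_def)
  next
    case False
    then have "yb = y4" "y0 = ya" using 3 n2 by metis+
    then have "2 *\<^sub>R v (j + 3) = (2 - s) *\<^sub>R U" "2 *\<^sub>R v (j + 2) = (1 + s) *\<^sub>R U"
      by (simp_all add: yb_def ya_def y0_def y4_def u4 algebra_simps scaleR_2)
    then have "(1 + s) *\<^sub>R U + 2 *\<^sub>R u (j + 2) = (2 - s) *\<^sub>R U" using vs by (simp add: scaleR_add_right)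
    then have "cr U ((1 + s) *\<^sub>R U + 2 *\<^sub>R u (j + 2)) = cr U ((2 - s) *\<^sub>R U)" by (rule arg_cong)
    then show False using c2 by simp
  qed
qed

lemma small_multiplicity_impossible: False
proof -
  obtain x0 where "X x0 > 0" by (rule translate_exists)
  then have "a (x0 + v 0) 0 > 0" by (simp add: a_def)
  then have "node (x0 + v 0)" by (auto simp: node_def)
  then have "m \<le> 5" by (rule node_weight)
  then show False using m4 no_octagon no_decagon by linarith
qed

end

section \<open>Tiles are centrally symmetric polygons\<close>

context tiling
begin

text \<open>A tile running along the ray on its left must be balanced by one running along it on its
  right, so the face of \<open>D\<close> opposite to edge \<open>n\<close> is a proper segment. Its
  length is measured in units of \<open>u n\<close>, and \<open>opposite_edge_length\<close> makes
  it 1.\<close>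

lemma opposite_edge:
  assumes "polygon_chain D v N"
  shows "\<exists>s. polygon.edge D s (s - polygon_chain.u v n)"
proof -
  interpret c: polygon_chain D v N by fact
  let ?u = "c.u n"
  have u: "?u \<noteq> 0" by (rule c.u_nonzero)
  have "v n + 1 *\<^sub>R ?u = v (Suc n)" by (simp add: c.u_def)
  moreover have "{q \<in> D. cr ?u (q - v n) = 0} = closed_segment (v n) (v (Suc n))"
    using c.edge_face[OF c.chain[of n]] by (simp only: c.u_def)
  ultimately have L: "along 1 D ?u = half_open_edge ?u 1 (v n)"
    using c.u_support c.v_in by (intro along_face[OF D_facts(1) u]) (auto simp del: cr_simps)
  obtain x0 where x0: "X x0 > 0" by (rule translate_exists)
  have "v n \<in> along 1 D ?u" unfolding L by (auto simp: half_open_edge_def intro: exI[of _ 0])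
  then have "X (v n + x0 - v n) \<le> cover_count (along 1 D ?u) X (v n + x0)"
    by (intro cover_count_ge bounded_sub along_sub discrete)
  then have "cover_count (along (-1) D ?u) X (v n + x0) > 0"
    using x0 local_balance[OF u, of 1 "v n + x0"] local_balance[OF u, of "-1" "v n + x0"] by simp
  then obtain y where "y \<in> along (-1) D ?u" by (rule cover_count_pos)
  then obtain r where y: "y \<in> D" "r > 0" "y + r *\<^sub>R ?u \<in> D" "\<And>z. z \<in> D \<Longrightarrow> - 1 * cr ?u (z - y) \<ge> 0"
    by (auto simp: along_def simp del: cr_simps)
  obtain a b where ab: "{z \<in> D. cr ?u (z - y) = 0} = closed_segment a b"
    using face_segment[OF D_facts(1,2) u y(1)] .
  have "a \<in> {z \<in> D. cr ?u (z - y) = 0}" "b \<in> {z \<in> D. cr ?u (z - y) = 0}" unfolding ab by auto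
  then have "cr ?u (b - a) = 0" by simp
  then obtain l where l: "b - a = l *\<^sub>R ?u" using cr_zero_imp_parallel[OF u] by metis
  have "y \<in> closed_segment a b" "y + r *\<^sub>R ?u \<in> closed_segment a b" using y unfolding ab[symmetric] by auto
  then have "a \<noteq> b" using y(2) u by auto
  then have "l \<noteq> 0" using l by auto
  have "\<exists>e \<mu>. \<mu> > 0 \<and> {z \<in> D. cr ?u (z - y) = 0} = closed_segment e (e + \<mu> *\<^sub>R ?u)"
  proof (cases "l > 0")
    case True
    have "b = a + l *\<^sub>R ?u" using l by (simp add: algebra_simps)
    then show ?thesis using ab True by blast
  next
    case False
    have "a = b + (- l) *\<^sub>R ?u" using l by (simp add: algebra_simps)
    moreover have "- l > 0" using False \<open>l \<noteq> 0\<close> by simp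
    ultimately show ?thesis using ab closed_segment_commute by metis
  qed
  then obtain e \<mu> where e: "\<mu> > 0" "{z \<in> D. cr ?u (z - y) = 0} = closed_segment e (e + \<mu> *\<^sub>R ?u)" by blast
  have R: "along (-1) D ?u = half_open_edge ?u \<mu> e"
    by (rule along_face[OF D_facts(1) u e(1) y(4) _ y(1) e(2)]) auto
  have "\<mu> = 1" by (rule opposite_edge_length[OF u e(1) L R])
  define s where "s = e + ?u"
  have seg: "{z \<in> D. cr ?u (z - y) = 0} = closed_segment e s" using e(2) \<open>\<mu> = 1\<close> by (simp add: s_def)
  have ext: "e extreme_point_of D" "s extreme_point_of D"
    by (rule extreme_point_of_support_face[of D "-1" ?u y]; use y(4) seg in \<open>simp add: extreme_point_of_segment del: cr_simps\<close>)+
  have "s \<in> {z \<in> D. cr ?u (z - y) = 0}" unfolding seg by simp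
  then have "cr ?u s = cr ?u y" by simp
  then have "cr (e - s) (q - s) \<ge> 0" if "q \<in> D" for q using y(4)[OF that] by (simp add: s_def)
  moreover have "s \<noteq> e" using u by (simp add: s_def)
  ultimately have "c.edge s e" using ext by (simp add: c.edge_def del: cr_simps)
  moreover have "e = s - ?u" by (simp add: s_def)
  ultimately show ?thesis by blast
qed

text \<open>Since opposite edge vectors cancel, \<open>v n + v (n + m)\<close> does not depend on
  \<open>n\<close>. Half of it is the centre \<open>c\<close>, and moving the centre to the origin
  makes the vertices antiperiodic.\<close>

lemma tile_is_gon:
  obtains m v c where "gon m v" "D = (+) c ` gon.body v"
proof -
  interpret P: polygon D by unfold_locales (use D_facts finite_extreme_points in auto)
  have "{v. v extreme_point_of D} \<noteq> {}"
  proof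
    assume "{v. v extreme_point_of D} = {}"
    then have "D = {}" using P.D_hull by simp
    then show False using D_facts(5) by simp
  qed
  then obtain v0 where "v0 extreme_point_of D" by blast
  then obtain v N where v: "N > 0" "\<And>n. P.edge (v n) (v (Suc n))" "\<And>n. v (n + N) = v n"
    using P.chain_exists by metis
  interpret C: polygon_chain D v N by unfold_locales (use v in auto)
  have "\<exists>s. P.edge s (s - C.u n)" for n using opposite_edge C.polygon_chain_axioms .
  then obtain m where m: "m \<ge> 2" "\<And>n. C.u (n + m) = - C.u n"
    "\<And>n i. 0 < i \<Longrightarrow> i < m \<Longrightarrow> cr (C.u n) (C.u (n + i)) > 0"
    using C.opposite_shift by blast
  define c where "c = (1/2) *\<^sub>R (v 0 + v m)"
  have const: "v n + v (n + m) = v 0 + v m" for n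
  proof (induction n)
    case (Suc n)
    have "v (Suc n) = v n + C.u n" "v (Suc n + m) = v (n + m) + C.u (n + m)" by (simp_all add: C.u_def)
    then show ?case using Suc m(2)[of n] by simp
  qed simp
  define v' where "v' n = v n - c" for n
  have cc: "c + c = v 0 + v m" unfolding c_def by (simp flip: scaleR_left_distrib)
  have "v' (n + m) = - v' n" for n
  proof -
    have "v (n + m) = c + c - v n" using const[of n] cc by (simp add: algebra_simps)
    then show ?thesis by (simp add: v'_def)
  qed
  moreover have "v' (Suc n) - v' n = C.u n" for n by (simp add: v'_def C.u_def)
  ultimately have g: "gon m v'" by unfold_locales (use m in auto)
  interpret G: gon m v' by fact
  have "range v = {w. w extreme_point_of D}" using C.chain_covers C.v_extreme by blast
  then have "D = convex hull (range v)" using P.D_hull by simp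
  also have "range v = (+) c ` range v'" by (auto simp: v'_def image_image)
  also have "convex hull ((+) c ` range v') = (+) c ` G.body"
    unfolding G.body_def by (rule convex_hull_translation)
  finally show thesis using that g by blast
qed

end

section \<open>Invariance under translation\<close>

lemma interior_translate_cover:
  "cover_count (interior ((+) c ` K)) X p = cover_count (interior K) X (p - c)"
  unfolding interior_translation by (rule cover_count_translate)

lemma kfold_tiling_translate:
  assumes "kfold_tiling k ((+) c ` K) X" shows "kfold_tiling k K X"
proof -
  have "k \<le> cover_count K X p \<and> cover_count (interior K) X p \<le> k" for p
    using assms unfolding kfold_tiling_def interior_translate_cover cover_count_translate
    by (metis add_diff_cancel_right')
  then show ?thesis by (simp add: kfold_tiling_def)
qed

lemma convex_ngon_translate:
  assumes "convex_ngon n K" shows "convex_ngon n ((+) c ` K)"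
proof -
  have "polytope ((+) c ` K)" using assms polytope_translation_eq[of c K] by (simp add: convex_ngon_def)
  moreover have "{x. x extreme_point_of (+) c ` K} = (+) c ` {x. x extreme_point_of K}"
    by (rule extreme_points_of_translation)
  ultimately show ?thesis using assms
    unfolding convex_ngon_def convex_domain_def interior_translation
    by (simp add: card_image compact_translation convex_translation)
qed

lemma centrally_symmetric_translate:
  assumes "centrally_symmetric K" shows "centrally_symmetric ((+) c ` K)"
proof -
  obtain d where d: "(\<lambda>x. 2 *\<^sub>R d - x) ` K = K" using assms by (auto simp: centrally_symmetric_def)
  have "(\<lambda>x. 2 *\<^sub>R (c + d) - x) ` (+) c ` K = (+) c ` (\<lambda>x. 2 *\<^sub>R d - x) ` K"
    unfolding image_image by (rule image_cong) (simp_all add: scaleR_2)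
  then show ?thesis unfolding centrally_symmetric_def d by blast
qed

lemma (in gon) parallelogram_body:
  assumes "m = 2" shows "parallelogram ((+) c ` body)"
proof -
  have n: "\<not> collinear {0, u 0, u 1}"
  proof
    assume "collinear {0, u 0, u 1}"
    then have "u 0 = 0 \<or> u 1 = 0 \<or> (\<exists>c. u 1 = c *\<^sub>R u 0)" by (simp add: collinear_lemma)
    then have "cr (u 0) (u 1) = 0" by auto
    then show False using turn[of 1 0] assms by simp
  qed
  have vs: "v 2 = - v 0" "v 3 = - v 1" using v_anti[of 0] v_anti[of 1] assms by (simp_all add: numeral_3_eq_3 numeral_2_eq_2)
  have us: "u 0 = v 1 - v 0" "u 1 = v 2 - v 1" by (simp_all add: u_def numeral_2_eq_2)
  have "{..<2 * m} = {0, 1, 2, 3}" using assms by auto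
  then have "range v = {v 0, v 1, v 2, v 3}" by (simp add: range_v)
  then have "(+) c ` body = convex hull ((+) c ` {v 0, v 1, v 2, v 3})"
    unfolding body_def by (simp only: convex_hull_translation)
  also have "(+) c ` {v 0, v 1, v 2, v 3} = {c + v 0, c + v 0 + u 0, c + v 0 + u 0 + u 1, c + v 0 + u 1}"
  proof -
    have "c + v 0 + u 0 = c + v 1" "c + v 0 + u 0 + u 1 = c + v 2" "c + v 0 + u 1 = c + v 3"
      unfolding us vs by simp_all
    then show ?thesis by (simp only: image_insert image_empty)
  qed
  finally show ?thesis using n unfolding parallelogram_def by blast
qed

theorem tau_ge_5:
  assumes "convex_domain D" "\<not> parallelogram D" "\<not> (convex_ngon 6 D \<and> centrally_symmetric D)"
  shows "tau D \<ge> 5"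
  unfolding tau_def
proof (rule Inf_greatest)
  fix y assume "y \<in> {enat k | k. k > 0 \<and> (\<exists>X. discrete_mset X \<and> kfold_tiling k D X)}"
  then obtain k X where k: "y = enat k" "k > 0" "discrete_mset X" "kfold_tiling k D X" by blast
  have "5 \<le> k"
  proof (rule ccontr)
    assume "\<not> 5 \<le> k"
    interpret tiling D X k by unfold_locales (use assms k in auto)
    obtain m v c where g: "gon m v" and D: "D = (+) c ` gon.body v" by (rule tile_is_gon)
    interpret gon m v by fact
    consider "m = 2" | "m = 3" | "m \<ge> 4" using m2 by linarith
    then show False
    proof cases
      case 1
      then show False using parallelogram_body assms(2) D by simp
    next
      case 2
      have "convex_ngon 6 D" "centrally_symmetric D"
        using convex_ngon_translate[OF convex_ngon_body, of c]
          centrally_symmetric_translate[OF centrally_symmetric_body, of c] 2 unfolding D by simp_all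
      then show False using assms(3) by blast
    next
      case 3
      interpret gon_tiling m v X k
      proof
        show "kfold_tiling k body X" using k(4) unfolding D by (rule kfold_tiling_translate)
      qed (use k 3 \<open>\<not> 5 \<le> k\<close> in auto)
      show False by (rule small_multiplicity_impossible)
    qed
  qed
  then have "enat 5 \<le> y" using k(1) by simp
  then show "5 \<le> y" by (simp add: numeral_eq_enat)
qed

section \<open>Fivefold lattice tilings by an octagon and a decagon\<close>

definition pt :: "real \<Rightarrow> real \<Rightarrow> plane" where "pt a b = vector [a, b]"

lemma pt_simps [simp]: "pt a b $ 1 = a" "pt a b $ 2 = b" "- pt a b = pt (- a) (- b)"
  "pt a b - pt c d = pt (a - c) (b - d)" "cr (pt a b) (pt c d) = a * d - b * c" "pt a b = pt c d \<longleftrightarrow> a = c \<and> b = d"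
  by (auto simp: pt_def cr_def vec_eq_iff forall_2)

lemma pt_eta: "z = pt (z$1) (z$2)"
  by (simp add: vec_eq_iff forall_2)

section \<open>Counting translates over the integer lattice\<close>

definition lattice :: "plane \<Rightarrow> nat" where "lattice z = of_bool (z$1 \<in> \<int> \<and> z$2 \<in> \<int>)"

lemma lattice_support: "{x. lattice x > 0 \<and> P x} = (\<lambda>(j, i). pt (of_int i) (of_int j)) ` {(j, i). P (pt (of_int i) (of_int j))}"
proof (intro equalityI subsetI)
  fix x assume x: "x \<in> {x. lattice x > 0 \<and> P x}"
  then obtain i j where "x$1 = of_int i" "x$2 = of_int j" by (auto simp: lattice_def elim!: Ints_cases)
  then have "x = pt (of_int i) (of_int j)" using pt_eta[of x] by simp
  then show "x \<in> (\<lambda>(j, i). pt (of_int i) (of_int j)) ` {(j, i). P (pt (of_int i) (of_int j))}"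
    using x by (intro image_eqI[of _ _ "(j, i)"]) auto
qed (auto simp: lattice_def)

lemma discrete_lattice: "discrete_mset lattice"
  unfolding discrete_mset_def
proof (intro allI impI)
  fix B :: "plane set" assume "bounded B"
  then obtain R where R: "\<And>z. z \<in> B \<Longrightarrow> norm z \<le> R" using bounded_iff by blast
  have "{(j, i). pt (of_int i) (of_int j) \<in> B} \<subseteq> {-\<lceil>R\<rceil>..\<lceil>R\<rceil>} \<times> {-\<lceil>R\<rceil>..\<lceil>R\<rceil>}"
  proof
    fix z assume "z \<in> {(j, i). pt (of_int i) (of_int j) \<in> B}"
    then obtain j i where z: "z = (j, i)" "pt (of_int i) (of_int j) \<in> B" by blast
    then have n: "norm (pt (of_int i) (of_int j)) \<le> R" by (intro R)
    have "\<bar>of_int i\<bar> \<le> R" "\<bar>of_int j\<bar> \<le> R"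
      using component_le_norm_cart[of "pt (of_int i) (of_int j)" 1]
        component_le_norm_cart[of "pt (of_int i) (of_int j)" 2] n by auto
    then have "\<bar>i\<bar> \<le> \<lceil>R\<rceil>" "\<bar>j\<bar> \<le> \<lceil>R\<rceil>" by linarith+
    then show "z \<in> {-\<lceil>R\<rceil>..\<lceil>R\<rceil>} \<times> {-\<lceil>R\<rceil>..\<lceil>R\<rceil>}" by (auto simp: z(1))
  qed
  then have "finite {(j, i). pt (of_int i) (of_int j) \<in> B}" by (rule finite_subset) auto
  then have "finite {x. lattice x > 0 \<and> x \<in> B}" unfolding lattice_support by blast
  then show "finite {x \<in> B. lattice x > 0}" by (rule rev_finite_subset) auto
qed

lemma cover_count_lattice:
  "cover_count K lattice p = card {(j, i). pt (p$1 - of_int i) (p$2 - of_int j) \<in> K}"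
proof -
  have d: "p - pt (of_int i) (of_int j) = pt (p$1 - of_int i) (p$2 - of_int j)" for i j
    by (simp add: vec_eq_iff forall_2)
  have "cover_count K lattice p = (\<Sum>x\<in>{x. lattice x > 0 \<and> p - x \<in> K}. 1)"
    unfolding cover_count_eq by (rule sum.cong) (auto simp: lattice_def)
  also have "\<dots> = card {x. lattice x > 0 \<and> p - x \<in> K}" by simp
  also have "\<dots> = card {(j, i). p - pt (of_int i) (of_int j) \<in> K}"
    unfolding lattice_support by (rule card_image) (auto simp: inj_on_def)
  finally show ?thesis by (simp only: d)
qed

lemma finite_lattice_cover:
  fixes K :: "plane set" and p :: plane
  assumes "bounded K" shows "finite {(j, i). pt (p$1 - of_int i) (p$2 - of_int j) \<in> K}"
proof -
  have d: "p - pt (of_int i) (of_int j) = pt (p$1 - of_int i) (p$2 - of_int j)" for i j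
    by (simp add: vec_eq_iff forall_2)
  have "finite ((\<lambda>(j, i). pt (of_int i) (of_int j)) ` {(j, i). p - pt (of_int i) (of_int j) \<in> K})"
    using finite_cover[OF assms discrete_lattice, of p] unfolding lattice_support .
  then show ?thesis unfolding d by (rule finite_imageD) (auto simp: inj_on_def)
qed

text \<open>Lattice points are counted row by row; row \<open>j\<close> of the translates meets the horizontal
  line through \<open>p\<close> in intervals congruent to \<open>[l j, r j]\<close> modulo 1.\<close>

lemma lattice_count_ge:
  assumes "finite J" "bounded K"
    and "\<And>i j. j \<in> J \<Longrightarrow> l j \<le> p$1 - of_int i \<Longrightarrow> p$1 - of_int i \<le> r j \<Longrightarrow> pt (p$1 - of_int i) (p$2 - of_int j) \<in> K"
  shows "(\<Sum>j\<in>J. \<lfloor>p$1 - l j\<rfloor> - \<lceil>p$1 - r j\<rceil> + 1) \<le> int (cover_count K lattice p)"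
proof -
  let ?A = "Sigma J (\<lambda>j. {\<lceil>p$1 - r j\<rceil>..\<lfloor>p$1 - l j\<rfloor>})"
  have "(\<Sum>j\<in>J. \<lfloor>p$1 - l j\<rfloor> - \<lceil>p$1 - r j\<rceil> + 1) \<le> (\<Sum>j\<in>J. int (card {\<lceil>p$1 - r j\<rceil>..\<lfloor>p$1 - l j\<rfloor>}))"
    by (rule sum_mono) simp
  also have "\<dots> = int (card ?A)" using assms(1) by (simp add: card_SigmaI)
  also have "card ?A \<le> card {(j, i). pt (p$1 - of_int i) (p$2 - of_int j) \<in> K}"
  proof (rule card_mono[OF finite_lattice_cover[OF assms(2)]])
    show "?A \<subseteq> {(j, i). pt (p$1 - of_int i) (p$2 - of_int j) \<in> K}"
    proof clarify
      fix j i assume "j \<in> J" "i \<in> {\<lceil>p$1 - r j\<rceil>..\<lfloor>p$1 - l j\<rfloor>}"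
      moreover from this have "l j \<le> p$1 - of_int i" "p$1 - of_int i \<le> r j"
        by (auto simp: ceiling_le_iff le_floor_iff)
      ultimately show "pt (p$1 - of_int i) (p$2 - of_int j) \<in> K" by (intro assms(3))
    qed
  qed
  finally show ?thesis by (simp add: cover_count_lattice)
qed

text \<open>The integers strictly between \<open>p$1 - r j\<close> and \<open>p$1 - l j\<close> are
  counted. The assumption \<open>l j < r j\<close> keeps the formula from giving -1, as it would for
  a row degenerated to an integer.\<close>

lemma lattice_count_le:
  assumes "finite J" and lr: "\<And>j. j \<in> J \<Longrightarrow> l j < r j"
    and "\<And>i j. pt (p$1 - of_int i) (p$2 - of_int j) \<in> K \<Longrightarrow> j \<in> J \<and> l j < p$1 - of_int i \<and> p$1 - of_int i < r j"
  shows "int (cover_count K lattice p) \<le> (\<Sum>j\<in>J. \<lceil>p$1 - l j\<rceil> - \<lfloor>p$1 - r j\<rfloor> - 1)"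
proof -
  let ?A = "Sigma J (\<lambda>j. {\<lfloor>p$1 - r j\<rfloor> + 1..\<lceil>p$1 - l j\<rceil> - 1})"
  have "card {(j, i). pt (p$1 - of_int i) (p$2 - of_int j) \<in> K} \<le> card ?A"
  proof (rule card_mono)
    show "finite ?A" using assms(1) by simp
    show "{(j, i). pt (p$1 - of_int i) (p$2 - of_int j) \<in> K} \<subseteq> ?A"
    proof clarify
      fix j i assume "pt (p$1 - of_int i) (p$2 - of_int j) \<in> K"
      then have *: "j \<in> J" "l j < p$1 - of_int i" "p$1 - of_int i < r j" using assms(3) by blast+
      have "\<lfloor>p$1 - r j\<rfloor> < i" using * by (simp add: floor_less_iff)
      moreover have "i < \<lceil>p$1 - l j\<rceil>" using * by (simp add: less_ceiling_iff)
      ultimately show "j \<in> J \<and> i \<in> {\<lfloor>p$1 - r j\<rfloor> + 1..\<lceil>p$1 - l j\<rceil> - 1}" using * by simp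
    qed
  qed
  also have "int (card ?A) = (\<Sum>j\<in>J. int (card {\<lfloor>p$1 - r j\<rfloor> + 1..\<lceil>p$1 - l j\<rceil> - 1}))"
    using assms(1) by (simp add: card_SigmaI)
  also have "\<dots> = (\<Sum>j\<in>J. \<lceil>p$1 - l j\<rceil> - \<lfloor>p$1 - r j\<rfloor> - 1)"
  proof (rule sum.cong[OF refl])
    fix j assume "j \<in> J"
    then have "p$1 - r j < p$1 - l j" using lr by simp
    then have "\<lfloor>p$1 - r j\<rfloor> < \<lceil>p$1 - l j\<rceil>" by linarith
    then show "int (card {\<lfloor>p$1 - r j\<rfloor> + 1..\<lceil>p$1 - l j\<rceil> - 1}) = \<lceil>p$1 - l j\<rceil> - \<lfloor>p$1 - r j\<rfloor> - 1" by simp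
  qed
  finally show ?thesis by (simp add: cover_count_lattice)
qed

text \<open>The half planes of two opposite sides combine into a strip symmetric about the origin,
  so \<open>m\<close> absolute values replace \<open>2 * m\<close> inequalities.\<close>

lemma (in gon) body_iff: "z \<in> body \<longleftrightarrow> (\<forall>n<m. \<bar>cr (u n) z\<bar> \<le> - cr (u n) (v n))"
  and interior_iff: "z \<in> interior body \<longleftrightarrow> (\<forall>n<m. \<bar>cr (u n) z\<bar> < - cr (u n) (v n))"
proof -
  have red: "(\<forall>n. P (u n) (v n)) \<longleftrightarrow> (\<forall>n<m. P (u n) (v n) \<and> P (- u n) (- v n))" for P
  proof
    assume *: "\<forall>n. P (u n) (v n)"
    then have "P (u (n + m)) (v (n + m))" for n by blast
    then show "\<forall>n<m. P (u n) (v n) \<and> P (- u n) (- v n)" using * by (simp add: u_anti v_anti)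
  next
    assume *: "\<forall>n<m. P (u n) (v n) \<and> P (- u n) (- v n)"
    show "\<forall>n. P (u n) (v n)"
    proof
      fix n
      define k where "k = n mod (2 * m)"
      have k: "u k = u n" "v k = v n" by (rule u_cong v_cong; simp add: k_def)+
      have "k < 2 * m" using m2 by (simp add: k_def)
      then consider "k < m" | l where "k = l + m" "l < m"
        by (metis add.commute add_less_cancel_left le_add_diff_inverse mult_2 not_less)
      then have "P (u k) (v k)" using * by cases (auto simp: u_anti v_anti)
      then show "P (u n) (v n)" using k by simp
    qed
  qed
  show "z \<in> body \<longleftrightarrow> (\<forall>n<m. \<bar>cr (u n) z\<bar> \<le> - cr (u n) (v n))"
    unfolding body_halfplanes mem_Collect_eq
    by (subst red[of "\<lambda>u v. cr u (z - v) \<ge> 0"]) (auto simp: abs_le_iff)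
  show "z \<in> interior body \<longleftrightarrow> (\<forall>n<m. \<bar>cr (u n) z\<bar> < - cr (u n) (v n))"
    unfolding interior_body mem_Collect_eq
    by (subst red[of "\<lambda>u v. cr u (z - v) > 0"]) (auto simp: abs_less_iff)
qed

section \<open>Explicit gons given by half of their vertices\<close>

definition antiperiodic :: "nat \<Rightarrow> (nat \<Rightarrow> plane) \<Rightarrow> nat \<Rightarrow> plane" where
  "antiperiodic m w n = (if even (n div m) then w (n mod m) else - w (n mod m))"

lemma antiperiodic_add: "m > 0 \<Longrightarrow> antiperiodic m w (n + m) = - antiperiodic m w n"
  by (simp add: antiperiodic_def)

lemma gon_antiperiodic:
  fixes m w defines "v \<equiv> antiperiodic m w"
  assumes m: "m \<ge> 2" and turn: "\<And>n i. n < m \<Longrightarrow> 0 < i \<Longrightarrow> i < m \<Longrightarrow> cr (v (Suc n) - v n) (v (Suc (n + i)) - v (n + i)) > 0"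
  shows "gon m v"
proof
  show "2 \<le> m" by (rule m)
  have anti: "v (n + m) = - v n" for n using m by (simp add: v_def antiperiodic_add)
  then show "v (n + m) = - v n" for n .
  have "0 < i \<Longrightarrow> i < m \<Longrightarrow> cr (v (Suc n) - v n) (v (Suc (n + i)) - v (n + i)) > 0" for n i
  proof (induction n rule: less_induct)
    case (less n)
    show ?case
    proof (cases "n < m")
      case False
      then obtain l where l: "n = l + m" by (metis add.commute le_add_diff_inverse not_less)
      have "v n = - v l" "v (Suc n) = - v (Suc l)" "v (n + i) = - v (l + i)" "v (Suc (n + i)) = - v (Suc (l + i))"
        using anti[of l] anti[of "Suc l"] anti[of "l + i"] anti[of "Suc (l + i)"] by (simp_all add: l ac_simps)
      moreover have "cr (v (Suc l) - v l) (v (Suc (l + i)) - v (l + i)) > 0" using less m l by simp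
      moreover have "cr (- a - - b) (- c - - d) = cr (a - b) (c - d)" for a b c d :: plane by simp
      ultimately show ?thesis by simp
    qed (use turn less.prems in blast)
  qed
  then show "0 < i \<Longrightarrow> i < m \<Longrightarrow> cr (v (Suc n) - v n) (v (Suc (n + i)) - v (n + i)) > 0" for i n .
qed

text \<open>Floor and ceiling will come from different rows: the right end of one row is paired with
  a left end congruent to it modulo 1. The regrouped terms then count integers in intervals of
  integral length \<open>k\<close>, at least \<open>k\<close> in a closed one and at most
  \<open>k\<close> in an open one.\<close>

lemma closed_gap: "\<lfloor>t\<rfloor> - \<lceil>t - of_int k\<rceil> + 1 \<ge> k" and open_gap: "\<lceil>t\<rceil> - \<lfloor>t - of_int k\<rfloor> - 1 \<le> k"
  for t :: real
proof -
  have "\<lceil>t\<rceil> \<le> \<lfloor>t\<rfloor> + 1" by linarith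
  then show "\<lfloor>t\<rfloor> - \<lceil>t - of_int k\<rceil> + 1 \<ge> k" "\<lceil>t\<rceil> - \<lfloor>t - of_int k\<rfloor> - 1 \<le> k"
    by (simp_all only: ceiling_diff_of_int floor_diff_of_int)
qed

text \<open>The midpoints of the sides of the decagon are half lattice points, so lattice vectors carry each
  side to the opposite one; for the octagon this holds except for the sides parallel to \<open>(1, 0)\<close>,
  which are lattice vectors themselves.\<close>

definition decagon_v :: "nat \<Rightarrow> plane" where
  "decagon_v = antiperiodic 5 (\<lambda>n. [pt (7/5) (-1/5), pt (8/5) (1/5), pt (7/5) (4/5), pt (3/5) (6/5), pt (-3/5) (4/5)] ! n)"

lemma closed_gap_0: "\<lfloor>t\<rfloor> - \<lceil>t\<rceil> + 1 \<ge> 0" and open_gap_0: "\<lceil>t\<rceil> - \<lfloor>t\<rfloor> - 1 \<le> 0"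
  for t :: real
  using closed_gap[of 0 t] open_gap[of t 0] by simp_all

lemma decagon_v_values: "decagon_v 0 = pt (7/5) (-1/5)" "decagon_v (Suc 0) = pt (8/5) (1/5)" "decagon_v 2 = pt (7/5) (4/5)"
    "decagon_v (Suc (Suc 0)) = pt (7/5) (4/5)"
    "decagon_v 3 = pt (3/5) (6/5)" "decagon_v 4 = pt (-3/5) (4/5)" "decagon_v 5 = pt (-7/5) (1/5)"
  by (simp_all add: decagon_v_def antiperiodic_def)

interpretation decagon: gon 5 decagon_v
proof -
  have "0 < cr (decagon_v (Suc n) - decagon_v n) (decagon_v (Suc (n + i)) - decagon_v (n + i))" if "n < 5" "0 < i" "i < 5" for n i
  proof -
    have "n \<in> {0, 1, 2, 3, 4}" "i \<in> {1, 2, 3, 4}" using that by auto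
    then show ?thesis by (elim insertE emptyE) (simp_all add: decagon_v_def antiperiodic_def)
  qed
  then show "gon 5 decagon_v" unfolding decagon_v_def by (intro gon_antiperiodic) auto
qed

definition octagon_v :: "nat \<Rightarrow> plane" where
  "octagon_v = antiperiodic 4 (\<lambda>n. [pt (-13/10) (-2), pt (-3/10) (-2), pt (3/10) (-1), pt (7/10) 0] ! n)"

lemma octagon_v_values: "octagon_v 0 = pt (-13/10) (-2)" "octagon_v (Suc 0) = pt (-3/10) (-2)" "octagon_v 2 = pt (3/10) (-1)"
    "octagon_v (Suc (Suc 0)) = pt (3/10) (-1)"
    "octagon_v 3 = pt (7/10) 0" "octagon_v 4 = pt (13/10) 2"
  by (simp_all add: octagon_v_def antiperiodic_def)

interpretation octagon: gon 4 octagon_v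
proof -
  have "0 < cr (octagon_v (Suc n) - octagon_v n) (octagon_v (Suc (n + i)) - octagon_v (n + i))" if "n < 4" "0 < i" "i < 4" for n i
  proof -
    have "n \<in> {0, 1, 2, 3}" "i \<in> {1, 2, 3}" using that by auto
    then show ?thesis by (elim insertE emptyE) (simp_all add: octagon_v_def antiperiodic_def)
  qed
  then show "gon 4 octagon_v" unfolding octagon_v_def by (intro gon_antiperiodic) auto
qed

lemma all_less_5: "(\<forall>n<5. P n) \<longleftrightarrow> P (0::nat) \<and> P 1 \<and> P 2 \<and> P 3 \<and> P 4"
  and all_less_4: "(\<forall>n<4. P n) \<longleftrightarrow> P (0::nat) \<and> P 1 \<and> P 2 \<and> P 3"
  by (auto simp: numeral_eq_Suc less_Suc_eq)

lemma decagon_forms: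
  "cr (decagon.u 0) (pt x y) = (y - 2 * x) / 5" "cr (decagon.u 1) (pt x y) = (y + 3 * x) / (- 5)"
  "cr (decagon.u 2) (pt x y) = (2 * y + x) / (- 5/2)" "cr (decagon.u 3) (pt x y) = (3 * y - x) / (- 5/2)"
  "cr (decagon.u 4) (pt x y) = (4 * y - 3 * x) / (- 5)"
  "cr (decagon.u 0) (decagon_v 0) = -3/5" "cr (decagon.u 1) (decagon_v 1) = -1" "cr (decagon.u 2) (decagon_v 2) = -6/5"
  "cr (decagon.u 3) (decagon_v 3) = -6/5" "cr (decagon.u 4) (decagon_v 4) = -1"
  by (simp_all add: decagon.u_def decagon_v_values field_simps)

lemma octagon_forms:
  "cr (octagon.u 0) (pt x y) = y" "cr (octagon.u 1) (pt x y) = (6 * y - 10 * x) / 10"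
  "cr (octagon.u 2) (pt x y) = (4 * y - 10 * x) / 10" "cr (octagon.u 3) (pt x y) = (3 * y - 10 * x) / 5"
  "cr (octagon.u 0) (octagon_v 0) = -2" "cr (octagon.u 1) (octagon_v 1) = -9/10" "cr (octagon.u 2) (octagon_v 2) = -7/10" "cr (octagon.u 3) (octagon_v 3) = -7/5"
  by (simp_all add: octagon.u_def octagon_v_values field_simps)

lemma decagon_body: "pt x y \<in> decagon.body \<longleftrightarrow> \<bar>y - 2 * x\<bar> \<le> 3 \<and> \<bar>y + 3 * x\<bar> \<le> 5 \<and> \<bar>2 * y + x\<bar> \<le> 3 \<and> \<bar>3 * y - x\<bar> \<le> 3 \<and> \<bar>4 * y - 3 * x\<bar> \<le> 5"
  and decagon_interior: "pt x y \<in> interior decagon.body \<longleftrightarrow> \<bar>y - 2 * x\<bar> < 3 \<and> \<bar>y + 3 * x\<bar> < 5 \<and> \<bar>2 * y + x\<bar> < 3 \<and> \<bar>3 * y - x\<bar> < 3 \<and> \<bar>4 * y - 3 * x\<bar> < 5"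
  unfolding decagon.body_iff decagon.interior_iff all_less_5 decagon_forms abs_divide by simp_all

lemma octagon_body: "pt x y \<in> octagon.body \<longleftrightarrow> \<bar>y\<bar> \<le> 2 \<and> \<bar>6 * y - 10 * x\<bar> \<le> 9 \<and> \<bar>4 * y - 10 * x\<bar> \<le> 7 \<and> \<bar>3 * y - 10 * x\<bar> \<le> 7"
  and octagon_interior: "pt x y \<in> interior octagon.body \<longleftrightarrow> \<bar>y\<bar> < 2 \<and> \<bar>6 * y - 10 * x\<bar> < 9 \<and> \<bar>4 * y - 10 * x\<bar> < 7 \<and> \<bar>3 * y - 10 * x\<bar> < 7"
  unfolding octagon.body_iff octagon.interior_iff all_less_4 octagon_forms abs_divide by simp_all

section \<open>The two fivefold tilings\<close>

lemma decagon_tiling: "kfold_tiling 5 decagon.body lattice"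
  unfolding kfold_tiling_def
proof (intro conjI allI)
  fix p :: plane
  \<comment> \<open>The vertex heights 1/5, 4/5, 6/5 and their negatives are -1/5 or 1/5 modulo 1.
    Cutting the range of \<open>s\<close> at these values keeps every row between the same two sides
    on each piece.\<close>
  define n where "n = \<lceil>p$2 - 4/5\<rceil>"
  define s where "s = p$2 - of_int n"
  have s: "-1/5 < s" "s \<le> 4/5" by (auto simp: s_def n_def) linarith+
  have y: "p$2 - of_int j = s + of_int (n - j)" for j by (simp add: s_def)
  have bd: "bounded decagon.body" using decagon.body_compact compact_imp_bounded by blast
  define J where "J = (if s < 1/5 then {n - 1, n, n + 1} else {n, n + 1})"
  define l where "l j = (if s < 1/5 then (if j = n - 1 then 3 * s else if j = n then -3/2 + s/2 else -1 - 2 * s)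
     else (if j = n then -5/3 + 4 * s / 3 else -4/3 - s/3))" for j
  define r where "r j = (if s < 1/5 then (if j = n - 1 then 1 - 2 * s else if j = n then 3/2 + s/2 else 3 * s)
     else (if j = n then 5/3 - s/3 else 4 * s / 3 + 1/3))" for j
  let ?x = "p$1"
  \<comment> \<open>Up to integers the right ends permute the left ends. The integers are 2, 3, 0 on
    this piece and 3, 2 on the other; both sums are 5.\<close>
  have low: "(\<Sum>j\<in>J. F j) = F (n - 1) + F n + F (n + 1)" "l (n - 1) = 3 * s" "l n = -3/2 + s/2" "l (n + 1) = -1 - 2 * s"
      "?x - r (n - 1) = (?x - (-1 - 2 * s)) - of_int 2" "?x - r n = (?x - (-3/2 + s/2)) - of_int 3" "r (n + 1) = 3 * s"
    if "s < 1/5" for F :: "int \<Rightarrow> int"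
    using that by (simp_all add: J_def l_def r_def)
  have high: "(\<Sum>j\<in>J. F j) = F n + F (n + 1)" "l n = -5/3 + 4 * s / 3" "l (n + 1) = -4/3 - s/3"
      "?x - r n = (?x - (-4/3 - s/3)) - of_int 3" "?x - r (n + 1) = (?x - (-5/3 + 4 * s / 3)) - of_int 2"
    if "\<not> s < 1/5" for F :: "int \<Rightarrow> int"
    using that by (simp_all add: J_def l_def r_def)
  show "5 \<le> cover_count decagon.body lattice p"
  proof -
    have "(\<Sum>j\<in>J. \<lfloor>?x - l j\<rfloor> - \<lceil>?x - r j\<rceil> + 1) \<le> int (cover_count decagon.body lattice p)"
    proof (rule lattice_count_ge)
      fix i j assume "j \<in> J" "l j \<le> ?x - of_int i" "?x - of_int i \<le> r j"
      then show "pt (?x - of_int i) (p$2 - of_int j) \<in> decagon.body"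
        using s unfolding decagon_body y J_def l_def r_def by (auto split: if_splits simp: abs_le_iff)
    qed (auto simp: J_def bd)
    moreover have "5 \<le> (\<Sum>j\<in>J. \<lfloor>?x - l j\<rfloor> - \<lceil>?x - r j\<rceil> + 1)"
    proof (cases "s < 1/5")
      case True
      show ?thesis unfolding low[OF True]
        using closed_gap[of 2 "?x - (-1 - 2 * s)"] closed_gap[of 3 "?x - (-3/2 + s/2)"] closed_gap_0[of "?x - 3 * s"] by linarith
    next
      case False
      show ?thesis unfolding high[OF False]
        using closed_gap[of 3 "?x - (-4/3 - s/3)"] closed_gap[of 2 "?x - (-5/3 + 4 * s / 3)"] by linarith
    qed
    ultimately show ?thesis by linarith
  qed
  show "cover_count (interior decagon.body) lattice p \<le> 5"
  proof -
    have "int (cover_count (interior decagon.body) lattice p) \<le> (\<Sum>j\<in>J. \<lceil>?x - l j\<rceil> - \<lfloor>?x - r j\<rfloor> - 1)"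
    proof (rule lattice_count_le)
      show "j \<in> J \<Longrightarrow> l j < r j" for j using s by (auto simp: J_def l_def r_def)
      fix i j assume "pt (?x - of_int i) (p$2 - of_int j) \<in> interior decagon.body"
      then have *: "\<bar>(s + of_int (n - j)) - 2 * (?x - of_int i)\<bar> < 3" "\<bar>(s + of_int (n - j)) + 3 * (?x - of_int i)\<bar> < 5"
        "\<bar>2 * (s + of_int (n - j)) + (?x - of_int i)\<bar> < 3" "\<bar>3 * (s + of_int (n - j)) - (?x - of_int i)\<bar> < 3"
        "\<bar>4 * (s + of_int (n - j)) - 3 * (?x - of_int i)\<bar> < 5"
        unfolding decagon_interior y by blast+
      \<comment> \<open>Adding the two strips gives \<open>5 * a < 6\<close>: they belong to the
        sides that meet at the top vertex, whose height is 6/5.\<close>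
      have "\<bar>a\<bar> < 6/5" if "\<bar>2 * a + b\<bar> < 3" "\<bar>3 * a - b\<bar> < 3" for a b :: real
        using that unfolding abs_less_iff by linarith
      from this[OF *(3,4)] have h: "\<bar>s + of_int (n - j)\<bar> < 6/5" .
      show "j \<in> J \<and> l j < ?x - of_int i \<and> ?x - of_int i < r j"
      proof (cases "s < 1/5")
        case True
        then have "real_of_int (n - j) < 2" "real_of_int (n - j) > - 2" using h s by linarith+
        then have "n - j < 2" "n - j > - 2" by linarith+
        then consider "j = n - 1" | "j = n" | "j = n + 1" by linarith
        then show ?thesis using True * by cases (auto simp: J_def l_def r_def)
      next
        case False
        then have "real_of_int (n - j) < 1" "real_of_int (n - j) > - 2" using h s by linarith+
        then have "n - j < 1" "n - j > - 2" by linarith+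
        then consider "j = n" | "j = n + 1" by linarith
        then show ?thesis using False * by cases (auto simp: J_def l_def r_def)
      qed
    qed (simp add: J_def)
    moreover have "(\<Sum>j\<in>J. \<lceil>?x - l j\<rceil> - \<lfloor>?x - r j\<rfloor> - 1) \<le> 5"
    proof (cases "s < 1/5")
      case True
      show ?thesis unfolding low[OF True]
        using open_gap[of "?x - (-1 - 2 * s)" 2] open_gap[of "?x - (-3/2 + s/2)" 3] open_gap_0[of "?x - 3 * s"] by linarith
    next
      case False
      show ?thesis unfolding high[OF False]
        using open_gap[of "?x - (-4/3 - s/3)" 3] open_gap[of "?x - (-5/3 + 4 * s / 3)" 2] by linarith
    qed
    ultimately show ?thesis by linarith
  qed
qed

lemma octagon_tiling: "kfold_tiling 5 octagon.body lattice"
  unfolding kfold_tiling_def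
proof (intro conjI allI)
  fix p :: plane
  \<comment> \<open>All vertex heights are integers, so no case distinction on \<open>s\<close>
    arises.\<close>
  define n where "n = \<lfloor>p$2\<rfloor>"
  define s where "s = p$2 - of_int n"
  have s: "0 \<le> s" "s < 1" by (auto simp: s_def n_def) linarith+
  have y: "p$2 - of_int j = s + of_int (n - j)" for j by (simp add: s_def)
  have bd: "bounded octagon.body" using octagon.body_compact compact_imp_bounded by blast
  define J where "J = {n - 1, n, n + 1, n + 2}"
  define l where "l j = (if j = n - 1 then -3/10 + 3 * s / 5 else if j = n then -7/10 + 2 * s / 5
     else if j = n + 1 then -1 + 3 * s / 10 else -13/10 + 3 * s / 10)" for j
  define r where "r j = (if j = n - 1 then 1 + 3 * s / 10 else if j = n then 7/10 + 3 * s / 10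
     else if j = n + 1 then 3/10 + 2 * s / 5 else -3/10 + 3 * s / 5)" for j
  let ?x = "p$1"
  \<comment> \<open>The right ends are the left ends of other rows shifted by 2, 2, 1 and 0, five in
    total.\<close>
  have rows: "(\<Sum>j\<in>J. F j) = F (n - 1) + F n + F (n + 1) + F (n + 2)" "l (n - 1) = -3/10 + 3 * s / 5"
      "l n = -7/10 + 2 * s / 5" "l (n + 1) = -1 + 3 * s / 10" "l (n + 2) = -13/10 + 3 * s / 10"
      "?x - r (n - 1) = (?x - (-1 + 3 * s / 10)) - of_int 2" "?x - r n = (?x - (-13/10 + 3 * s / 10)) - of_int 2"
      "?x - r (n + 1) = (?x - (-7/10 + 2 * s / 5)) - of_int 1" "r (n + 2) = -3/10 + 3 * s / 5"
    for F :: "int \<Rightarrow> int"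
    by (simp_all add: J_def l_def r_def)
  show "5 \<le> cover_count octagon.body lattice p"
  proof -
    have "(\<Sum>j\<in>J. \<lfloor>?x - l j\<rfloor> - \<lceil>?x - r j\<rceil> + 1) \<le> int (cover_count octagon.body lattice p)"
    proof (rule lattice_count_ge)
      fix i j assume "j \<in> J" "l j \<le> ?x - of_int i" "?x - of_int i \<le> r j"
      then show "pt (?x - of_int i) (p$2 - of_int j) \<in> octagon.body"
        using s unfolding octagon_body y J_def l_def r_def by (auto split: if_splits simp: abs_le_iff)
    qed (auto simp: J_def bd)
    moreover have "5 \<le> (\<Sum>j\<in>J. \<lfloor>?x - l j\<rfloor> - \<lceil>?x - r j\<rceil> + 1)"
      unfolding rows
      using closed_gap[of 2 "?x - (-1 + 3 * s / 10)"] closed_gap[of 2 "?x - (-13/10 + 3 * s / 10)"]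
        closed_gap[of 1 "?x - (-7/10 + 2 * s / 5)"] closed_gap_0[of "?x - (-3/10 + 3 * s / 5)"]
      by linarith
    ultimately show ?thesis by linarith
  qed
  show "cover_count (interior octagon.body) lattice p \<le> 5"
  proof -
    have "int (cover_count (interior octagon.body) lattice p) \<le> (\<Sum>j\<in>J. \<lceil>?x - l j\<rceil> - \<lfloor>?x - r j\<rfloor> - 1)"
    proof (rule lattice_count_le)
      show "j \<in> J \<Longrightarrow> l j < r j" for j using s by (auto simp: J_def l_def r_def)
      fix i j assume "pt (?x - of_int i) (p$2 - of_int j) \<in> interior octagon.body"
      then have *: "\<bar>s + of_int (n - j)\<bar> < 2" "\<bar>6 * (s + of_int (n - j)) - 10 * (?x - of_int i)\<bar> < 9"
        "\<bar>4 * (s + of_int (n - j)) - 10 * (?x - of_int i)\<bar> < 7" "\<bar>3 * (s + of_int (n - j)) - 10 * (?x - of_int i)\<bar> < 7"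
        unfolding octagon_interior y by blast+
      then have "real_of_int (n - j) < 2" "real_of_int (n - j) > - 3" using s by linarith+
      then have "n - j < 2" "n - j > - 3" by linarith+
      then consider "j = n - 1" | "j = n" | "j = n + 1" | "j = n + 2" by linarith
      then show "j \<in> J \<and> l j < ?x - of_int i \<and> ?x - of_int i < r j"
        using * by cases (auto simp: J_def l_def r_def)
    qed (simp add: J_def)
    moreover have "(\<Sum>j\<in>J. \<lceil>?x - l j\<rceil> - \<lfloor>?x - r j\<rfloor> - 1) \<le> 5"
      unfolding rows
      using open_gap[of "?x - (-1 + 3 * s / 10)" 2] open_gap[of "?x - (-13/10 + 3 * s / 10)" 2]
        open_gap[of "?x - (-7/10 + 2 * s / 5)" 1] open_gap_0[of "?x - (-3/10 + 3 * s / 5)"]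
      by linarith
    ultimately show ?thesis by linarith
  qed
qed

lemma many_vertices_not_parallelogram:
  assumes "convex_ngon n K" "n > 4" shows "\<not> parallelogram K"
proof
  assume "parallelogram K"
  then obtain a u v where K: "K = convex hull {a, a + u, a + u + v, a + v}" by (auto simp: parallelogram_def)
  have "{x. x extreme_point_of K} \<subseteq> {a, a + u, a + u + v, a + v}"
    unfolding K using extreme_points_of_convex_hull by blast
  then have "card {x. x extreme_point_of K} \<le> card {a, a + u, a + u + v, a + v}"
    by (intro card_mono) auto
  also have "\<dots> \<le> 4" by (simp add: card_insert_if)
  finally show False using assms by (simp add: convex_ngon_def)
qed

lemma tau_eq_5:
  assumes "convex_ngon n K" "n > 6" "kfold_tiling 5 K lattice"
  shows "tau K = 5"
proof (rule antisym)
  have "n \<noteq> 6" using assms(2) by simp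
  then have "\<not> convex_ngon 6 K" using assms(1) by (simp add: convex_ngon_def)
  moreover have "\<not> parallelogram K" using many_vertices_not_parallelogram[OF assms(1)] assms(2) by simp
  moreover have "convex_domain K" using assms(1) by (simp add: convex_ngon_def)
  ultimately show "5 \<le> tau K" by (intro tau_ge_5) auto
  have "enat 5 \<in> {enat k | k. k > 0 \<and> (\<exists>X. discrete_mset X \<and> kfold_tiling k K X)}"
    using discrete_lattice assms(3) by auto
  then have "tau K \<le> enat 5" unfolding tau_def by (rule Inf_lower)
  then show "tau K \<le> 5" by (simp add: numeral_eq_enat)
qed

theorem theorem2:
  "(\<forall>D. convex_domain D \<and> \<not> parallelogram D \<and> \<not> (convex_ngon 6 D \<and> centrally_symmetric D)
        \<longrightarrow> tau D \<ge> 5)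
   \<and> (\<exists>D. convex_ngon 8 D \<and> centrally_symmetric D \<and> tau D = 5)
   \<and> (\<exists>D. convex_ngon 10 D \<and> centrally_symmetric D \<and> tau D = 5)"
proof (intro conjI)
  show "\<forall>D. convex_domain D \<and> \<not> parallelogram D \<and> \<not> (convex_ngon 6 D \<and> centrally_symmetric D)
        \<longrightarrow> tau D \<ge> 5"
    using tau_ge_5 by blast
  have "convex_ngon 8 octagon.body" using octagon.convex_ngon_body by simp
  then show "\<exists>D. convex_ngon 8 D \<and> centrally_symmetric D \<and> tau D = 5"
    using octagon.centrally_symmetric_body tau_eq_5[OF _ _ octagon_tiling] by (intro exI[of _ octagon.body]) auto
  have "convex_ngon 10 decagon.body" using decagon.convex_ngon_body by simp
  then show "\<exists>D. convex_ngon 10 D \<and> centrally_symmetric D \<and> tau D = 5"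
    using decagon.centrally_symmetric_body tau_eq_5[OF _ _ decagon_tiling] by (intro exI[of _ decagon.body]) auto
qed

end
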